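(* Let $\mathrm{HA}^{\omega}$ be extensional Heyting arithmetic in all finite types. For any closed term $Y \colon \mathbb{N}^{\mathbb{N}} \to \mathbb{N}$ of $\mathrm{HA}^{\omega}$, there is a closed term $\gamma \colon \mathbb{N}^{*} \to \mathbb{N}$ of $\mathrm{HA}^{\omega}$ such that (1) $\mathrm{HA}^{\omega} \vdash$ "$\gamma$ is a neighbourhood function of $Y$", and (2) for any predicate $Q$ on $\mathbb{N}^{*}$ (i.e. any formula $Q(a)$ of $\mathrm{HA}^{\omega}$ with a distinguished variable $a$ of type $\mathbb{N}^*$), $$\mathrm{HA}^{\omega} \vdash \forall a^{\mathbb{N}^*}\,[\gamma(a)>0 \to Q(a)] \wedge \forall a^{\mathbb{N}^{*}} \left[ \forall n^{\mathbb{N}} Q(a * \langle n \rangle) \to Q(a) \right] \to Q(\langle\, \rangle).$$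
   Context: $\mathrm{HA}^{\omega}$ is extensional Heyting arithmetic in all finite types (with lambda abstraction): finite types are built from $\mathbb{N}$ by $\to$; terms are those of simply typed lambda calculus with constants $0\colon\mathbb{N}$, $\mathsf{Succ}\colon\mathbb{N}\to\mathbb{N}$ and Gödel recursors $\mathsf{Rec}_\rho\colon \rho\to(\mathbb{N}\to\rho\to\rho)\to\mathbb{N}\to\rho$ (i.e. the terms of Gödel's system $\mathsf{T}$); prime formulas are equations between terms of the same type. Finite sequences of natural numbers ($\mathbb{N}^*$) are identified with natural numbers via a fixed bijective coding; $\langle\,\rangle$ is the empty sequence, $\langle n\rangle$ a singleton, $a*b$ concatenation, $|a|$ length, $\overline{\alpha}n$ the initial segment of $\alpha$ of length $n$, and $\dot-$ cut-off subtraction. A function $\gamma\colon\mathbb{N}^*\to\mathbb{N}$ is a neighbourhood function if (i) $\forall \alpha^{\mathbb{N}^{\mathbb{N}}}\exists n\, \gamma(\overline{\alpha}n)>0$ and (ii) $\forall a\,[\gamma(a)>0 \to \forall b\, \gamma(a)=\gamma(a*b)]$. It is a neighbourhood function of (induces) $f\colon\mathbb{N}^{\mathbb{N}}\to\mathbb{N}$ if moreover $\forall\alpha\forall n\,[\gamma(\overline{\alpha}n)>0 \to f(\alpha)=\gamma(\overline{\alpha}n)\dot- 1]$. *)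

theory Defs
  imports Main
begin

section \<open>Types, terms and formulas\<close>

text \<open>
  Binding is represented by de Bruijn indices throughout. A context is a list of types, whose
  \<open>i\<close>-th entry is the type of the variable with index \<open>i\<close>.
\<close>

datatype ty = N | Fn ty ty  (infixr "\<leadsto>" 65)

datatype tm =
    Var nat
  | Zero
  | Succ
  | Rec ty
  | App tm tm  (infixl "\<cdot>" 200)
  | Lam ty tm

inductive has_type :: "ty list \<Rightarrow> tm \<Rightarrow> ty \<Rightarrow> bool"  ("_ \<turnstile> _ \<Colon> _" [50, 50, 50] 50) where
  Var: "i < length \<Gamma> \<Longrightarrow> \<Gamma> \<turnstile> Var i \<Colon> \<Gamma> ! i"
| Zero: "\<Gamma> \<turnstile> Zero \<Colon> N"
| Succ: "\<Gamma> \<turnstile> Succ \<Colon> N \<leadsto> N"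
| Rec: "\<Gamma> \<turnstile> Rec \<rho> \<Colon> \<rho> \<leadsto> (N \<leadsto> \<rho> \<leadsto> \<rho>) \<leadsto> N \<leadsto> \<rho>"
| App: "\<Gamma> \<turnstile> t \<Colon> \<rho> \<leadsto> \<sigma> \<Longrightarrow> \<Gamma> \<turnstile> s \<Colon> \<rho> \<Longrightarrow> \<Gamma> \<turnstile> t \<cdot> s \<Colon> \<sigma>"
| Lam: "\<rho> # \<Gamma> \<turnstile> t \<Colon> \<sigma> \<Longrightarrow> \<Gamma> \<turnstile> Lam \<rho> t \<Colon> \<rho> \<leadsto> \<sigma>"

datatype fm =
    Eq ty tm tm
  | Bot
  | Conj fm fm  (infixr "\<^bold>\<and>" 135)
  | Disj fm fm  (infixr "\<^bold>\<or>" 130)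
  | Imp fm fm  (infixr "\<^bold>\<longrightarrow>" 125)
  | Forall ty fm
  | Exists ty fm

fun wff :: "ty list \<Rightarrow> fm \<Rightarrow> bool" where
  "wff \<Gamma> (Eq \<rho> s t) \<longleftrightarrow> (\<Gamma> \<turnstile> s \<Colon> \<rho>) \<and> (\<Gamma> \<turnstile> t \<Colon> \<rho>)"
| "wff \<Gamma> Bot \<longleftrightarrow> True"
| "wff \<Gamma> (A \<^bold>\<and> B) \<longleftrightarrow> wff \<Gamma> A \<and> wff \<Gamma> B"
| "wff \<Gamma> (A \<^bold>\<or> B) \<longleftrightarrow> wff \<Gamma> A \<and> wff \<Gamma> B"
| "wff \<Gamma> (A \<^bold>\<longrightarrow> B) \<longleftrightarrow> wff \<Gamma> A \<and> wff \<Gamma> B"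
| "wff \<Gamma> (Forall \<rho> A) \<longleftrightarrow> wff (\<rho> # \<Gamma>) A"
| "wff \<Gamma> (Exists \<rho> A) \<longleftrightarrow> wff (\<rho> # \<Gamma>) A"

section \<open>Substitution\<close>

definition up_ren :: "(nat \<Rightarrow> nat) \<Rightarrow> nat \<Rightarrow> nat" where
  "up_ren r = case_nat 0 (\<lambda>i. Suc (r i))"

fun ren :: "(nat \<Rightarrow> nat) \<Rightarrow> tm \<Rightarrow> tm" where
  "ren r (Var i) = Var (r i)"
| "ren r (t \<cdot> s) = ren r t \<cdot> ren r s"
| "ren r (Lam \<rho> t) = Lam \<rho> (ren (up_ren r) t)"
| "ren r Zero = Zero"
| "ren r Succ = Succ"
| "ren r (Rec \<rho>) = Rec \<rho>"

abbreviation lift :: "tm \<Rightarrow> tm" where "lift \<equiv> ren Suc"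

definition up :: "(nat \<Rightarrow> tm) \<Rightarrow> nat \<Rightarrow> tm" where
  "up f = case_nat (Var 0) (\<lambda>i. lift (f i))"

fun sub :: "(nat \<Rightarrow> tm) \<Rightarrow> tm \<Rightarrow> tm" where
  "sub f (Var i) = f i"
| "sub f (t \<cdot> s) = sub f t \<cdot> sub f s"
| "sub f (Lam \<rho> t) = Lam \<rho> (sub (up f) t)"
| "sub f Zero = Zero"
| "sub f Succ = Succ"
| "sub f (Rec \<rho>) = Rec \<rho>"

fun fsub :: "(nat \<Rightarrow> tm) \<Rightarrow> fm \<Rightarrow> fm" where
  "fsub f (Eq \<rho> s t) = Eq \<rho> (sub f s) (sub f t)"
| "fsub f Bot = Bot"
| "fsub f (A \<^bold>\<and> B) = (fsub f A \<^bold>\<and> fsub f B)"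
| "fsub f (A \<^bold>\<or> B) = (fsub f A \<^bold>\<or> fsub f B)"
| "fsub f (A \<^bold>\<longrightarrow> B) = (fsub f A \<^bold>\<longrightarrow> fsub f B)"
| "fsub f (Forall \<rho> A) = Forall \<rho> (fsub (up f) A)"
| "fsub f (Exists \<rho> A) = Exists \<rho> (fsub (up f) A)"

text \<open>\<open>inst t\<close> replaces variable \<open>0\<close> by \<open>t\<close> and removes it from the context.\<close>

definition inst :: "tm \<Rightarrow> nat \<Rightarrow> tm" where
  "inst t = case_nat t Var"

definition flift :: "fm \<Rightarrow> fm" where
  "flift = fsub (\<lambda>i. Var (Suc i))"

section \<open>Derivability\<close>

text \<open>
  Intuitionistic natural deduction. \<open>HA \<Gamma> \<Delta> A\<close> means that \<open>A\<close> is derivable from the assumptions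
  \<open>\<Delta>\<close>, where the free variables have the types given by \<open>\<Gamma>\<close>.
\<close>

inductive HA :: "ty list \<Rightarrow> fm list \<Rightarrow> fm \<Rightarrow> bool" where
  Hyp: "A \<in> set \<Delta> \<Longrightarrow> HA \<Gamma> \<Delta> A"
| BotE: "HA \<Gamma> \<Delta> Bot \<Longrightarrow> wff \<Gamma> A \<Longrightarrow> HA \<Gamma> \<Delta> A"
| ConjI: "HA \<Gamma> \<Delta> A \<Longrightarrow> HA \<Gamma> \<Delta> B \<Longrightarrow> HA \<Gamma> \<Delta> (A \<^bold>\<and> B)"
| ConjE1: "HA \<Gamma> \<Delta> (A \<^bold>\<and> B) \<Longrightarrow> HA \<Gamma> \<Delta> A"
| ConjE2: "HA \<Gamma> \<Delta> (A \<^bold>\<and> B) \<Longrightarrow> HA \<Gamma> \<Delta> B"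
| DisjI1: "HA \<Gamma> \<Delta> A \<Longrightarrow> wff \<Gamma> B \<Longrightarrow> HA \<Gamma> \<Delta> (A \<^bold>\<or> B)"
| DisjI2: "HA \<Gamma> \<Delta> B \<Longrightarrow> wff \<Gamma> A \<Longrightarrow> HA \<Gamma> \<Delta> (A \<^bold>\<or> B)"
| DisjE: "HA \<Gamma> \<Delta> (A \<^bold>\<or> B) \<Longrightarrow> HA \<Gamma> (A # \<Delta>) C \<Longrightarrow> HA \<Gamma> (B # \<Delta>) C \<Longrightarrow> HA \<Gamma> \<Delta> C"
| ImpI: "wff \<Gamma> A \<Longrightarrow> HA \<Gamma> (A # \<Delta>) B \<Longrightarrow> HA \<Gamma> \<Delta> (A \<^bold>\<longrightarrow> B)"
| ImpE: "HA \<Gamma> \<Delta> (A \<^bold>\<longrightarrow> B) \<Longrightarrow> HA \<Gamma> \<Delta> A \<Longrightarrow> HA \<Gamma> \<Delta> B"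
| ForallI: "HA (\<rho> # \<Gamma>) (map flift \<Delta>) A \<Longrightarrow> HA \<Gamma> \<Delta> (Forall \<rho> A)"
| ForallE: "HA \<Gamma> \<Delta> (Forall \<rho> A) \<Longrightarrow> \<Gamma> \<turnstile> t \<Colon> \<rho> \<Longrightarrow> HA \<Gamma> \<Delta> (fsub (inst t) A)"
| ExistsI: "wff (\<rho> # \<Gamma>) A \<Longrightarrow> \<Gamma> \<turnstile> t \<Colon> \<rho> \<Longrightarrow> HA \<Gamma> \<Delta> (fsub (inst t) A) \<Longrightarrow> HA \<Gamma> \<Delta> (Exists \<rho> A)"
| ExistsE: "HA \<Gamma> \<Delta> (Exists \<rho> A) \<Longrightarrow> wff \<Gamma> C \<Longrightarrow>
    HA (\<rho> # \<Gamma>) (A # map flift \<Delta>) (flift C) \<Longrightarrow> HA \<Gamma> \<Delta> C"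
| EqRefl: "\<Gamma> \<turnstile> t \<Colon> \<rho> \<Longrightarrow> HA \<Gamma> \<Delta> (Eq \<rho> t t)"
| EqSubst: "wff (\<rho> # \<Gamma>) A \<Longrightarrow> HA \<Gamma> \<Delta> (Eq \<rho> s t) \<Longrightarrow>
    HA \<Gamma> \<Delta> (fsub (inst s) A) \<Longrightarrow> HA \<Gamma> \<Delta> (fsub (inst t) A)"
| Ext: "\<Gamma> \<turnstile> s \<Colon> \<rho> \<leadsto> \<sigma> \<Longrightarrow> \<Gamma> \<turnstile> t \<Colon> \<rho> \<leadsto> \<sigma> \<Longrightarrow>
    HA \<Gamma> \<Delta> (Forall \<rho> (Eq \<sigma> (lift s \<cdot> Var 0) (lift t \<cdot> Var 0))) \<Longrightarrow> HA \<Gamma> \<Delta> (Eq (\<rho> \<leadsto> \<sigma>) s t)"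
| Beta: "\<rho> # \<Gamma> \<turnstile> t \<Colon> \<sigma> \<Longrightarrow> \<Gamma> \<turnstile> s \<Colon> \<rho> \<Longrightarrow> HA \<Gamma> \<Delta> (Eq \<sigma> (Lam \<rho> t \<cdot> s) (sub (inst s) t))"
| Rec_Zero: "\<Gamma> \<turnstile> s \<Colon> \<rho> \<Longrightarrow> \<Gamma> \<turnstile> t \<Colon> N \<leadsto> \<rho> \<leadsto> \<rho> \<Longrightarrow>
    HA \<Gamma> \<Delta> (Eq \<rho> (Rec \<rho> \<cdot> s \<cdot> t \<cdot> Zero) s)"
| Rec_Succ: "\<Gamma> \<turnstile> s \<Colon> \<rho> \<Longrightarrow> \<Gamma> \<turnstile> t \<Colon> N \<leadsto> \<rho> \<leadsto> \<rho> \<Longrightarrow> \<Gamma> \<turnstile> n \<Colon> N \<Longrightarrow>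
    HA \<Gamma> \<Delta> (Eq \<rho> (Rec \<rho> \<cdot> s \<cdot> t \<cdot> (Succ \<cdot> n)) (t \<cdot> n \<cdot> (Rec \<rho> \<cdot> s \<cdot> t \<cdot> n)))"
| Succ_inj: "HA \<Gamma> \<Delta> (Eq N (Succ \<cdot> s) (Succ \<cdot> t)) \<Longrightarrow> HA \<Gamma> \<Delta> (Eq N s t)"
| Succ_not_Zero: "HA \<Gamma> \<Delta> (Eq N (Succ \<cdot> t) Zero) \<Longrightarrow> HA \<Gamma> \<Delta> Bot"
| Induct: "wff (N # \<Gamma>) A \<Longrightarrow> HA \<Gamma> \<Delta> (fsub (inst Zero) A) \<Longrightarrow>
    HA \<Gamma> \<Delta> (Forall N (A \<^bold>\<longrightarrow> fsub (case_nat (Succ \<cdot> Var 0) (\<lambda>i. Var (Suc i))) A)) \<Longrightarrow>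
    HA \<Gamma> \<Delta> (Forall N A)"

section \<open>Arithmetic and coding of finite sequences\<close>

text \<open>
  The terms below are closed, so they may be used under binders without lifting.
\<close>

definition plus_tm :: tm where  \<comment> \<open>\<open>m + 0 = m\<close>, \<open>m + Succ n = Succ (m + n)\<close>\<close>
  "plus_tm = Lam N (Rec N \<cdot> Var 0 \<cdot> Lam N Succ)"

definition pred_tm :: tm where
  "pred_tm = Rec N \<cdot> Zero \<cdot> Lam N (Lam N (Var 1))"

definition monus_tm :: tm where  \<comment> \<open>\<open>m - 0 = m\<close>, \<open>m - Succ n = pred (m - n)\<close>\<close>
  "monus_tm = Lam N (Rec N \<cdot> Var 0 \<cdot> Lam N pred_tm)"

definition less_fm :: "tm \<Rightarrow> tm \<Rightarrow> fm" where  \<comment> \<open>\<open>\<exists>k. s + Succ k = t\<close>\<close>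
  "less_fm s t = Exists N (Eq N (plus_tm \<cdot> lift s \<cdot> (Succ \<cdot> Var 0)) (lift t))"

definition triangle_tm :: tm where
  "triangle_tm = Rec N \<cdot> Zero \<cdot> Lam N (Lam N (plus_tm \<cdot> Var 0 \<cdot> (Succ \<cdot> Var 1)))"

text \<open>
  Cantor's bijection \<open>pair m n = triangle (m + n) + m\<close>, which is \<open>prod_encode\<close> of
  \<open>HOL-Library.Nat_Bijection\<close>. Its inverse is presented by
  \<open>unpair k c = c m n\<close> for \<open>k = pair m n\<close>, computed by running through the diagonals: the successor
  of \<open>(m, Succ n)\<close> is \<open>(Succ m, n)\<close>, and that of \<open>(m, 0)\<close> is \<open>(0, Succ m)\<close>.
\<close>

definition pair_tm :: tm where
  "pair_tm = Lam N (Lam N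
     (plus_tm \<cdot> (triangle_tm \<cdot> (plus_tm \<cdot> Var 1 \<cdot> Var 0)) \<cdot> Var 1))"

definition unpair_tm :: tm where
  "unpair_tm = Rec ((N \<leadsto> N \<leadsto> N) \<leadsto> N)
     \<cdot> Lam (N \<leadsto> N \<leadsto> N) (Var 0 \<cdot> Zero \<cdot> Zero)
     \<cdot> Lam N (Lam ((N \<leadsto> N \<leadsto> N) \<leadsto> N) (Lam (N \<leadsto> N \<leadsto> N)
         (Var 1 \<cdot> Lam N (Lam N
            (Rec N \<cdot> (Var 2 \<cdot> Zero \<cdot> (Succ \<cdot> Var 1))
                   \<cdot> Lam N (Lam N (Var 4 \<cdot> (Succ \<cdot> Var 3) \<cdot> Var 1))
                   \<cdot> Var 0)))))"

definition fst_tm :: tm where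
  "fst_tm = Lam N (unpair_tm \<cdot> Var 0 \<cdot> Lam N (Lam N (Var 1)))"

definition snd_tm :: tm where
  "snd_tm = Lam N (unpair_tm \<cdot> Var 0 \<cdot> Lam N (Lam N (Var 0)))"

text \<open>
  The coding of \<open>\<nat>\<^sup>*\<close> by \<open>\<nat>\<close>: the empty sequence has code \<open>0\<close>, and \<open>a * \<langle>n\<rangle>\<close> has code
  \<open>Succ (pair a n)\<close>. This is a bijection, since \<open>pair\<close> is.
\<close>

abbreviation (input) Seq :: ty where "Seq \<equiv> N"

definition nil_tm :: tm where
  "nil_tm = Zero"

definition single_tm :: tm where
  "single_tm = Lam N (Succ \<cdot> (pair_tm \<cdot> nil_tm \<cdot> Var 0))"

text \<open>
  Concatenation satisfies \<open>a * 0 = a\<close> and \<open>a * Succ c = Succ (pair (a * fst c) (snd c))\<close>.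
  As \<open>fst c\<close> is smaller than \<open>Succ c\<close>, this is defined by iterating \<open>b\<close> many times on \<open>b\<close>.
\<close>

definition append_tm :: tm where
  "append_tm = Lam Seq (Lam Seq
     (Rec (Seq \<leadsto> Seq)
        \<cdot> Lam Seq (Var 2)
        \<cdot> Lam N (Lam (Seq \<leadsto> Seq) (Lam Seq
            (Rec Seq \<cdot> Var 4
               \<cdot> Lam N (Lam Seq (Succ \<cdot> (pair_tm \<cdot> (Var 3 \<cdot> (fst_tm \<cdot> Var 1)) \<cdot> (snd_tm \<cdot> Var 1))))
               \<cdot> Var 0)))
        \<cdot> Var 0 \<cdot> Var 0))"

text \<open>Initial segments \<open>seg \<alpha> n = \<langle>\<alpha> 0, \<dots>, \<alpha> (n - 1)\<rangle>\<close>.\<close>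

definition seg_tm :: tm where
  "seg_tm = Lam (N \<leadsto> N)
     (Rec Seq \<cdot> nil_tm \<cdot> Lam N (Lam Seq (append_tm \<cdot> Var 0 \<cdot> (single_tm \<cdot> (Var 2 \<cdot> Var 1)))))"

section \<open>Neighbourhood functions and bar induction\<close>

text \<open>In the following formulas \<open>\<gamma>\<close> and \<open>Y\<close> stand for closed terms, hence are not lifted.\<close>

definition nbhd :: "tm \<Rightarrow> fm" where
  "nbhd \<gamma> =
     (Forall (N \<leadsto> N) (Exists N (less_fm Zero (\<gamma> \<cdot> (seg_tm \<cdot> Var 1 \<cdot> Var 0)))) \<^bold>\<and>
      Forall Seq (less_fm Zero (\<gamma> \<cdot> Var 0) \<^bold>\<longrightarrow>
        Forall Seq (Eq N (\<gamma> \<cdot> Var 1) (\<gamma> \<cdot> (append_tm \<cdot> Var 1 \<cdot> Var 0)))))"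

definition nbhd_of :: "tm \<Rightarrow> tm \<Rightarrow> fm" where
  "nbhd_of \<gamma> Y =
     (nbhd \<gamma> \<^bold>\<and>
      Forall (N \<leadsto> N) (Forall N (less_fm Zero (\<gamma> \<cdot> (seg_tm \<cdot> Var 1 \<cdot> Var 0)) \<^bold>\<longrightarrow>
        Eq N (Y \<cdot> Var 1) (monus_tm \<cdot> (\<gamma> \<cdot> (seg_tm \<cdot> Var 1 \<cdot> Var 0)) \<cdot> (Succ \<cdot> Zero)))))"

text \<open>
  Variable \<open>0\<close> of \<open>Q\<close> is the distinguished variable \<open>a\<close>; the other variables of \<open>Q\<close> are parameters.
  \<open>at_snoc Q\<close> is \<open>Q(a * \<langle>n\<rangle>)\<close>, with \<open>n\<close> as variable \<open>0\<close>, \<open>a\<close> as variable \<open>1\<close> and the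
  parameters shifted accordingly.
\<close>

definition at_snoc :: "fm \<Rightarrow> fm" where
  "at_snoc Q =
     fsub (case_nat (append_tm \<cdot> Var 1 \<cdot> (single_tm \<cdot> Var 0)) (\<lambda>i. Var (Suc (Suc i)))) Q"

definition bar_ind :: "tm \<Rightarrow> fm \<Rightarrow> fm" where
  "bar_ind \<gamma> Q =
     (Forall Seq (less_fm Zero (\<gamma> \<cdot> Var 0) \<^bold>\<longrightarrow> Q) \<^bold>\<and>
      Forall Seq (Forall N (at_snoc Q) \<^bold>\<longrightarrow> Q)
      \<^bold>\<longrightarrow> fsub (inst nil_tm) Q)"

end

theory Submission
  imports Defs
begin

text \<open>
  The terms of system T are translated into system T by the monad whose computations of type \<open>N\<close>
  are functions \<open>g : Seq \<leadsto> N\<close>: \<open>g a = Succ m\<close> means that the value \<open>m\<close> is determined by the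
  initial segment \<open>a\<close>, and \<open>g a = 0\<close> that more input is needed. Applying the translation of \<open>Y\<close>
  to a generic sequence, which looks up its entries in \<open>a\<close>, gives \<open>\<gamma>\<close>.

  For a sequence \<open>\<alpha>\<close> and a progressive formula \<open>Q\<close>, a number \<open>x\<close> is related to \<open>g\<close> if \<open>g\<close> is
  monotone, returns \<open>x\<close> along \<open>\<alpha>\<close>, and admits bar induction for \<open>Q\<close> above every node. This relation
  is a formula of \<open>HA\<^sup>\<omega>\<close>, it is preserved by unit and bind, and hence extends to a logical relation
  at all types, for which every term is provably related to its translation. As \<open>\<gamma>\<close> does not
  depend on \<open>Q\<close>, this gives bar induction for all \<open>Q\<close>. Bar induction for the formula
  ``if \<open>a\<close> is an initial segment of \<open>\<alpha>\<close>, then \<open>\<gamma>\<close> is positive somewhere along \<open>\<alpha>\<close>'' finally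
  shows that \<open>\<gamma>\<close> is defined on every sequence.
\<close>

section \<open>Typing and substitution\<close>

text \<open>The obstacle is that every claim has to become a derivation in a de Bruijn calculus. A
  world is a context with hypotheses, and derivability in a world behaves like Kripke forcing:
  implications and universal quantifiers range over later worlds. Terms modulo provable equality
  form a model in which beta reduction and the recursor equations are rewrite rules, so that simp
  runs the terms of system T. Induction must still be that of HA, which is why so many claims about
  codes are cast as equations. Of the closure properties of the base relation, only the one for the
  generic sequence uses that Q is progressive: every one-step extension of a node that has all
  entries below m has entry m. Unit and bind merely transport bars. The induction on Y takes place
  in the metalanguage, because the relation at a type is a formula that grows with the type. HA
  contributes one derivation for each term.\<close>

fun apty :: "ty option \<Rightarrow> ty option \<Rightarrow> ty option" where
  "apty (Some (\<rho> \<leadsto> \<sigma>)) (Some \<tau>) = (if \<rho> = \<tau> then Some \<sigma> else None)"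
| "apty _ _ = None"

text \<open>Types of concrete terms can thus be computed by simp, where \<open>has_type\<close>
  would require rule applications and inversions.\<close>

fun typeof :: "ty list \<Rightarrow> tm \<Rightarrow> ty option" where
  "typeof \<Gamma> (Var i) = (if i < length \<Gamma> then Some (\<Gamma> ! i) else None)"
| "typeof \<Gamma> Zero = Some N"
| "typeof \<Gamma> Succ = Some (N \<leadsto> N)"
| "typeof \<Gamma> (Rec \<rho>) = Some (\<rho> \<leadsto> (N \<leadsto> \<rho> \<leadsto> \<rho>) \<leadsto> N \<leadsto> \<rho>)"
| "typeof \<Gamma> (t \<cdot> s) = apty (typeof \<Gamma> t) (typeof \<Gamma> s)"
| "typeof \<Gamma> (Lam \<rho> t) = map_option (Fn \<rho>) (typeof (\<rho> # \<Gamma>) t)"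

lemma apty_eq_Some: "apty a b = Some \<sigma> \<longleftrightarrow> (\<exists>\<rho>. a = Some (\<rho> \<leadsto> \<sigma>) \<and> b = Some \<rho>)"
  by (cases "(a, b)" rule: apty.cases) auto

lemma has_type_iff: "(\<Gamma> \<turnstile> t \<Colon> \<rho>) \<longleftrightarrow> typeof \<Gamma> t = Some \<rho>"
proof
  show "(\<Gamma> \<turnstile> t \<Colon> \<rho>) \<Longrightarrow> typeof \<Gamma> t = Some \<rho>"
    by (induction rule: has_type.induct) auto
  show "typeof \<Gamma> t = Some \<rho> \<Longrightarrow> \<Gamma> \<turnstile> t \<Colon> \<rho>"
  proof (induction t arbitrary: \<Gamma> \<rho>)
    case (App t s)
    then show ?case by (metis apty_eq_Some typeof.simps(5) has_type.App)
  qed (auto split: if_splits intro: has_type.intros)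
qed

lemma up_Var_comp: "up (Var \<circ> r) = Var \<circ> up_ren r"
  by (rule ext) (simp add: up_def up_ren_def split: nat.split)

lemma ren_eq_sub: "ren r t = sub (Var \<circ> r) t"
  by (induction t arbitrary: r) (auto simp: up_Var_comp)

lemma sub_ren: "sub f (ren r t) = sub (f \<circ> r) t"
proof (induction t arbitrary: f r)
  case (Lam \<rho> t)
  have "up f \<circ> up_ren r = up (f \<circ> r)"
    by (rule ext) (simp add: up_def up_ren_def split: nat.split)
  then show ?case by (simp only: ren.simps sub.simps Lam.IH)
qed auto

lemma ren_ren: "ren r (ren q t) = ren (r \<circ> q) t"
  by (simp only: ren_eq_sub[of r] ren_eq_sub[of "r \<circ> q"] sub_ren comp_assoc)

lemma ren_sub: "ren r (sub f t) = sub (ren r \<circ> f) t"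
proof (induction t arbitrary: f r)
  case (Lam \<rho> t)
  have "ren (up_ren r) (lift u) = lift (ren r u)" for u
    by (simp add: ren_ren comp_def up_ren_def)
  then have "ren (up_ren r) \<circ> up f = up (ren r \<circ> f)"
    by (intro ext) (simp add: up_def up_ren_def split: nat.split)
  then show ?case by (simp only: ren.simps sub.simps Lam.IH)
qed auto

lemma sub_up_lift: "sub (up f) (lift t) = lift (sub f t)"
  by (simp add: sub_ren ren_sub comp_def up_def)

lemma up_comp: "up (sub f \<circ> g) = sub (up f) \<circ> up g"
  by (rule ext) (simp add: up_def sub_up_lift[unfolded up_def] split: nat.split)

lemma sub_sub: "sub f (sub g t) = sub (sub f \<circ> g) t"
proof (induction t arbitrary: f g)
  case (Lam \<rho> t)
  show ?case by (simp only: sub.simps Lam.IH up_comp)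
qed auto

lemma up_Var: "up Var = Var"
  by (rule ext) (simp add: up_def split: nat.split)

lemma sub_Var: "sub Var t = t"
  by (induction t) (auto simp: up_Var)

lemma fsub_fsub: "fsub f (fsub g A) = fsub (sub f \<circ> g) A"
proof (induction A arbitrary: f g)
  case (Forall \<rho> A)
  show ?case by (simp only: fsub.simps Forall.IH up_comp)
next
  case (Exists \<rho> A)
  show ?case by (simp only: fsub.simps Exists.IH up_comp)
qed (auto simp: sub_sub)

lemma fsub_Var: "fsub Var A = A"
  by (induction A) (auto simp: up_Var sub_Var)

lemma fsub_up_flift: "fsub (up f) (flift A) = flift (fsub f A)"
proof -
  have "sub (up f) \<circ> (\<lambda>i. Var (Suc i)) = sub (\<lambda>i. Var (Suc i)) \<circ> f"
    by (rule ext) (simp add: up_def ren_eq_sub comp_def)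
  then show ?thesis by (simp add: flift_def fsub_fsub)
qed

lemma sub_inst: "sub f (sub (inst t) s) = sub (inst (sub f t)) (sub (up f) s)"
  and fsub_inst: "fsub f (fsub (inst t) A) = fsub (inst (sub f t)) (fsub (up f) A)"
proof -
  have "sub f \<circ> inst t = sub (inst (sub f t)) \<circ> up f"
    by (rule ext) (simp add: up_def inst_def sub_ren comp_def sub_Var split: nat.split)
  then show "sub f (sub (inst t) s) = sub (inst (sub f t)) (sub (up f) s)"
    and "fsub f (fsub (inst t) A) = fsub (inst (sub f t)) (fsub (up f) A)"
    by (simp_all add: sub_sub fsub_fsub)
qed

definition tysub :: "ty list \<Rightarrow> (nat \<Rightarrow> tm) \<Rightarrow> ty list \<Rightarrow> bool" where
  "tysub \<Gamma>' f \<Gamma> \<longleftrightarrow> (\<forall>i < length \<Gamma>. typeof \<Gamma>' (f i) = Some (\<Gamma> ! i))"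

lemma typeof_ren:
  assumes "typeof \<Gamma> t = Some \<rho>" "\<And>i. i < length \<Gamma> \<Longrightarrow> r i < length \<Gamma>' \<and> \<Gamma>' ! r i = \<Gamma> ! i"
  shows "typeof \<Gamma>' (ren r t) = Some \<rho>"
  using assms
proof (induction t arbitrary: \<Gamma> \<Gamma>' r \<rho>)
  case (App t1 t2)
  then show ?case by (fastforce simp: apty_eq_Some)
next
  case (Lam \<sigma> t)
  from Lam.prems(1) obtain \<tau> where t: "typeof (\<sigma> # \<Gamma>) t = Some \<tau>" "\<rho> = \<sigma> \<leadsto> \<tau>" by auto
  have "typeof (\<sigma> # \<Gamma>') (ren (up_ren r) t) = Some \<tau>"
    using Lam.prems(2) by (intro Lam.IH[OF t(1)]) (auto simp: up_ren_def less_Suc_eq_0_disj)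
  with t show ?case by simp
qed (auto split: if_splits)

lemma typeof_lift: "typeof \<Gamma> t = Some \<rho> \<Longrightarrow> typeof (\<sigma> # \<Gamma>) (lift t) = Some \<rho>"
  by (rule typeof_ren) auto

lemma tysub_up: "tysub \<Gamma>' f \<Gamma> \<Longrightarrow> tysub (\<rho> # \<Gamma>') (up f) (\<rho> # \<Gamma>)"
  by (auto simp: tysub_def up_def less_Suc_eq_0_disj typeof_lift)

lemma typeof_sub: "typeof \<Gamma> t = Some \<rho> \<Longrightarrow> tysub \<Gamma>' f \<Gamma> \<Longrightarrow> typeof \<Gamma>' (sub f t) = Some \<rho>"
proof (induction t arbitrary: \<Gamma> \<Gamma>' f \<rho>)
  case (App t1 t2)
  then show ?case by (fastforce simp: apty_eq_Some)
next
  case (Lam \<sigma> t)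
  then show ?case using Lam.IH[of "\<sigma> # \<Gamma>" _ "\<sigma> # \<Gamma>'" "up f"] tysub_up by auto
qed (auto simp: tysub_def split: if_splits)

lemma wff_fsub: "wff \<Gamma> A \<Longrightarrow> tysub \<Gamma>' f \<Gamma> \<Longrightarrow> wff \<Gamma>' (fsub f A)"
  by (induction A arbitrary: \<Gamma> \<Gamma>' f) (auto simp: has_type_iff typeof_sub tysub_up)

lemma tysub_inst: "typeof \<Gamma> t = Some \<rho> \<Longrightarrow> tysub \<Gamma> (inst t) (\<rho> # \<Gamma>)"
  by (auto simp: tysub_def inst_def less_Suc_eq_0_disj)

lemma tysub_Var_append: "tysub (\<Gamma> @ \<Gamma>') Var \<Gamma>"
  by (simp add: tysub_def nth_append)

lemma tysub_cons: "typeof \<Gamma>' t = Some \<rho> \<Longrightarrow> tysub \<Gamma>' f \<Gamma> \<Longrightarrow> tysub \<Gamma>' (case_nat t f) (\<rho> # \<Gamma>)"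
  by (auto simp: tysub_def less_Suc_eq_0_disj)

lemma up_cong: "(\<And>i. i < n \<Longrightarrow> f i = g i) \<Longrightarrow> i < Suc n \<Longrightarrow> up f i = up g i"
  by (cases i) (auto simp: up_def)

text \<open>Values of a substitution outside the context are irrelevant. This makes closed terms
  invariant under substitution and lets substitutions with arbitrary default values be
  compared.\<close>

lemma sub_cong_typed:
  "typeof \<Gamma> t = Some \<rho> \<Longrightarrow> (\<And>i. i < length \<Gamma> \<Longrightarrow> f i = g i) \<Longrightarrow> sub f t = sub g t"
proof (induction t arbitrary: \<Gamma> f g \<rho>)
  case (App t1 t2)
  show ?case using App.prems App.IH[of \<Gamma> _ f g] by (auto simp: apty_eq_Some)
next
  case (Lam \<sigma> t)
  from Lam.prems(1) obtain \<tau> where t: "typeof (\<sigma> # \<Gamma>) t = Some \<tau>" by auto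
  have "sub (up f) t = sub (up g) t"
    using up_cong[of "length \<Gamma>" f g] Lam.prems(2) by (intro Lam.IH[OF t]) auto
  then show ?case by simp
qed (auto split: if_splits)

lemma fsub_cong_wff:
  "wff \<Gamma> A \<Longrightarrow> (\<And>i. i < length \<Gamma> \<Longrightarrow> f i = g i) \<Longrightarrow> fsub f A = fsub g A"
proof (induction A arbitrary: \<Gamma> f g)
  case (Forall \<rho> A)
  have "fsub (up f) A = fsub (up g) A"
    using up_cong[of "length \<Gamma>" f g] Forall.prems by (intro Forall.IH[of "\<rho> # \<Gamma>"]) auto
  then show ?case by simp
next
  case (Exists \<rho> A)
  have "fsub (up f) A = fsub (up g) A"
    using up_cong[of "length \<Gamma>" f g] Exists.prems by (intro Exists.IH[of "\<rho> # \<Gamma>"]) auto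
  then show ?case by simp
next
  case (Eq \<rho> s t)
  then show ?case using sub_cong_typed[of \<Gamma> _ \<rho> f g] by (simp add: has_type_iff)
next
  case (Conj A B)
  show ?case using Conj.prems Conj.IH[of \<Gamma> f g] by simp
next
  case (Disj A B)
  show ?case using Disj.prems Disj.IH[of \<Gamma> f g] by simp
next
  case (Imp A B)
  show ?case using Imp.prems Imp.IH[of \<Gamma> f g] by simp
qed auto

section \<open>Structural properties of derivability\<close>

text \<open>Substitution and weakening are proved by one induction: the inclusion of hypotheses
  absorbs the additional ones, and \<open>f = Var\<close> gives pure weakening. The substitution is
  generalised because the quantifier rules pass to \<open>up f\<close>.\<close>

lemma HA_sub:
  "HA \<Gamma> \<Delta> A \<Longrightarrow> tysub \<Gamma>' f \<Gamma> \<Longrightarrow> fsub f ` set \<Delta> \<subseteq> set \<Delta>' \<Longrightarrow> HA \<Gamma>' \<Delta>' (fsub f A)"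
proof (induction arbitrary: \<Gamma>' f \<Delta>' rule: HA.induct)
  case (Hyp A \<Delta> \<Gamma>)
  then show ?case by (simp add: HA.Hyp image_subset_iff)
next
  case (BotE \<Gamma> \<Delta> A)
  show ?case by (rule HA.BotE) (use BotE.IH[OF BotE.prems] BotE.hyps BotE.prems in \<open>simp_all add: wff_fsub\<close>)
next
  case (ConjI \<Gamma> \<Delta> A B)
  show ?case using ConjI.IH[OF ConjI.prems] by (simp add: HA.ConjI)
next
  case (ConjE1 \<Gamma> \<Delta> A B)
  show ?case using ConjE1.IH[OF ConjE1.prems] by (simp add: HA.ConjE1[of _ _ _ "fsub f B"])
next
  case (ConjE2 \<Gamma> \<Delta> A B)
  show ?case using ConjE2.IH[OF ConjE2.prems] by (simp add: HA.ConjE2[of _ _ "fsub f A"])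
next
  case (DisjI1 \<Gamma> \<Delta> A B)
  show ?case using DisjI1.IH[OF DisjI1.prems] DisjI1.hyps DisjI1.prems by (simp add: HA.DisjI1 wff_fsub)
next
  case (DisjI2 \<Gamma> \<Delta> B A)
  show ?case using DisjI2.IH[OF DisjI2.prems] DisjI2.hyps DisjI2.prems by (simp add: HA.DisjI2 wff_fsub)
next
  case (DisjE \<Gamma> \<Delta> A B C)
  show ?case
  proof (rule HA.DisjE)
    show "HA \<Gamma>' \<Delta>' (fsub f A \<^bold>\<or> fsub f B)" using DisjE.IH(1)[OF DisjE.prems] by simp
  qed (rule DisjE.IH(2,3)[OF DisjE.prems(1)]; use DisjE.prems(2) in auto)+
next
  case (ImpI \<Gamma> A \<Delta> B)
  have "HA \<Gamma>' (fsub f A # \<Delta>') (fsub f B)"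
    by (rule ImpI.IH[OF ImpI.prems(1)]) (use ImpI.prems(2) in auto)
  then show ?case using ImpI.hyps ImpI.prems by (simp add: HA.ImpI wff_fsub)
next
  case (ImpE \<Gamma> \<Delta> A B)
  show ?case by (rule HA.ImpE[of _ _ "fsub f A"]) (use ImpE.IH[OF ImpE.prems] in simp_all)
next
  case (ForallI \<rho> \<Gamma> \<Delta> A)
  have "HA (\<rho> # \<Gamma>') (map flift \<Delta>') (fsub (up f) A)"
    by (rule ForallI.IH[OF tysub_up[OF ForallI.prems(1)]])
      (use ForallI.prems(2) in \<open>auto simp: fsub_up_flift\<close>)
  then show ?case by (simp add: HA.ForallI)
next
  case (ForallE \<Gamma> \<Delta> \<rho> A t)
  have "HA \<Gamma>' \<Delta>' (fsub (inst (sub f t)) (fsub (up f) A))"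
    by (rule HA.ForallE[of _ _ \<rho>])
      (use ForallE.IH[OF ForallE.prems] ForallE.hyps ForallE.prems in \<open>simp_all add: has_type_iff typeof_sub\<close>)
  then show ?case by (simp only: fsub_inst)
next
  case (ExistsI \<rho> \<Gamma> A t \<Delta>)
  have "HA \<Gamma>' \<Delta>' (Exists \<rho> (fsub (up f) A))"
    by (rule HA.ExistsI[of _ _ _ "sub f t"])
      (use ExistsI.IH[OF ExistsI.prems] ExistsI.hyps ExistsI.prems in
        \<open>simp_all add: has_type_iff typeof_sub fsub_inst wff_fsub[OF _ tysub_up]\<close>)
  then show ?case by simp
next
  case (ExistsE \<Gamma> \<Delta> \<rho> A C)
  have "HA (\<rho> # \<Gamma>') (fsub (up f) A # map flift \<Delta>') (fsub (up f) (flift C))"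
    by (rule ExistsE.IH(2)[OF tysub_up[OF ExistsE.prems(1)]])
      (use ExistsE.prems(2) in \<open>auto simp: fsub_up_flift\<close>)
  then show ?case
    using HA.ExistsE[of \<Gamma>' \<Delta>' \<rho> "fsub (up f) A" "fsub f C"] ExistsE.IH(1)[OF ExistsE.prems]
      ExistsE.hyps ExistsE.prems by (simp add: fsub_up_flift wff_fsub)
next
  case (EqRefl \<Gamma> t \<rho> \<Delta>)
  then show ?case by (simp add: HA.EqRefl has_type_iff typeof_sub)
next
  case (EqSubst \<rho> \<Gamma> A \<Delta> s t)
  have "HA \<Gamma>' \<Delta>' (fsub (inst (sub f t)) (fsub (up f) A))"
    by (rule HA.EqSubst[of \<rho> _ _ _ "sub f s"])
      (use EqSubst.IH[OF EqSubst.prems] EqSubst.hyps EqSubst.prems in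
        \<open>simp_all add: wff_fsub[OF _ tysub_up] fsub_inst\<close>)
  then show ?case by (simp only: fsub_inst)
next
  case (Ext \<Gamma> s \<rho> \<sigma> t \<Delta>)
  have "up f 0 = Var 0" by (simp add: up_def)
  with Ext.IH[OF Ext.prems] Ext.hyps Ext.prems show ?case
    by (simp add: HA.Ext has_type_iff typeof_sub sub_up_lift)
next
  case (Beta \<rho> \<Gamma> t \<sigma> s \<Delta>)
  then have "HA \<Gamma>' \<Delta>'
      (Eq \<sigma> (Lam \<rho> (sub (up f) t) \<cdot> sub f s) (sub (inst (sub f s)) (sub (up f) t)))"
    by (intro HA.Beta) (simp_all add: has_type_iff typeof_sub[OF _ tysub_up] typeof_sub)
  then show ?case by (simp add: sub_inst)
next
  case (Rec_Zero \<Gamma> s \<rho> t \<Delta>)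
  then show ?case by (simp add: HA.Rec_Zero has_type_iff typeof_sub)
next
  case (Rec_Succ \<Gamma> s \<rho> t n \<Delta>)
  then show ?case by (simp add: HA.Rec_Succ has_type_iff typeof_sub)
next
  case (Succ_inj \<Gamma> \<Delta> s t)
  then show ?case by (simp add: HA.Succ_inj)
next
  case (Succ_not_Zero \<Gamma> \<Delta> t)
  show ?case using Succ_not_Zero.IH[OF Succ_not_Zero.prems]
    by (simp add: HA.Succ_not_Zero[of _ _ "sub f t"])
next
  case (Induct \<Gamma> A \<Delta>)
  let ?S = "\<lambda>i. case i of 0 \<Rightarrow> Succ \<cdot> Var 0 | Suc i \<Rightarrow> Var (Suc i)"
  \<comment> \<open>The substitution of the induction step only changes variable 0, which
    \<open>up f\<close> leaves fixed, so the two commute.\<close>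
  have "sub (up f) \<circ> ?S = sub ?S \<circ> up f"
    by (rule ext) (simp add: up_def sub_sub ren_eq_sub comp_def split: nat.split)
  then have S: "fsub (up f) (fsub ?S A) = fsub ?S (fsub (up f) A)"
    by (simp only: fsub_fsub)
  have "HA \<Gamma>' \<Delta>' (Forall N (fsub (up f) A))"
    by (rule HA.Induct)
      (use Induct.IH[OF Induct.prems] Induct.hyps Induct.prems in
        \<open>simp_all add: wff_fsub[OF _ tysub_up] fsub_inst S\<close>)
  then show ?case by simp
qed

lemma HA_mono: "HA \<Gamma> \<Delta> A \<Longrightarrow> set \<Delta> \<subseteq> set \<Delta>' \<Longrightarrow> HA \<Gamma> \<Delta>' A"
  using HA_sub[of \<Gamma> \<Delta> A \<Gamma> Var \<Delta>'] by (simp add: tysub_def fsub_Var[abs_def])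

lemma HA_weaken: "HA \<Gamma> \<Delta> A \<Longrightarrow> set \<Delta> \<subseteq> set \<Delta>' \<Longrightarrow> HA (\<Gamma> @ \<Gamma>') \<Delta>' A"
  using HA_sub[OF _ tysub_Var_append, of \<Gamma> \<Delta> A \<Delta>' \<Gamma>'] by (simp add: fsub_Var[abs_def])

lemma wff_flift: "wff \<Gamma> A \<Longrightarrow> wff (\<rho> # \<Gamma>) (flift A)"
  unfolding flift_def by (rule wff_fsub) (auto simp: tysub_def)

text \<open>Allows the type of a side of an equation to be read off its derivability, as in
  \<open>val_eq_iff\<close>.\<close>

lemma HA_wff: "HA \<Gamma> \<Delta> A \<Longrightarrow> (\<And>B. B \<in> set \<Delta> \<Longrightarrow> wff \<Gamma> B) \<Longrightarrow> wff \<Gamma> A"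
proof (induction rule: HA.induct)
  case (ForallE \<Gamma> \<Delta> \<rho> A t)
  then show ?case by (auto intro!: wff_fsub tysub_inst simp: has_type_iff)
next
  case (EqSubst \<rho> \<Gamma> A \<Delta> s t)
  then show ?case by (auto intro!: wff_fsub tysub_inst simp: has_type_iff)
next
  case (Beta \<rho> \<Gamma> t \<sigma> s \<Delta>)
  then show ?case by (auto simp: has_type_iff intro!: typeof_sub[OF _ tysub_inst])
next
  case (DisjE \<Gamma> \<Delta> A B C)
  then show ?case by auto
next
  case (ForallI \<rho> \<Gamma> \<Delta> A)
  then show ?case by (auto intro: wff_flift)
qed (auto simp: has_type_iff apty_eq_Some)

text \<open>The rule \<open>ForallI\<close> puts the new variable in front and shifts all
  hypotheses. With the new variable at the end the hypotheses stay as they are, which is what an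
  extension of worlds needs.\<close>

lemma ForallI_fresh:
  assumes "HA (\<Gamma> @ [\<rho>]) \<Delta> (fsub (inst (Var (length \<Gamma>))) A)"
    and A: "wff (\<rho> # \<Gamma>) A" and \<Delta>: "\<And>B. B \<in> set \<Delta> \<Longrightarrow> wff \<Gamma> B"
  shows "HA \<Gamma> \<Delta> (Forall \<rho> A)"
proof -
  \<comment> \<open>Rotates the context: the last variable becomes variable 0 and the others move up
    by one.\<close>
  let ?f = "\<lambda>i. if i < length \<Gamma> then Var (Suc i) else Var 0"
  have "tysub (\<rho> # \<Gamma>) ?f (\<Gamma> @ [\<rho>])"
    by (auto simp: tysub_def nth_append)
  from HA_sub[OF assms(1) this, of "map (fsub ?f) \<Delta>"]
  have *: "HA (\<rho> # \<Gamma>) (map (fsub ?f) \<Delta>) (fsub (sub ?f \<circ> inst (Var (length \<Gamma>))) A)"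
    by (simp add: fsub_fsub)
  have "map (fsub ?f) \<Delta> = map flift \<Delta>"
    using \<Delta> by (auto simp: flift_def intro!: fsub_cong_wff)
  moreover have "fsub (sub ?f \<circ> inst (Var (length \<Gamma>))) A = fsub Var A"
    by (rule fsub_cong_wff[OF A]) (auto simp: inst_def less_Suc_eq_0_disj)
  ultimately show ?thesis using * by (simp only: fsub_Var HA.ForallI)
qed

lemma HA_Eq_sym: 
  assumes "HA \<Gamma> \<Delta> (Eq \<rho> s t)" "typeof \<Gamma> s = Some \<rho>"
  shows "HA \<Gamma> \<Delta> (Eq \<rho> t s)"
  using EqSubst[of \<rho> \<Gamma> "Eq \<rho> (Var 0) (lift s)" \<Delta> s t] assms
  by (auto simp: has_type_iff typeof_lift inst_def sub_ren comp_def sub_Var EqRefl)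

lemma HA_Eq_trans: 
  assumes "HA \<Gamma> \<Delta> (Eq \<rho> s t)" "HA \<Gamma> \<Delta> (Eq \<rho> t u)" "typeof \<Gamma> s = Some \<rho>"
  shows "HA \<Gamma> \<Delta> (Eq \<rho> s u)"
  using EqSubst[of \<rho> \<Gamma> "Eq \<rho> (lift s) (Var 0)" \<Delta> t u] assms
  by (auto simp: has_type_iff typeof_lift inst_def sub_ren comp_def sub_Var)

lemma HA_Eq_App: 
  assumes "HA \<Gamma> \<Delta> (Eq (\<rho> \<leadsto> \<sigma>) f g)" "HA \<Gamma> \<Delta> (Eq \<rho> s t)"
    and "typeof \<Gamma> f = Some (\<rho> \<leadsto> \<sigma>)" "typeof \<Gamma> s = Some \<rho>" "typeof \<Gamma> t = Some \<rho>"
  shows "HA \<Gamma> \<Delta> (Eq \<sigma> (f \<cdot> s) (g \<cdot> t))"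
proof -
  have "HA \<Gamma> \<Delta> (Eq \<sigma> (f \<cdot> s) (f \<cdot> t))"
    using EqSubst[of \<rho> \<Gamma> "Eq \<sigma> (lift (f \<cdot> s)) (lift f \<cdot> Var 0)" \<Delta> s t] assms
    by (auto simp: has_type_iff typeof_lift inst_def sub_ren comp_def sub_Var EqRefl)
  then show ?thesis
    using EqSubst[of "\<rho> \<leadsto> \<sigma>" \<Gamma> "Eq \<sigma> (lift (f \<cdot> s)) (Var 0 \<cdot> lift t)" \<Delta> f g] assms
    by (auto simp: has_type_iff typeof_lift inst_def sub_ren comp_def sub_Var)
qed

section \<open>Worlds\<close>

text \<open>
  Contexts are extended at the end, so that terms and formulas of a world need not be lifted to
  make sense in its extensions.
\<close>

typedef world = "{(\<Gamma>, \<Delta>). \<forall>B \<in> set \<Delta>. wff \<Gamma> B}"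
  by (rule exI[of _ "([], [])"]) simp

definition ctx :: "world \<Rightarrow> ty list" where "ctx w = fst (Rep_world w)"
definition hyp :: "world \<Rightarrow> fm list" where "hyp w = snd (Rep_world w)"

abbreviation typed :: "world \<Rightarrow> tm \<Rightarrow> ty \<Rightarrow> bool" where
  "typed w t \<rho> \<equiv> typeof (ctx w) t = Some \<rho>"

lemma wff_hyp: "B \<in> set (hyp w) \<Longrightarrow> wff (ctx w) B"
  using Rep_world[of w] by (auto simp: ctx_def hyp_def)

lemma ex_world:
  assumes "\<And>B. B \<in> set \<Delta> \<Longrightarrow> wff \<Gamma> B"
  obtains w where "ctx w = \<Gamma>" "hyp w = \<Delta>"
proof -
  have "Rep_world (Abs_world (\<Gamma>, \<Delta>)) = (\<Gamma>, \<Delta>)"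
    by (rule Abs_world_inverse) (use assms in auto)
  then show ?thesis using that[of "Abs_world (\<Gamma>, \<Delta>)"] by (simp add: ctx_def hyp_def)
qed

instantiation world :: preorder
begin

definition less_eq_world :: "world \<Rightarrow> world \<Rightarrow> bool" where
  "w \<le> w' \<longleftrightarrow> (\<exists>\<Gamma>. ctx w' = ctx w @ \<Gamma>) \<and> set (hyp w) \<subseteq> set (hyp w')"

definition less_world :: "world \<Rightarrow> world \<Rightarrow> bool" where
  "(w :: world) < w' \<longleftrightarrow> w \<le> w' \<and> \<not> w' \<le> w"

instance
  by standard (auto simp: less_eq_world_def less_world_def)

end

definition prv :: "world \<Rightarrow> fm \<Rightarrow> bool" where
  "prv w A \<longleftrightarrow> HA (ctx w) (hyp w) A"

lemma prv_mono: "prv w A \<Longrightarrow> w \<le> w' \<Longrightarrow> prv w' A"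
  by (auto simp: prv_def less_eq_world_def intro: HA_weaken)

lemma prv_wff: "prv w A \<Longrightarrow> wff (ctx w) A"
  unfolding prv_def by (rule HA_wff) (auto simp: wff_hyp)

lemma typeof_mono: "typed w t \<rho> \<Longrightarrow> w \<le> w' \<Longrightarrow> typed w' t \<rho>"
  using typeof_sub[OF _ tysub_Var_append] by (auto simp: less_eq_world_def sub_Var)

lemma ex_world_hyp:
  assumes "wff (ctx w) A"
  obtains w' where "w \<le> w'" "ctx w' = ctx w" "hyp w' = A # hyp w" "prv w' A"
proof -
  obtain w' where w': "ctx w' = ctx w" "hyp w' = A # hyp w"
    using ex_world[of "A # hyp w" "ctx w"] assms wff_hyp by auto
  then show ?thesis
    by (intro that[of w']) (auto simp: less_eq_world_def prv_def HA.Hyp)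
qed

lemma ex_world_var:
  obtains w' where "w \<le> w'" "ctx w' = ctx w @ [\<rho>]" "hyp w' = hyp w"
    "typed w' (Var (length (ctx w))) \<rho>"
proof -
  have "wff (ctx w @ [\<rho>]) B" if "B \<in> set (hyp w)" for B
    using wff_fsub[OF wff_hyp[OF that] tysub_Var_append] by (simp add: fsub_Var)
  then obtain w' where w': "ctx w' = ctx w @ [\<rho>]" "hyp w' = hyp w"
    using ex_world[of "hyp w" "ctx w @ [\<rho>]"] by auto
  then show ?thesis
    by (intro that[of w']) (auto simp: less_eq_world_def)
qed

text \<open>With \<open>prv_mono\<close> this is the Kripke clause for implication. The generic
  later world is the one that has \<open>A\<close> as an additional hypothesis.\<close>

lemma prv_ImpI:
  assumes "wff (ctx w) A" "\<And>w'. w \<le> w' \<Longrightarrow> prv w' A \<Longrightarrow> prv w' B"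
  shows "prv w (A \<^bold>\<longrightarrow> B)"
proof -
  obtain w' where w': "w \<le> w'" "ctx w' = ctx w" "hyp w' = A # hyp w" "prv w' A"
    using ex_world_hyp[OF assms(1)] .
  from assms(2)[OF w'(1,4)] show ?thesis
    using assms(1) by (simp add: prv_def w' HA.ImpI)
qed

lemma prv_ForallI:
  assumes "wff (\<rho> # ctx w) A"
    "\<And>w' t. w \<le> w' \<Longrightarrow> typed w' t \<rho> \<Longrightarrow> prv w' (fsub (inst t) A)"
  shows "prv w (Forall \<rho> A)"
proof -
  obtain w' where w': "w \<le> w'" "ctx w' = ctx w @ [\<rho>]" "hyp w' = hyp w"
    "typed w' (Var (length (ctx w))) \<rho>"
    using ex_world_var .
  from assms(2)[OF w'(1,4)] show ?thesis
    using ForallI_fresh[OF _ assms(1)] by (simp add: prv_def w' wff_hyp)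
qed

lemma fsub_inst_flift: "fsub (inst t) (flift A) = A"
proof -
  have "sub (inst t) \<circ> (\<lambda>i. Var (Suc i)) = Var" by (rule ext) (simp add: inst_def)
  then show ?thesis by (simp only: flift_def fsub_fsub fsub_Var)
qed

lemma HA_Forall_elim_fresh:
  assumes "HA \<Gamma> \<Delta> (Forall \<rho> A)"
  shows "HA (\<rho> # \<Gamma>) (map flift \<Delta>) A"
proof -
  let ?f = "\<lambda>i. Var (Suc i)"
  have "tysub (\<rho> # \<Gamma>) ?f \<Gamma>" by (simp add: tysub_def)
  from HA_sub[OF assms this, of "map flift \<Delta>"] have "HA (\<rho> # \<Gamma>) (map flift \<Delta>) (Forall \<rho> (fsub (up ?f) A))"
    by (simp add: flift_def[abs_def])
  from HA.ForallE[OF this, of "Var 0"]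
  have "HA (\<rho> # \<Gamma>) (map flift \<Delta>) (fsub (sub (inst (Var 0)) \<circ> up ?f) A)"
    by (simp add: has_type_iff fsub_fsub)
  moreover have "sub (inst (Var 0)) \<circ> up ?f = Var"
    by (rule ext) (simp add: up_def inst_def split: nat.split)
  ultimately show ?thesis by (simp only: fsub_Var)
qed

lemma prv_ExistsE:
  assumes "prv w (Exists \<rho> A)" "wff (ctx w) C"
    "\<And>w' t. w \<le> w' \<Longrightarrow> typed w' t \<rho> \<Longrightarrow> prv w' (fsub (inst t) A) \<Longrightarrow> prv w' C"
  shows "prv w C"
proof -
  have A: "wff (\<rho> # ctx w) A" using prv_wff[OF assms(1)] by simp
  \<comment> \<open>\<open>ExistsE\<close> wants the witness as variable 0, while worlds grow at the
    end. The detour through a universal implication leaves the change of position to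
    \<open>prv_ForallI\<close> and \<open>HA_Forall_elim_fresh\<close>.\<close>
  have "prv w (Forall \<rho> (A \<^bold>\<longrightarrow> flift C))"
  proof (rule prv_ForallI)
    show "wff (\<rho> # ctx w) (A \<^bold>\<longrightarrow> flift C)" using A assms(2) wff_flift by simp
    fix w' t assume w': "w \<le> w'" and t: "typed w' t \<rho>"
    have "tysub (ctx w') (inst t) (\<rho> # ctx w)"
      using tysub_inst[OF t] w' by (auto simp: tysub_def less_eq_world_def nth_append nth_Cons' split: if_splits)
    then have "wff (ctx w') (fsub (inst t) A)" using A wff_fsub by blast
    moreover have "prv w'' C" if "w' \<le> w''" "prv w'' (fsub (inst t) A)" for w''
      using assms(3)[OF order_trans[OF w' that(1)] typeof_mono[OF t that(1)] that(2)] .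
    ultimately show "prv w' (fsub (inst t) (A \<^bold>\<longrightarrow> flift C))"
      by (simp add: fsub_inst_flift prv_ImpI)
  qed
  then have "HA (\<rho> # ctx w) (map flift (hyp w)) (A \<^bold>\<longrightarrow> flift C)"
    by (simp add: prv_def HA_Forall_elim_fresh)
  then have "HA (\<rho> # ctx w) (A # map flift (hyp w)) (A \<^bold>\<longrightarrow> flift C)"
    by (rule HA_mono) auto
  then have "HA (\<rho> # ctx w) (A # map flift (hyp w)) (flift C)"
    by (rule HA.ImpE) (simp add: HA.Hyp)
  then show ?thesis
    using assms(1,2) by (auto simp: prv_def intro: HA.ExistsE)
qed

section \<open>Provable equality\<close>

text \<open>
  \<open>val w t\<close> is the class of \<open>t\<close> modulo provable equality in \<open>w\<close>, so that equations provable
  in \<open>w\<close> become equations of the metalanguage. It is \<open>None\<close> for ill-typed \<open>t\<close>.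
\<close>

type_synonym cls = "(ty \<times> tm set) option"

definition val :: "world \<Rightarrow> tm \<Rightarrow> cls" where
  "val w t = map_option (\<lambda>\<rho>. (\<rho>, {s. prv w (Eq \<rho> t s)})) (typeof (ctx w) t)"

lemma val_eq_iff:
  assumes "typed w s \<rho>"
  shows "val w s = val w t \<longleftrightarrow> prv w (Eq \<rho> s t)"
proof
  assume "val w s = val w t"
  then have t: "typed w t \<rho>" "{u. prv w (Eq \<rho> s u)} = {u. prv w (Eq \<rho> t u)}"
    using assms by (cases "typeof (ctx w) t"; simp add: val_def)+
  have "prv w (Eq \<rho> t t)" using t by (simp add: prv_def HA.EqRefl has_type_iff)
  with t(2) show "prv w (Eq \<rho> s t)" by blast
next
  assume *: "prv w (Eq \<rho> s t)"
  have t: "typed w t \<rho>" using prv_wff[OF *] by (simp add: has_type_iff)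
  have "prv w (Eq \<rho> s u) \<longleftrightarrow> prv w (Eq \<rho> t u)" for u
    using * assms t HA_Eq_sym HA_Eq_trans unfolding prv_def by blast
  then show "val w s = val w t" using assms t by (simp add: val_def)
qed

definition tyw :: "world \<Rightarrow> cls \<Rightarrow> ty option" where
  "tyw w X = (if X \<in> range (val w) then map_option fst X else None)"

definition rp :: "world \<Rightarrow> cls \<Rightarrow> tm" where
  "rp w X = (SOME t. val w t = X)"

text \<open>The default outside the range of \<open>val w\<close> lets \<open>tyw_app\<close> be a
  simp rule without premises.\<close>

definition app :: "world \<Rightarrow> cls \<Rightarrow> cls \<Rightarrow> cls" where
  "app w F X = (if F \<in> range (val w) \<and> X \<in> range (val w) then val w (rp w F \<cdot> rp w X) else None)"

lemma val_rp_range: "X \<in> range (val w) \<Longrightarrow> val w (rp w X) = X"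
  unfolding rp_def by (rule someI_ex) auto

lemma tyw_val [simp]: "tyw w (val w t) = typeof (ctx w) t"
  by (simp add: tyw_def) (simp add: val_def option.map_comp comp_def option.map_ident)

lemma val_rp: "tyw w X = Some \<rho> \<Longrightarrow> val w (rp w X) = X"
  by (rule val_rp_range) (auto simp: tyw_def split: if_splits)

lemma typeof_rp: "tyw w X = Some \<rho> \<Longrightarrow> typed w (rp w X) \<rho>"
  using tyw_val[of w "rp w X"] val_rp by simp

lemma cls_cases:
  assumes "tyw w X = Some \<rho>"
  obtains x where "X = val w x" "typed w x \<rho>"
  using that[of "rp w X"] val_rp[OF assms] typeof_rp[OF assms] by simp

lemma val_app [simp]: "val w (f \<cdot> x) = app w (val w f) (val w x)"
proof -
  let ?f = "rp w (val w f)" and ?x = "rp w (val w x)"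
  have f: "val w ?f = val w f" and x: "val w ?x = val w x" by (auto intro: val_rp_range)
  have ty: "typeof (ctx w) ?f = typeof (ctx w) f" "typeof (ctx w) ?x = typeof (ctx w) x"
    using arg_cong[OF f, of "tyw w"] arg_cong[OF x, of "tyw w"] by simp_all
  have "val w (f \<cdot> x) = val w (?f \<cdot> ?x)"
  proof (cases "typeof (ctx w) (f \<cdot> x)")
    case None
    then show ?thesis using ty by (simp add: val_def)
  next
    case (Some \<sigma>)
    then obtain \<rho> where \<rho>: "typed w f (\<rho> \<leadsto> \<sigma>)" "typed w x \<rho>"
      by (auto simp: apty_eq_Some)
    then have "prv w (Eq (\<rho> \<leadsto> \<sigma>) f ?f)" "prv w (Eq \<rho> x ?x)"
      using f x val_eq_iff[OF \<rho>(1), of ?f] val_eq_iff[OF \<rho>(2), of ?x] by simp_all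
    then have "prv w (Eq \<sigma> (f \<cdot> x) (?f \<cdot> ?x))"
      using \<rho> ty unfolding prv_def by (simp add: HA_Eq_App[of _ _ \<rho>])
    then show ?thesis using Some by (simp add: val_eq_iff)
  qed
  then show ?thesis by (simp add: app_def)
qed

lemma tyw_app [simp]: "tyw w (app w F X) = apty (tyw w F) (tyw w X)"
proof (cases "F \<in> range (val w) \<and> X \<in> range (val w)")
  case True
  then obtain f x where fx: "F = val w f" "X = val w x" by auto
  then have "app w F X = val w (f \<cdot> x)" by simp
  with fx show ?thesis by (simp only: tyw_val typeof.simps)
next
  case False
  have "apty a None = None" for a by (cases "(a, None :: ty option)" rule: apty.cases) simp_all
  moreover have "tyw w F = None \<or> tyw w X = None" using False by (simp add: tyw_def)
  moreover have "tyw w (app w F X) = None" using False by (simp only: app_def tyw_def) simp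
  ultimately show ?thesis by (elim disjE) simp_all
qed

text \<open>Classes belong to a single world, and only equations between terms survive in later
  ones. For this reason facts needed later are repeatedly restated with terms.\<close>

lemma val_mono:
  assumes "val w s = val w t" "typed w s \<rho>" "w \<le> w'"
  shows "val w' s = val w' t"
  using assms(1) prv_mono[OF _ assms(3)] by (simp add: val_eq_iff[OF assms(2)] val_eq_iff[OF typeof_mono[OF assms(2,3)]])

lemma val_Rec_Zero [simp]:
  assumes "tyw w A = Some \<rho>" "tyw w F = Some (N \<leadsto> \<rho> \<leadsto> \<rho>)"
  shows "app w (app w (app w (val w (Rec \<rho>)) A) F) (val w Zero) = A"
proof -
  from assms obtain a f where "A = val w a" "typed w a \<rho>"
    "F = val w f" "typed w f (N \<leadsto> \<rho> \<leadsto> \<rho>)" by (metis cls_cases)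
  then show ?thesis
    using val_eq_iff[of w "Rec \<rho> \<cdot> a \<cdot> f \<cdot> Zero" \<rho> a]
    by (simp add: prv_def HA.Rec_Zero has_type_iff)
qed

lemma val_Rec_Succ [simp]:
  assumes "tyw w A = Some \<rho>" "tyw w F = Some (N \<leadsto> \<rho> \<leadsto> \<rho>)" "tyw w X = Some N"
  shows "app w (app w (app w (val w (Rec \<rho>)) A) F) (app w (val w Succ) X) =
    app w (app w F X) (app w (app w (app w (val w (Rec \<rho>)) A) F) X)"
proof -
  from assms obtain a f x where "A = val w a" "typed w a \<rho>"
    "F = val w f" "typed w f (N \<leadsto> \<rho> \<leadsto> \<rho>)"
    "X = val w x" "typed w x N" by (metis cls_cases)
  then show ?thesis
    using val_eq_iff[of w "Rec \<rho> \<cdot> a \<cdot> f \<cdot> (Succ \<cdot> x)" \<rho> "f \<cdot> x \<cdot> (Rec \<rho> \<cdot> a \<cdot> f \<cdot> x)"]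
    by (simp add: prv_def HA.Rec_Succ has_type_iff)
qed

lemma val_Succ_inj:
  assumes "app w (val w Succ) X = app w (val w Succ) Y" "tyw w X = Some N" "tyw w Y = Some N"
  shows "X = Y"
proof -
  from assms obtain x y where "X = val w x" "typed w x N"
    "Y = val w y" "typed w y N" by (metis cls_cases)
  with assms(1) show ?thesis
    using val_eq_iff[of w "Succ \<cdot> x" N "Succ \<cdot> y"] val_eq_iff[of w x N y]
    by (auto simp: prv_def dest: HA.Succ_inj)
qed

lemma val_Succ_not_Zero:
  assumes "app w (val w Succ) X = val w Zero" "tyw w X = Some N" "wff (ctx w) A"
  shows "prv w A"
proof -
  from assms obtain x where "X = val w x" "typed w x N" by (metis cls_cases)
  with assms(1) have "prv w (Eq N (Succ \<cdot> x) Zero)"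
    using val_eq_iff[of w "Succ \<cdot> x" N Zero] by simp
  then show ?thesis
    using assms(3) unfolding prv_def by (metis HA.BotE HA.Succ_not_Zero)
qed

text \<open>Ex falso for equations: in an inconsistent world any two values of the same type
  coincide. It closes the impossible branches of case distinctions.\<close>

lemma val_Succ_not_Zero_eq:
  assumes "app w (val w Succ) X = val w Zero" "tyw w X = Some N" "tyw w A = Some \<rho>" "tyw w B = Some \<rho>"
  shows "A = B"
proof -
  from assms obtain a b where "A = val w a" "typed w a \<rho>"
    "B = val w b" "typed w b \<rho>" by (metis cls_cases)
  then show ?thesis
    using val_Succ_not_Zero[OF assms(1,2), of "Eq \<rho> a b"] by (simp add: has_type_iff val_eq_iff)
qed

section \<open>Environments\<close>

definition den :: "world \<Rightarrow> cls list \<Rightarrow> tm \<Rightarrow> cls" where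
  "den w E t = val w (sub (\<lambda>i. if i < length E then rp w (E ! i) else Var i) t)"

definition tys :: "world \<Rightarrow> cls list \<Rightarrow> ty list" where
  "tys w E = map (\<lambda>X. the (tyw w X)) E"

definition tyE :: "world \<Rightarrow> cls list \<Rightarrow> bool" where
  "tyE w E \<longleftrightarrow> (\<forall>X \<in> set E. tyw w X \<noteq> None)"

lemma tys_simps [simp]: "tys w [] = []" "tys w (X # E) = the (tyw w X) # tys w E"
  by (simp_all add: tys_def)

lemma tyE_simps [simp]: "tyE w []" "tyE w (X # E) \<longleftrightarrow> tyw w X \<noteq> None \<and> tyE w E"
  by (simp_all add: tyE_def)

lemma den_simps [simp]:
  "den w E (s \<cdot> t) = app w (den w E s) (den w E t)"
  "den w E Zero = val w Zero"
  "den w E Succ = val w Succ"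
  "den w E (Rec \<rho>) = val w (Rec \<rho>)"
  by (simp_all add: den_def)

lemma den_Var [simp]: "i < length E \<Longrightarrow> tyE w E \<Longrightarrow> den w E (Var i) = E ! i"
  unfolding tyE_def by (auto simp: den_def) (metis nth_mem val_rp)

lemma tysub_env:
  "tyE w E \<Longrightarrow> tysub (ctx w) (\<lambda>i. if i < length E then rp w (E ! i) else Var i) (tys w E)"
  unfolding tyE_def by (auto simp: tysub_def tys_def) (metis nth_mem typeof_rp option.sel)

lemma tyw_den: "tyE w E \<Longrightarrow> typeof (tys w E) t = Some \<rho> \<Longrightarrow> tyw w (den w E t) = Some \<rho>"
  by (simp add: den_def typeof_sub tysub_env)

lemma tyw_den_Lam [simp]:
  "tyE w E \<Longrightarrow> typeof (\<rho> # tys w E) t = Some \<sigma> \<Longrightarrow> tyw w (den w E (Lam \<rho> t)) = Some (\<rho> \<leadsto> \<sigma>)"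
  by (simp add: tyw_den)

text \<open>Evaluation by closures: an application pushes its argument onto the environment, so that
  simp evaluates nested abstractions without computing substitutions.\<close>

lemma den_beta [simp]:
  assumes "tyw w X = Some \<rho>" "tyE w E" "typeof (\<rho> # tys w E) t \<noteq> None"
  shows "app w (den w E (Lam \<rho> t)) X = den w (X # E) t"
proof -
  let ?f = "\<lambda>E i. if i < length E then rp w (E ! i) else Var i"
  obtain x where x: "X = val w x" "typed w x \<rho>" using cls_cases[OF assms(1)] .
  obtain \<sigma> where \<sigma>: "typeof (\<rho> # tys w E) t = Some \<sigma>" using assms(3) by auto
  have x': "typed w (rp w X) \<rho>" using assms(1) typeof_rp by blast
  have ty: "typeof (\<rho> # ctx w) (sub (up (?f E)) t) = Some \<sigma>"
    using \<sigma> tysub_env[OF assms(2)] by (blast intro: typeof_sub tysub_up)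
  have "app w (den w E (Lam \<rho> t)) X = app w (val w (Lam \<rho> (sub (up (?f E)) t))) (val w (rp w X))"
    using assms(1) by (simp add: den_def val_rp)
  also have "\<dots> = val w (Lam \<rho> (sub (up (?f E)) t) \<cdot> rp w X)" by simp
  also have "\<dots> = val w (sub (inst (rp w X)) (sub (up (?f E)) t))"
    using ty x' by (subst val_eq_iff[of _ _ \<sigma>]) (simp_all add: prv_def HA.Beta has_type_iff del: val_app)
  also have "sub (inst (rp w X)) (sub (up (?f E)) t) = sub (?f (X # E)) t"
    unfolding sub_sub
  proof (rule sub_cong_typed[OF \<sigma>])
    fix i assume "i < length (\<rho> # tys w E)"
    then show "(sub (inst (rp w X)) \<circ> up (?f E)) i = ?f (X # E) i"
      by (auto simp: up_def inst_def sub_ren comp_def sub_Var tys_def split: nat.split)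
  qed
  finally show ?thesis by (simp add: den_def)
qed

lemma den_closed: "typeof [] t = Some \<rho> \<Longrightarrow> den w E t = val w t"
  unfolding den_def by (subst sub_cong_typed[of "[]" t \<rho> _ Var]) (auto simp: sub_Var)

text \<open>Gives a closed abstraction the form of a closure with empty environment, on which
  \<open>den_beta\<close> fires.\<close>

lemma val_Lam_closed [simp]: "typeof [] (Lam \<rho> t) = Some \<sigma> \<Longrightarrow> val w (Lam \<rho> t) = den w [] (Lam \<rho> t)"
  using den_closed by simp

lemma typeof_closed: "typeof [] t = Some \<rho> \<Longrightarrow> typeof \<Gamma> t = Some \<rho>"
  using typeof_sub[of "[]" t \<rho> \<Gamma> Var] by (simp add: tysub_def sub_Var)

section \<open>Satisfaction\<close>

text \<open>Forcing in the model of worlds, with \<open>\<sigma>\<close> as the assignment. The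
  lemmas that follow recover the Kripke clauses for conjunction, implication and universal
  quantification.\<close>

definition sat :: "world \<Rightarrow> (nat \<Rightarrow> tm) \<Rightarrow> fm \<Rightarrow> bool" where
  "sat w \<sigma> A \<longleftrightarrow> prv w (fsub \<sigma> A)"

lemma sat_mono: "sat w \<sigma> A \<Longrightarrow> w \<le> w' \<Longrightarrow> sat w' \<sigma> A"
  unfolding sat_def by (rule prv_mono)

lemma tysub_mono: "tysub (ctx w) \<sigma> \<Gamma> \<Longrightarrow> w \<le> w' \<Longrightarrow> tysub (ctx w') \<sigma> \<Gamma>"
  using typeof_mono unfolding tysub_def by blast

lemma sat_fsub: "sat w \<sigma> (fsub \<tau> A) \<longleftrightarrow> sat w (sub \<sigma> \<circ> \<tau>) A"
  by (simp add: sat_def fsub_fsub)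

lemma sat_cong: "wff \<Gamma> A \<Longrightarrow> (\<And>i. i < length \<Gamma> \<Longrightarrow> \<sigma> i = \<tau> i) \<Longrightarrow> sat w \<sigma> A \<longleftrightarrow> sat w \<tau> A"
  unfolding sat_def using fsub_cong_wff[of \<Gamma> A \<sigma> \<tau>] by simp

lemma fsub_inst_up: "fsub (inst t) (fsub (up \<sigma>) A) = fsub (case_nat t \<sigma>) A"
proof -
  have "sub (inst t) \<circ> up \<sigma> = case_nat t \<sigma>"
    by (rule ext) (simp add: up_def inst_def sub_ren comp_def sub_Var split: nat.split)
  then show ?thesis by (simp only: fsub_fsub)
qed

lemma sat_Eq:
  assumes "tysub (ctx w) \<sigma> \<Gamma>" "typeof \<Gamma> s = Some \<rho>"
  shows "sat w \<sigma> (Eq \<rho> s t) \<longleftrightarrow> val w (sub \<sigma> s) = val w (sub \<sigma> t)"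
  using assms by (simp add: sat_def typeof_sub val_eq_iff)

lemma sat_Conj: "sat w \<sigma> (A \<^bold>\<and> B) \<longleftrightarrow> sat w \<sigma> A \<and> sat w \<sigma> B"
  unfolding sat_def prv_def fsub.simps using HA.ConjI HA.ConjE1 HA.ConjE2 by metis

lemma sat_Imp:
  assumes "tysub (ctx w) \<sigma> \<Gamma>" "wff \<Gamma> A"
  shows "sat w \<sigma> (A \<^bold>\<longrightarrow> B) \<longleftrightarrow> (\<forall>w' \<ge> w. sat w' \<sigma> A \<longrightarrow> sat w' \<sigma> B)"
proof
  assume "sat w \<sigma> (A \<^bold>\<longrightarrow> B)"
  then have "prv w' (fsub \<sigma> A \<^bold>\<longrightarrow> fsub \<sigma> B)" if "w \<le> w'" for w'
    using prv_mono[OF _ that] by (simp add: sat_def)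
  then show "\<forall>w' \<ge> w. sat w' \<sigma> A \<longrightarrow> sat w' \<sigma> B"
    unfolding sat_def prv_def using HA.ImpE by metis
next
  assume "\<forall>w' \<ge> w. sat w' \<sigma> A \<longrightarrow> sat w' \<sigma> B"
  then show "sat w \<sigma> (A \<^bold>\<longrightarrow> B)"
    using wff_fsub[OF assms(2,1)] by (simp add: sat_def prv_ImpI)
qed

lemma sat_Forall:
  assumes "tysub (ctx w) \<sigma> \<Gamma>" "wff (\<rho> # \<Gamma>) A"
  shows "sat w \<sigma> (Forall \<rho> A) \<longleftrightarrow>
    (\<forall>w' \<ge> w. \<forall>t. typed w' t \<rho> \<longrightarrow> sat w' (case_nat t \<sigma>) A)"
proof
  assume *: "sat w \<sigma> (Forall \<rho> A)"
  have "sat w' (case_nat t \<sigma>) A" if "w \<le> w'" "typed w' t \<rho>" for w' t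
    using sat_mono[OF * that(1)] HA.ForallE[of "ctx w'" "hyp w'" \<rho> "fsub (up \<sigma>) A" t] that(2)
    by (simp add: sat_def prv_def has_type_iff fsub_inst_up)
  then show "\<forall>w' \<ge> w. \<forall>t. typed w' t \<rho> \<longrightarrow> sat w' (case_nat t \<sigma>) A" by blast
next
  assume "\<forall>w' \<ge> w. \<forall>t. typed w' t \<rho> \<longrightarrow> sat w' (case_nat t \<sigma>) A"
  then show "sat w \<sigma> (Forall \<rho> A)"
    using wff_fsub[OF assms(2) tysub_up[OF assms(1)]]
    by (simp add: sat_def prv_ForallI fsub_inst_up)
qed

lemma sat_ExistsI:
  assumes "tysub (ctx w) \<sigma> \<Gamma>" "wff (\<rho> # \<Gamma>) A" "typed w t \<rho>" "sat w (case_nat t \<sigma>) A"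
  shows "sat w \<sigma> (Exists \<rho> A)"
  using wff_fsub[OF assms(2) tysub_up[OF assms(1)]] assms(3,4)
  by (simp add: sat_def prv_def has_type_iff fsub_inst_up HA.ExistsI[of _ _ _ t])

text \<open>A derivable existential need not have a witness in the same world, so there is an
  elimination towards a formula \<open>C\<close> instead of a Kripke clause.\<close>

lemma sat_ExistsE:
  assumes "sat w \<sigma> (Exists \<rho> A)" "wff (ctx w) (fsub \<tau> C)"
    "\<And>w' t. w \<le> w' \<Longrightarrow> typed w' t \<rho> \<Longrightarrow> sat w' (case_nat t \<sigma>) A \<Longrightarrow> sat w' \<tau> C"
  shows "sat w \<tau> C"
  using prv_ExistsE[of w \<rho> "fsub (up \<sigma>) A" "fsub \<tau> C"] assms by (simp add: sat_def fsub_inst_up)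

lemma sat_subst:
  assumes "tysub (ctx w) \<sigma> \<Gamma>" "wff (\<rho> # \<Gamma>) A" "typed w s \<rho>"
    "val w s = val w t" "sat w (case_nat s \<sigma>) A"
  shows "sat w (case_nat t \<sigma>) A"
  using HA.EqSubst[of \<rho> "ctx w" "fsub (up \<sigma>) A" "hyp w" s t] assms
    wff_fsub[OF assms(2) tysub_up[OF assms(1)]]
  by (simp add: sat_def val_eq_iff prv_def fsub_inst_up)

text \<open>Induction of HA as a rule of the metalanguage. It is restricted to predicates given by a
  formula, and the step has to hold in all later worlds.\<close>

lemma sat_induct:
  assumes "tysub (ctx w) \<sigma> \<Gamma>" "wff (N # \<Gamma>) A" "sat w (case_nat Zero \<sigma>) A"
    and step: "\<And>w' n. w \<le> w' \<Longrightarrow> typed w' n N \<Longrightarrow> sat w' (case_nat n \<sigma>) A \<Longrightarrow>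
      sat w' (case_nat (Succ \<cdot> n) \<sigma>) A"
    and "typed w n N"
  shows "sat w (case_nat n \<sigma>) A"
proof -
  let ?S = "\<lambda>i. case i of 0 \<Rightarrow> Succ \<cdot> Var 0 | Suc i \<Rightarrow> Var (Suc i)"
  have S: "tysub (N # \<Gamma>) ?S (N # \<Gamma>)"
    by (auto simp: tysub_def less_Suc_eq_0_disj)
  have S': "sub (up \<sigma>) \<circ> ?S = sub ?S \<circ> up \<sigma>"
    by (rule ext) (simp add: up_def sub_sub ren_eq_sub comp_def split: nat.split)
  have "sat w \<sigma> (Forall N (A \<^bold>\<longrightarrow> fsub ?S A))"
  proof -
    have "sat w' (case_nat t \<sigma>) (A \<^bold>\<longrightarrow> fsub ?S A)"
      if w': "w \<le> w'" "typed w' t N" for w' t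
    proof -
      have ty: "tysub (ctx w') (case_nat t \<sigma>) (N # \<Gamma>)"
        using tysub_cons[OF that(2) tysub_mono[OF assms(1) that(1)]] .
      have "sub (case_nat t \<sigma>) \<circ> ?S = case_nat (Succ \<cdot> t) \<sigma>"
        by (rule ext) (simp split: nat.split)
      then show ?thesis
        unfolding sat_Imp[OF ty assms(2)] sat_fsub
        using step[of _ t] typeof_mono[OF w'(2)] order_trans[OF w'(1)] by auto
    qed
    then show ?thesis
      using sat_Forall[OF assms(1), of N "A \<^bold>\<longrightarrow> fsub ?S A"] assms(2) wff_fsub[OF assms(2) S] by auto
  qed
  then have "prv w (Forall N (fsub (up \<sigma>) A \<^bold>\<longrightarrow> fsub ?S (fsub (up \<sigma>) A)))"
    by (simp add: sat_def fsub_fsub S')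
  then have "prv w (Forall N (fsub (up \<sigma>) A))"
    using assms(3) wff_fsub[OF assms(2) tysub_up[OF assms(1)]]
    by (simp add: prv_def sat_def HA.Induct fsub_inst_up)
  then have "sat w \<sigma> (Forall N A)" by (simp add: sat_def)
  then show ?thesis using sat_Forall[OF assms(1,2)] assms(5) by blast
qed

section \<open>Assignments given by lists of terms\<close>

lemma case_nat_nth: "case_nat t ((!) ts) = (!) (t # ts)"
  by (rule ext) (simp split: nat.split)

abbreviation tyl :: "world \<Rightarrow> tm list \<Rightarrow> ty list \<Rightarrow> bool" where
  "tyl w ts \<Gamma> \<equiv> map (typeof (ctx w)) ts = map Some \<Gamma>"

lemma tyl_mono:
  assumes "tyl w ts \<Gamma>" "w \<le> w'"
  shows "tyl w' ts \<Gamma>"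
proof (rule nth_equalityI)
  show l: "length (map (typeof (ctx w')) ts) = length (map Some \<Gamma>)"
    using map_eq_imp_length_eq[OF assms(1)] by simp
  fix i assume "i < length (map (typeof (ctx w')) ts)"
  then show "map (typeof (ctx w')) ts ! i = map Some \<Gamma> ! i"
    using arg_cong[OF assms(1), of "\<lambda>xs. xs ! i"] typeof_mono[OF _ assms(2)] l by simp
qed

lemma tyl_tysub:
  assumes "tyl w ts \<Gamma>"
  shows "tysub (ctx w) ((!) ts) \<Gamma>"
  unfolding tysub_def
proof (intro allI impI)
  fix i assume "i < length \<Gamma>"
  then show "typed w (ts ! i) (\<Gamma> ! i)"
    using arg_cong[OF assms, of "\<lambda>xs. xs ! i"] map_eq_imp_length_eq[OF assms] by simp
qed

lemma tyl_tyE: "tyl w ts \<Gamma> \<Longrightarrow> tyE w (map (val w) ts)"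
  and tyl_tys: "tyl w ts \<Gamma> \<Longrightarrow> tys w (map (val w) ts) = \<Gamma>"
  by (induction ts arbitrary: \<Gamma>) (auto simp: map_eq_Cons_conv Cons_eq_map_conv)

text \<open>The head of the list is traded for a beta redex: \<open>t\<close> becomes
  \<open>Lam \<rho> t\<close>, to which the induction hypothesis for the tail applies, and
  \<open>den_beta\<close> pushes the head back.\<close>

lemma val_sub:
  "tyl w ts \<Gamma> \<Longrightarrow> typeof \<Gamma> t = Some \<sigma> \<Longrightarrow> val w (sub ((!) ts) t) = den w (map (val w) ts) t"
proof (induction ts arbitrary: \<Gamma> t \<sigma>)
  case Nil
  then have "typeof [] t = Some \<sigma>" by simp
  then have "sub ((!) []) t = sub Var t" by (rule sub_cong_typed) simp
  with \<open>typeof [] t = Some \<sigma>\<close> show ?case by (simp add: sub_Var den_closed)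
next
  case (Cons a ts)
  then obtain \<rho> \<Gamma>' where \<Gamma>: "\<Gamma> = \<rho> # \<Gamma>'" "typed w a \<rho>" "tyl w ts \<Gamma>'"
    by (auto simp: Cons_eq_map_conv)
  have t: "typeof \<Gamma>' (Lam \<rho> t) = Some (\<rho> \<leadsto> \<sigma>)" using Cons.prems(2) \<Gamma>(1) by simp
  have ty: "typeof (\<rho> # ctx w) (sub (up ((!) ts)) t) = Some \<sigma>"
    using Cons.prems(2) \<Gamma> tyl_tysub by (blast intro: typeof_sub tysub_up)
  have "sub ((!) (a # ts)) t = sub (inst a) (sub (up ((!) ts)) t)"
    unfolding sub_sub
    by (rule sub_cong_typed[OF Cons.prems(2)])
      (simp add: up_def inst_def sub_ren comp_def sub_Var nth_Cons split: nat.split)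
  also have "val w \<dots> = val w (Lam \<rho> (sub (up ((!) ts)) t) \<cdot> a)"
    using ty \<Gamma>(2)
    by (intro val_eq_iff[of _ _ \<sigma>, THEN iffD2, symmetric])
      (simp_all add: prv_def HA.Beta has_type_iff del: val_app)
  also have "\<dots> = app w (val w (sub ((!) ts) (Lam \<rho> t))) (val w a)"
    by simp
  also have "\<dots> = app w (den w (map (val w) ts) (Lam \<rho> t)) (val w a)"
    by (simp only: Cons.IH[OF \<Gamma>(3) t])
  also have "\<dots> = den w (val w a # map (val w) ts) t"
    using \<Gamma> Cons.prems(2) by (intro den_beta) (simp_all add: tyl_tyE tyl_tys)
  finally show ?case by simp
qed

definition satl :: "world \<Rightarrow> tm list \<Rightarrow> fm \<Rightarrow> bool" where
  "satl w ts A \<longleftrightarrow> sat w ((!) ts) A"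

lemma satl_mono: "satl w ts A \<Longrightarrow> w \<le> w' \<Longrightarrow> satl w' ts A"
  unfolding satl_def by (rule sat_mono)

lemma satl_Eq:
  assumes "tyl w ts \<Gamma>" "typeof \<Gamma> s = Some \<rho>" "typeof \<Gamma> t = Some \<rho>"
  shows "satl w ts (Eq \<rho> s t) \<longleftrightarrow> den w (map (val w) ts) s = den w (map (val w) ts) t"
  using assms unfolding satl_def by (simp add: sat_Eq[OF tyl_tysub] val_sub)

lemma satl_Conj: "satl w ts (A \<^bold>\<and> B) \<longleftrightarrow> satl w ts A \<and> satl w ts B"
  by (simp add: satl_def sat_Conj)

lemma satl_Imp:
  assumes "tyl w ts \<Gamma>" "wff \<Gamma> A"
  shows "satl w ts (A \<^bold>\<longrightarrow> B) \<longleftrightarrow> (\<forall>w' \<ge> w. satl w' ts A \<longrightarrow> satl w' ts B)"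
  unfolding satl_def by (rule sat_Imp[OF tyl_tysub[OF assms(1)] assms(2)])

lemma satl_Forall:
  assumes "tyl w ts \<Gamma>" "wff (\<rho> # \<Gamma>) A"
  shows "satl w ts (Forall \<rho> A) \<longleftrightarrow>
    (\<forall>w' \<ge> w. \<forall>t. typed w' t \<rho> \<longrightarrow> satl w' (t # ts) A)"
  unfolding satl_def sat_Forall[OF tyl_tysub[OF assms(1)] assms(2)] case_nat_nth ..

lemma satl_subst:
  assumes "tyl w ts \<Gamma>" "wff (\<rho> # \<Gamma>) A" "typed w s \<rho>"
    "val w s = val w t" "satl w (s # ts) A"
  shows "satl w (t # ts) A"
  using sat_subst[OF tyl_tysub[OF assms(1)] assms(2-4)] assms(5) by (simp add: satl_def case_nat_nth)

lemma satl_induct: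
  assumes "tyl w ts \<Gamma>" "wff (N # \<Gamma>) A" "satl w (Zero # ts) A"
    and "\<And>w' n. w \<le> w' \<Longrightarrow> typed w' n N \<Longrightarrow> satl w' (n # ts) A \<Longrightarrow>
      satl w' (Succ \<cdot> n # ts) A"
    and "typed w n N"
  shows "satl w (n # ts) A"
  using sat_induct[OF tyl_tysub[OF assms(1)] assms(2), of n] assms(3-5)
  by (simp add: satl_def case_nat_nth)

lemma satl_fsub:
  assumes "wff \<Gamma> A" "\<And>i. i < length \<Gamma> \<Longrightarrow> sub ((!) ts) (\<tau> i) = ts' ! i"
  shows "satl w ts (fsub \<tau> A) \<longleftrightarrow> satl w ts' A"
  unfolding satl_def sat_fsub by (rule sat_cong[OF assms(1)]) (simp add: assms(2))

lemma prv_cases: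
  assumes "typed w t N" "wff (ctx w) C"
    and "\<And>w'. w \<le> w' \<Longrightarrow> val w' t = val w' Zero \<Longrightarrow> prv w' C"
    and "\<And>w' n. w \<le> w' \<Longrightarrow> typed w' n N \<Longrightarrow> val w' t = app w' (val w' Succ) (val w' n) \<Longrightarrow> prv w' C"
  shows "prv w C"
proof -
  \<comment> \<open>A case distinction on \<open>t\<close> is obtained from induction on a number
    \<open>n\<close> for the formula \<open>n = t \<longrightarrow> C\<close>, instantiated with
    \<open>t\<close> itself.\<close>
  let ?A = "Eq N (Var 0) (lift t) \<^bold>\<longrightarrow> flift C"
  have id: "tysub (ctx w') Var (ctx w)" if "w \<le> w'" for w'
    using tysub_mono[OF _ that, of Var] by (simp add: tysub_def)
  have s: "sub (case_nat n Var) (lift t) = t" "fsub (case_nat n Var) (flift C) = C" for n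
    using fsub_inst_flift by (simp_all add: sub_ren comp_def sub_Var inst_def)
  have eq: "sat w' (case_nat n Var) ?A \<longleftrightarrow> (\<forall>w'' \<ge> w'. val w'' n = val w'' t \<longrightarrow> prv w'' C)"
    if "w \<le> w'" "typed w' n N" for w' n
  proof -
    have ty: "tysub (ctx w'') (case_nat n Var) (N # ctx w)" if w'': "w' \<le> w''" for w''
      using tysub_cons[OF typeof_mono[OF \<open>typed w' n N\<close> w''] id[OF order_trans[OF \<open>w \<le> w'\<close> w'']]] .
    have "sat w'' (case_nat n Var) (Eq N (Var 0) (lift t)) \<longleftrightarrow> val w'' n = val w'' t" if "w' \<le> w''" for w''
      by (subst sat_Eq[OF ty[OF that]]) (simp_all add: s)
    moreover have "wff (N # ctx w) (Eq N (Var 0) (lift t))"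
      using assms(1) by (simp add: has_type_iff typeof_lift)
    ultimately show ?thesis
      by (subst sat_Imp[OF ty[OF order_refl]]) (auto simp: sat_def s)
  qed
  have "sat w (case_nat t Var) ?A"
  proof (rule sat_induct[OF id[OF order_refl] _ _ _ assms(1)])
    show "wff (N # ctx w) ?A"
      using assms by (simp add: has_type_iff typeof_lift wff_flift)
    show "sat w (case_nat Zero Var) ?A"
      by (subst eq) (use assms(3) in auto)
    fix w' n assume w': "w \<le> w'" "typed w' n N"
    have "prv w'' C" if "w' \<le> w''" "app w'' (val w'' Succ) (val w'' n) = val w'' t" for w''
      using assms(4)[OF order_trans[OF w'(1) that(1)] typeof_mono[OF w'(2) that(1)]] that(2) by simp
    then show "sat w' (case_nat (Succ \<cdot> n) Var) ?A"
      by (subst eq[OF w'(1)]) (use w' in auto)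
  qed
  then show ?thesis
    using eq[OF order_refl assms(1)] by blast
qed

text \<open>The head of the list is the innermost quantifier, hence variable 0. The order of the
  list then agrees with that of contexts, and the body lives in
  \<open>\<rho>s @ \<Gamma>\<close>.\<close>

fun foralls :: "ty list \<Rightarrow> fm \<Rightarrow> fm" where
  "foralls [] A = A"
| "foralls (\<rho> # \<rho>s) A = foralls \<rho>s (Forall \<rho> A)"

lemma wff_foralls: "wff \<Gamma> (foralls \<rho>s A) \<longleftrightarrow> wff (\<rho>s @ \<Gamma>) A"
  by (induction \<rho>s arbitrary: A) auto

lemma satl_foralls:
  assumes "tyl w ts \<Gamma>" "wff (\<rho>s @ \<Gamma>) A"
  shows "satl w ts (foralls \<rho>s A) \<longleftrightarrow> (\<forall>w' \<ge> w. \<forall>us. tyl w' us \<rho>s \<longrightarrow> satl w' (us @ ts) A)"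
  using assms(2)
proof (induction \<rho>s arbitrary: A)
  case Nil
  show ?case using satl_mono[of w ts A] by (simp) (meson order_refl)
next
  case (Cons \<rho> \<rho>s)
  have "satl w ts (foralls (\<rho> # \<rho>s) A) \<longleftrightarrow>
    (\<forall>w' \<ge> w. \<forall>us. tyl w' us \<rho>s \<longrightarrow> satl w' (us @ ts) (Forall \<rho> A))"
    using Cons by simp
  also have "\<dots> \<longleftrightarrow> (\<forall>w' \<ge> w. \<forall>us. tyl w' us \<rho>s \<longrightarrow> (\<forall>w'' \<ge> w'. \<forall>t. typed w'' t \<rho> \<longrightarrow>
      satl w'' (t # us @ ts) A))"
  proof -
    have "satl w' (us @ ts) (Forall \<rho> A) \<longleftrightarrow>
      (\<forall>w'' \<ge> w'. \<forall>t. typed w'' t \<rho> \<longrightarrow> satl w'' (t # us @ ts) A)"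
      if "w \<le> w'" "tyl w' us \<rho>s" for w' us
      by (rule satl_Forall[of _ _ "\<rho>s @ \<Gamma>"])
        (use that Cons.prems tyl_mono[OF assms(1)] in simp_all)
    then show ?thesis by meson
  qed
  also have "\<dots> \<longleftrightarrow> (\<forall>w' \<ge> w. \<forall>us. tyl w' us (\<rho> # \<rho>s) \<longrightarrow> satl w' (us @ ts) A)"
    (is "?l \<longleftrightarrow> ?r")
  proof
    assume ?l
    show ?r
    proof (intro allI impI)
      fix w' us assume "w \<le> w'" "tyl w' us (\<rho> # \<rho>s)"
      moreover from this obtain t us' where "us = t # us'" "typed w' t \<rho>" "tyl w' us' \<rho>s"
        by (auto simp: map_eq_Cons_conv)
      ultimately show "satl w' (us @ ts) A" using \<open>?l\<close> order_refl[of w'] by simp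
    qed
  next
    assume r: ?r
    show ?l
    proof (intro allI impI)
      fix w' us w'' t
      assume "w \<le> w'" "tyl w' us \<rho>s" "w' \<le> w''" "typed w'' t \<rho>"
      then show "satl w'' (t # us @ ts) A"
        using r[rule_format, of w'' "t # us"] tyl_mono[of w' us \<rho>s w''] order_trans[of w w' w''] by simp
    qed
  qed
  finally show ?case .
qed

section \<open>Induction in HA for equations between classes\<close>

lemma env_cases:
  assumes "map (tyw w) E = map Some \<rho>s"
  obtains us where "tyl w us \<rho>s" "E = map (val w) us"
proof -
  have "\<exists>us. tyl w us \<rho>s \<and> E = map (val w) us"
    using assms
  proof (induction E arbitrary: \<rho>s)
    case (Cons X E)
    then obtain \<rho> \<rho>s' where "\<rho>s = \<rho> # \<rho>s'" "tyw w X = Some \<rho>" "map (tyw w) E = map Some \<rho>s'"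
      by (auto simp: Cons_eq_map_conv)
    moreover from Cons.IH[OF this(3)] obtain us where "tyl w us \<rho>s'" "E = map (val w) us" by blast
    moreover obtain x where "X = val w x" "typed w x \<rho>"
      using cls_cases[OF \<open>tyw w X = Some \<rho>\<close>] .
    ultimately show ?case by (intro exI[of _ "x # us"]) simp
  qed simp
  then show ?thesis using that by blast
qed

abbreviation den_eq :: "world \<Rightarrow> cls list \<Rightarrow> tm \<Rightarrow> tm \<Rightarrow> bool" where
  "den_eq w E s t \<equiv> den w E s = den w E t"

text \<open>The values \<open>E\<close> are quantified in the induction formula and may change from
  step to step, as accumulators do. The fixed parameters \<open>as\<close> are terms, not classes,
  because they are read anew in every later world.\<close>

lemma cls_induct:
  assumes ty: "typeof (\<rho>s @ N # \<tau>s) s = Some \<sigma>" "typeof (\<rho>s @ N # \<tau>s) t = Some \<sigma>" "tyl w as \<tau>s"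
    and base: "\<And>w' E. w \<le> w' \<Longrightarrow> map (tyw w') E = map Some \<rho>s \<Longrightarrow>
      den_eq w' (E @ val w' Zero # map (val w') as) s t"
    and step: "\<And>w' X E. w \<le> w' \<Longrightarrow> tyw w' X = Some N \<Longrightarrow>
      (\<And>E. map (tyw w') E = map Some \<rho>s \<Longrightarrow>
        den_eq w' (E @ X # map (val w') as) s t) \<Longrightarrow>
      map (tyw w') E = map Some \<rho>s \<Longrightarrow>
      den_eq w' (E @ app w' (val w' Succ) X # map (val w') as) s t"
    and X: "tyw w X = Some N" and E: "map (tyw w) E = map Some \<rho>s"
  shows "den_eq w (E @ X # map (val w) as) s t"
proof -
  let ?A = "foralls \<rho>s (Eq \<sigma> s t)"
  have eq: "satl w' (n # as) ?A \<longleftrightarrow> (\<forall>w'' \<ge> w'. \<forall>E. map (tyw w'') E = map Some \<rho>s \<longrightarrow>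
    den_eq w'' (E @ val w'' n # map (val w'') as) s t)"
    if "w \<le> w'" "typed w' n N" for w' n
  proof -
    have "satl w'' (us @ n # as) (Eq \<sigma> s t) \<longleftrightarrow>
      den_eq w'' (map (val w'') us @ val w'' n # map (val w'') as) s t"
      if w'': "w' \<le> w''" "tyl w'' us \<rho>s" for w'' us
    proof -
      have "tyl w'' (us @ n # as) (\<rho>s @ N # \<tau>s)"
        using w'' tyl_mono[OF ty(3) order_trans[OF \<open>w \<le> w'\<close> w''(1)]] typeof_mono[OF \<open>typed w' n N\<close> w''(1)]
        by simp
      from satl_Eq[OF this ty(1,2)] show ?thesis by simp
    qed
    moreover have "satl w' (n # as) ?A \<longleftrightarrow>
      (\<forall>w'' \<ge> w'. \<forall>us. tyl w'' us \<rho>s \<longrightarrow> satl w'' (us @ n # as) (Eq \<sigma> s t))"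
      by (rule satl_foralls[of _ _ "N # \<tau>s"]) (use that ty tyl_mono[OF ty(3) that(1)] in \<open>simp_all add: has_type_iff wff_foralls\<close>)
    moreover have "(\<forall>E. map (tyw w'') E = map Some \<rho>s \<longrightarrow> P E) \<longleftrightarrow> (\<forall>us. tyl w'' us \<rho>s \<longrightarrow> P (map (val w'') us))"
      for w'' P
    proof (intro iffI allI impI)
      fix us assume "\<forall>E. map (tyw w'') E = map Some \<rho>s \<longrightarrow> P E" "tyl w'' us \<rho>s"
      then show "P (map (val w'') us)" by (simp add: comp_def)
    next
      fix E assume us: "\<forall>us. tyl w'' us \<rho>s \<longrightarrow> P (map (val w'') us)" and "map (tyw w'') E = map Some \<rho>s"
      then obtain us where "tyl w'' us \<rho>s" "E = map (val w'') us" using env_cases by blast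
      then show "P E" using us by blast
    qed
    ultimately show ?thesis by simp
  qed
  obtain x where x: "X = val w x" "typed w x N" using cls_cases[OF X] .
  have "satl w (x # as) ?A"
  proof (rule satl_induct[OF ty(3) _ _ _ x(2)])
    show "wff (N # \<tau>s) ?A" using ty by (simp add: wff_foralls has_type_iff)
    show "satl w (Zero # as) ?A" by (subst eq) (simp_all add: base)
    fix w' n assume w': "w \<le> w'" "typed w' n N" and IH: "satl w' (n # as) ?A"
    show "satl w' (Succ \<cdot> n # as) ?A"
    proof (subst eq[OF w'(1)])
      show "typed w' (Succ \<cdot> n) N" using w' by simp
      show "\<forall>w'' \<ge> w'. \<forall>E. map (tyw w'') E = map Some \<rho>s \<longrightarrow>
        den_eq w'' (E @ val w'' (Succ \<cdot> n) # map (val w'') as) s t"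
      proof (intro allI impI)
        fix w'' E assume w'': "w' \<le> w''" and E: "map (tyw w'') E = map Some \<rho>s"
        have "den_eq w'' (E @ app w'' (val w'' Succ) (val w'' n) # map (val w'') as) s t"
        proof (rule step[OF order_trans[OF w'(1) w''] _ _ E])
          show "tyw w'' (val w'' n) = Some N" using typeof_mono[OF w'(2) w''] by simp
          show "den_eq w'' (E @ val w'' n # map (val w'') as) s t"
            if "map (tyw w'') E = map Some \<rho>s" for E
            using IH that w'' unfolding eq[OF w'] by blast
        qed
        then show "den_eq w'' (E @ val w'' (Succ \<cdot> n) # map (val w'') as) s t" by simp
      qed
    qed
  qed
  then show ?thesis unfolding eq[OF order_refl x(2)] using E x by blast
qed

lemmas cls_induct0 = cls_induct[of "[]" _ _ _ _ _ _ _ "[]", simplified]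

lemma cls_induct1:
  assumes ty: "typeof (\<rho> # N # \<tau>s) s = Some \<sigma>" "typeof (\<rho> # N # \<tau>s) t = Some \<sigma>" "tyl w as \<tau>s"
    and base: "\<And>w' Y. w \<le> w' \<Longrightarrow> tyw w' Y = Some \<rho> \<Longrightarrow>
      den_eq w' (Y # val w' Zero # map (val w') as) s t"
    and step: "\<And>w' X Y. w \<le> w' \<Longrightarrow> tyw w' X = Some N \<Longrightarrow>
      (\<And>Y. tyw w' Y = Some \<rho> \<Longrightarrow>
        den_eq w' (Y # X # map (val w') as) s t) \<Longrightarrow>
      tyw w' Y = Some \<rho> \<Longrightarrow>
      den_eq w' (Y # app w' (val w' Succ) X # map (val w') as) s t"
    and X: "tyw w X = Some N" "tyw w Y = Some \<rho>"
  shows "den_eq w (Y # X # map (val w) as) s t"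
proof -
  have "den_eq w ([Y] @ X # map (val w) as) s t"
  proof (rule cls_induct[of "[\<rho>]"])
    show "den_eq w' (E @ val w' Zero # map (val w') as) s t"
      if "w \<le> w'" "map (tyw w') E = map Some [\<rho>]" for w' E
      using that base by (auto simp: map_eq_Cons_conv)
    fix w' X E assume "w \<le> w'" "tyw w' X = Some N" "map (tyw w') E = map Some [\<rho>]"
      and IH: "\<And>E. map (tyw w') E = map Some [\<rho>] \<Longrightarrow>
        den_eq w' (E @ X # map (val w') as) s t"
    then obtain Y where "E = [Y]" "tyw w' Y = Some \<rho>" by (auto simp: map_eq_Cons_conv)
    then show "den_eq w' (E @ app w' (val w' Succ) X # map (val w') as) s t"
      using step[OF \<open>w \<le> w'\<close> \<open>tyw w' X = Some N\<close>, of Y] IH[of "[_]"] by simp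
  qed (use ty X in auto)
  then show ?thesis by simp
qed

lemma cls_induct2:
  assumes ty: "typeof (\<rho> # \<rho>' # N # \<tau>s) s = Some \<sigma>" "typeof (\<rho> # \<rho>' # N # \<tau>s) t = Some \<sigma>" "tyl w as \<tau>s"
    and base: "\<And>w' Y Y'. w \<le> w' \<Longrightarrow> tyw w' Y = Some \<rho> \<Longrightarrow> tyw w' Y' = Some \<rho>' \<Longrightarrow>
      den_eq w' (Y # Y' # val w' Zero # map (val w') as) s t"
    and step: "\<And>w' X Y Y'. w \<le> w' \<Longrightarrow> tyw w' X = Some N \<Longrightarrow>
      (\<And>Y Y'. tyw w' Y = Some \<rho> \<Longrightarrow> tyw w' Y' = Some \<rho>' \<Longrightarrow>
        den_eq w' (Y # Y' # X # map (val w') as) s t) \<Longrightarrow>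
      tyw w' Y = Some \<rho> \<Longrightarrow> tyw w' Y' = Some \<rho>' \<Longrightarrow>
      den_eq w' (Y # Y' # app w' (val w' Succ) X # map (val w') as) s t"
    and X: "tyw w X = Some N" "tyw w Y = Some \<rho>" "tyw w Y' = Some \<rho>'"
  shows "den_eq w (Y # Y' # X # map (val w) as) s t"
proof -
  have "den_eq w ([Y, Y'] @ X # map (val w) as) s t"
  proof (rule cls_induct[of "[\<rho>, \<rho>']"])
    show "den_eq w' (E @ val w' Zero # map (val w') as) s t"
      if "w \<le> w'" "map (tyw w') E = map Some [\<rho>, \<rho>']" for w' E
      using that base by (auto simp: map_eq_Cons_conv)
    fix w' X E assume "w \<le> w'" "tyw w' X = Some N" "map (tyw w') E = map Some [\<rho>, \<rho>']"
      and IH: "\<And>E. map (tyw w') E = map Some [\<rho>, \<rho>'] \<Longrightarrow>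
        den_eq w' (E @ X # map (val w') as) s t"
    then obtain Y Y' where "E = [Y, Y']" "tyw w' Y = Some \<rho>" "tyw w' Y' = Some \<rho>'"
      by (auto simp: map_eq_Cons_conv)
    then show "den_eq w' (E @ app w' (val w' Succ) X # map (val w') as) s t"
      using step[OF \<open>w \<le> w'\<close> \<open>tyw w' X = Some N\<close>, of Y Y'] IH[of "[_, _]"] by simp
  qed (use ty X in auto)
  then show ?thesis by simp
qed

section \<open>Arithmetic\<close>

lemma const_types:
  "typeof [] plus_tm = Some (N \<leadsto> N \<leadsto> N)"
  "typeof [] pred_tm = Some (N \<leadsto> N)"
  "typeof [] monus_tm = Some (N \<leadsto> N \<leadsto> N)"
  "typeof [] triangle_tm = Some (N \<leadsto> N)"
  "typeof [] pair_tm = Some (N \<leadsto> N \<leadsto> N)"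
  "typeof [] unpair_tm = Some (N \<leadsto> (N \<leadsto> N \<leadsto> N) \<leadsto> N)"
  "typeof [] fst_tm = Some (N \<leadsto> N)"
  "typeof [] snd_tm = Some (N \<leadsto> N)"
  "typeof [] nil_tm = Some N"
  "typeof [] single_tm = Some (N \<leadsto> N)"
  "typeof [] append_tm = Some (N \<leadsto> N \<leadsto> N)"
  "typeof [] seg_tm = Some ((N \<leadsto> N) \<leadsto> N \<leadsto> N)"
  by (simp_all add: plus_tm_def pred_tm_def monus_tm_def triangle_tm_def pair_tm_def unpair_tm_def
    fst_tm_def snd_tm_def nil_tm_def single_tm_def append_tm_def seg_tm_def)

lemmas const_types' [simp] = const_types [THEN typeof_closed]
lemmas const_den [simp] = const_types [THEN den_closed]

abbreviation zr :: "world \<Rightarrow> cls" where "zr w \<equiv> val w Zero"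
abbreviation sc :: "world \<Rightarrow> cls \<Rightarrow> cls" where "sc w X \<equiv> app w (val w Succ) X"
abbreviation ap2 :: "world \<Rightarrow> cls \<Rightarrow> cls \<Rightarrow> cls \<Rightarrow> cls" where "ap2 w F X Y \<equiv> app w (app w F X) Y"
abbreviation pl :: "world \<Rightarrow> cls \<Rightarrow> cls \<Rightarrow> cls" where "pl w \<equiv> ap2 w (val w plus_tm)"
abbreviation mn :: "world \<Rightarrow> cls \<Rightarrow> cls \<Rightarrow> cls" where "mn w \<equiv> ap2 w (val w monus_tm)"
abbreviation pd :: "world \<Rightarrow> cls \<Rightarrow> cls" where "pd w \<equiv> app w (val w pred_tm)"
abbreviation tri :: "world \<Rightarrow> cls \<Rightarrow> cls" where "tri w \<equiv> app w (val w triangle_tm)"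
abbreviation pr :: "world \<Rightarrow> cls \<Rightarrow> cls \<Rightarrow> cls" where "pr w \<equiv> ap2 w (val w pair_tm)"
abbreviation up2 :: "world \<Rightarrow> cls \<Rightarrow> cls \<Rightarrow> cls" where "up2 w \<equiv> ap2 w (val w unpair_tm)"
abbreviation ft :: "world \<Rightarrow> cls \<Rightarrow> cls" where "ft w \<equiv> app w (val w fst_tm)"
abbreviation sd :: "world \<Rightarrow> cls \<Rightarrow> cls" where "sd w \<equiv> app w (val w snd_tm)"
abbreviation snoc :: "world \<Rightarrow> cls \<Rightarrow> cls \<Rightarrow> cls" where "snoc w A X \<equiv> sc w (pr w A X)"
abbreviation cat :: "world \<Rightarrow> cls \<Rightarrow> cls \<Rightarrow> cls" where "cat w \<equiv> ap2 w (val w append_tm)"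

lemma plus_Zero [simp]: "tyw w A = Some N \<Longrightarrow> pl w A (zr w) = A"
  by (simp add: plus_tm_def)

lemma plus_Succ [simp]: 
  "tyw w A = Some N \<Longrightarrow> tyw w B = Some N \<Longrightarrow> pl w A (sc w B) = sc w (pl w A B)"
  by (simp add: plus_tm_def)

lemma Zero_plus [simp]: "tyw w A = Some N \<Longrightarrow> pl w (zr w) A = A"
  using cls_induct0[where \<tau>s="[]" and s="plus_tm \<cdot> Zero \<cdot> Var 0" and t="Var 0" and \<sigma>=N and w=w and as="[]" and X=A]
  by simp

lemma Succ_plus [simp]:
  assumes "tyw w A = Some N" "tyw w B = Some N"
  shows "pl w (sc w A) B = sc w (pl w A B)"
  using cls_induct1[where \<rho>=N and \<tau>s="[]" and s="plus_tm \<cdot> (Succ \<cdot> Var 0) \<cdot> Var 1"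
      and t="Succ \<cdot> (plus_tm \<cdot> Var 0 \<cdot> Var 1)" and \<sigma>=N and w=w and as="[]" and X=B and Y=A] assms
  by simp

lemma plus_comm:
  assumes "tyw w A = Some N" "tyw w B = Some N"
  shows "pl w A B = pl w B A"
  using cls_induct1[where \<rho>=N and \<tau>s="[]" and s="plus_tm \<cdot> Var 0 \<cdot> Var 1"
      and t="plus_tm \<cdot> Var 1 \<cdot> Var 0" and \<sigma>=N and w=w and as="[]" and X=B and Y=A] assms
  by simp

lemma plus_assoc:
  assumes "tyw w A = Some N" "tyw w B = Some N" "tyw w C = Some N"
  shows "pl w (pl w A B) C = pl w A (pl w B C)"
  using cls_induct2[where \<rho>=N and \<rho>'=N and \<tau>s="[]" and s="plus_tm \<cdot> (plus_tm \<cdot> Var 0 \<cdot> Var 1) \<cdot> Var 2"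
      and t="plus_tm \<cdot> Var 0 \<cdot> (plus_tm \<cdot> Var 1 \<cdot> Var 2)" and \<sigma>=N and w=w and as="[]"
      and X=C and Y=A and Y'=B] assms
  by simp

lemma pred_simps [simp]: "pd w (zr w) = zr w" "tyw w A = Some N \<Longrightarrow> pd w (sc w A) = A"
  by (simp_all add: pred_tm_def den_closed[of "Lam N (Lam N (Var 1))", symmetric])

lemma monus_Zero [simp]: "tyw w A = Some N \<Longrightarrow> mn w A (zr w) = A"
  by (simp add: monus_tm_def)

lemma monus_Succ: 
  "tyw w A = Some N \<Longrightarrow> tyw w B = Some N \<Longrightarrow> mn w A (sc w B) = pd w (mn w A B)"
  by (simp add: monus_tm_def)

lemma Zero_monus [simp]: "tyw w A = Some N \<Longrightarrow> mn w (zr w) A = zr w"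
  using cls_induct0[where \<tau>s="[]" and s="monus_tm \<cdot> Zero \<cdot> Var 0" and t="Zero" and \<sigma>=N and w=w and as="[]" and X=A]
  by (simp add: monus_Succ)

lemma Succ_monus_Succ [simp]:
  assumes "tyw w A = Some N" "tyw w B = Some N"
  shows "mn w (sc w A) (sc w B) = mn w A B"
  using cls_induct1[where \<rho>=N and \<tau>s="[]" and s="monus_tm \<cdot> (Succ \<cdot> Var 0) \<cdot> (Succ \<cdot> Var 1)"
      and t="monus_tm \<cdot> Var 0 \<cdot> Var 1" and \<sigma>=N and w=w and as="[]" and X=B and Y=A] assms
  by (simp add: monus_Succ)

lemma plus_monus:
  assumes "tyw w A = Some N" "tyw w B = Some N"
  shows "mn w (pl w A B) B = A"
  using cls_induct1[where \<rho>=N and \<tau>s="[]" and s="monus_tm \<cdot> (plus_tm \<cdot> Var 0 \<cdot> Var 1) \<cdot> Var 1"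
      and t="Var 0" and \<sigma>=N and w=w and as="[]" and X=B and Y=A] assms
  by simp

lemma triangle_simps: "tri w (zr w) = zr w"
  "tyw w A = Some N \<Longrightarrow> tri w (sc w A) = pl w (tri w A) (sc w A)"
  by (simp_all add: triangle_tm_def)

lemma pair_eq: "tyw w A = Some N \<Longrightarrow> tyw w B = Some N \<Longrightarrow> pr w A B = pl w (tri w (pl w A B)) A"
  by (simp add: pair_tm_def)

lemma pair_Zero_Zero: "pr w (zr w) (zr w) = zr w"
  by (simp add: pair_eq triangle_simps)

lemma pair_Succ:
  "tyw w A = Some N \<Longrightarrow> tyw w B = Some N \<Longrightarrow> pr w (sc w A) B = sc w (pr w A (sc w B))"
  by (simp add: pair_eq)

lemma pair_Zero_Succ: "tyw w A = Some N \<Longrightarrow> pr w (zr w) (sc w A) = sc w (pr w A (zr w))"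
  by (simp add: pair_eq triangle_simps)

section \<open>Inverting the pairing function\<close>

abbreviation Cont :: ty where "Cont \<equiv> N \<leadsto> N \<leadsto> N"

text \<open>A name for the step inside \<open>unpair_tm\<close>: a continuation precomposed with the
  move to the next point of the diagonal enumeration.\<close>

definition next_tm :: tm where
  "next_tm = Lam Cont (Lam N (Lam N
     (Rec N \<cdot> (Var 2 \<cdot> Zero \<cdot> (Succ \<cdot> Var 1)) \<cdot> Lam N (Lam N (Var 4 \<cdot> (Succ \<cdot> Var 3) \<cdot> Var 1)) \<cdot> Var 0)))"

definition iter_next_tm :: tm where
  "iter_next_tm = Rec (Cont \<leadsto> Cont) \<cdot> Lam Cont (Var 0) \<cdot>
     Lam N (Lam (Cont \<leadsto> Cont) (Lam Cont (Var 1 \<cdot> (next_tm \<cdot> Var 0))))"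

lemma next_types: "typeof [] next_tm = Some (Cont \<leadsto> Cont)" "typeof [] iter_next_tm = Some (N \<leadsto> Cont \<leadsto> Cont)"
proof -
  show "typeof [] next_tm = Some (Cont \<leadsto> Cont)" by (simp add: next_tm_def)
  from typeof_closed[OF this] show "typeof [] iter_next_tm = Some (N \<leadsto> Cont \<leadsto> Cont)"
    by (simp add: iter_next_tm_def)
qed

lemmas next_types' [simp] = next_types [THEN typeof_closed]
lemmas next_den [simp] = next_types [THEN den_closed]

lemma next_simps:
  assumes "tyw w C = Some Cont" "tyw w A = Some N" "tyw w B = Some N"
  shows "ap2 w (app w (val w next_tm) C) A (zr w) = ap2 w C (zr w) (sc w A)"
    "ap2 w (app w (val w next_tm) C) A (sc w B) = ap2 w C (sc w A) B"
  using assms by (simp_all add: next_tm_def)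

lemma iter_next_simps:
  assumes "tyw w C = Some Cont" "tyw w A = Some N"
  shows "ap2 w (val w iter_next_tm) (zr w) C = C"
    "ap2 w (val w iter_next_tm) (sc w A) C = ap2 w (val w iter_next_tm) A (app w (val w next_tm) C)"
  using assms by (simp_all add: iter_next_tm_def)

text \<open>In \<open>unpair_tm\<close> the step lies below further binders of the recursor.
  Closures that mention only variable 0 agree with those formed in the shorter environment of
  \<open>next_tm\<close>.\<close>

lemma den_Cons_Cons: "typeof (tys w [X]) t = Some \<sigma> \<Longrightarrow> den w (X # Y # E) t = den w [X] t"
  unfolding den_def by (rule arg_cong[where f="val w"], rule sub_cong_typed[of "tys w [X]"]) auto

lemma unpair_Zero: "tyw w C = Some Cont \<Longrightarrow> up2 w (zr w) C = ap2 w C (zr w) (zr w)"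
  by (simp add: unpair_tm_def)

lemma unpair_Succ:
  "tyw w C = Some Cont \<Longrightarrow> tyw w A = Some N \<Longrightarrow> up2 w (sc w A) C = up2 w A (app w (val w next_tm) C)"
  by (simp add: unpair_tm_def next_tm_def den_Cons_Cons)

text \<open>\<open>pair A B\<close> lies \<open>A\<close> steps after the first point
  \<open>pair 0 (A + B)\<close> of its diagonal, and each step back composes the continuation with
  \<open>next_tm\<close>.\<close>

lemma unpair_pair_iter:
  assumes "tyw w A = Some N" "tyw w B = Some N" "tyw w C = Some Cont"
  shows "up2 w (pr w A B) C = up2 w (pr w (zr w) (pl w A B)) (ap2 w (val w iter_next_tm) A C)"
  using cls_induct2[where \<rho>=Cont and \<rho>'=N and \<tau>s="[]" and s="unpair_tm \<cdot> (pair_tm \<cdot> Var 2 \<cdot> Var 1) \<cdot> Var 0"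
      and t="unpair_tm \<cdot> (pair_tm \<cdot> Zero \<cdot> (plus_tm \<cdot> Var 2 \<cdot> Var 1)) \<cdot> (iter_next_tm \<cdot> Var 2 \<cdot> Var 0)"
      and \<sigma>=N and w=w and as="[]" and X=A and Y=C and Y'=B] assms
  by (simp add: iter_next_simps pair_Succ unpair_Succ)

text \<open>Moving \<open>A\<close> times along the diagonal from \<open>(0, A + B)\<close> ends in
  \<open>(A, B)\<close>. In the induction one move is taken over by the continuation, so
  \<open>B\<close> becomes its successor.\<close>

lemma iter_next_eval:
  assumes "tyw w A = Some N" "tyw w B = Some N" "tyw w C = Some Cont"
  shows "ap2 w (ap2 w (val w iter_next_tm) A C) (zr w) (pl w A B) = ap2 w C A B"
proof -
  let ?s = "iter_next_tm \<cdot> Var 2 \<cdot> Var 0 \<cdot> Zero \<cdot> (plus_tm \<cdot> Var 2 \<cdot> Var 1)"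
  let ?t = "Var 0 \<cdot> Var 2 \<cdot> Var 1"
  have "den_eq w (C # B # A # map (val w) []) ?s ?t"
  proof (rule cls_induct2[where \<rho>=Cont and \<rho>'=N and \<tau>s="[]"])
    fix w' X Y Y'
    assume "tyw w' X = Some N" "tyw w' Y = Some Cont" "tyw w' Y' = Some N"
      and IH: "\<And>Y Y'. tyw w' Y = Some Cont \<Longrightarrow> tyw w' Y' = Some N \<Longrightarrow>
        den_eq w' (Y # Y' # X # map (val w') []) ?s ?t"
    then show "den_eq w' (Y # Y' # sc w' X # map (val w') []) ?s ?t"
      using IH[of "app w' (val w' next_tm) Y" "sc w' Y'"] by (simp add: iter_next_simps next_simps)
  qed (use assms in \<open>simp_all add: iter_next_simps\<close>)
  then show ?thesis using assms by simp
qed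

text \<open>The first point of a diagonal succeeds the last point \<open>pair A 0\<close> of the
  previous one. From there the two preceding lemmas lead back to \<open>pair 0 A\<close>, where the
  induction hypothesis applies.\<close>

lemma unpair_pair_Zero:
  assumes "tyw w A = Some N" "tyw w C = Some Cont"
  shows "up2 w (pr w (zr w) A) C = ap2 w C (zr w) A"
proof -
  let ?s = "unpair_tm \<cdot> (pair_tm \<cdot> Zero \<cdot> Var 1) \<cdot> Var 0" and ?t = "Var 0 \<cdot> Zero \<cdot> Var 1"
  have "den_eq w (C # A # map (val w) []) ?s ?t"
  proof (rule cls_induct1[where \<rho>=Cont and \<tau>s="[]"])
    fix w' X Y
    assume "tyw w' X = Some N" "tyw w' Y = Some Cont"
      and IH: "\<And>Y. tyw w' Y = Some Cont \<Longrightarrow>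
        den_eq w' (Y # X # map (val w') []) ?s ?t"
    then show "den_eq w' (Y # sc w' X # map (val w') []) ?s ?t"
      using unpair_pair_iter[of w' X "zr w'" "app w' (val w' next_tm) Y"]
        iter_next_eval[of w' X "zr w'" "app w' (val w' next_tm) Y"]
      by (simp add: pair_Zero_Succ unpair_Succ next_simps)
  qed (use assms in \<open>simp_all add: pair_Zero_Zero unpair_Zero\<close>)
  then show ?thesis using assms by simp
qed

lemma unpair_pair:
  assumes "tyw w A = Some N" "tyw w B = Some N" "tyw w C = Some Cont"
  shows "up2 w (pr w A B) C = ap2 w C A B"
  using assms unpair_pair_iter[OF assms] iter_next_eval[OF assms] by (simp add: unpair_pair_Zero)

lemma fst_pair [simp]: "tyw w A = Some N \<Longrightarrow> tyw w B = Some N \<Longrightarrow> ft w (pr w A B) = A"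
  and snd_pair [simp]: "tyw w A = Some N \<Longrightarrow> tyw w B = Some N \<Longrightarrow> sd w (pr w A B) = B"
  by (simp_all add: fst_tm_def snd_tm_def unpair_pair)

text \<open>The induction step for surjectivity of pairing: the successor of a pair is a pair,
  namely \<open>pair 0 (Succ A)\<close> if \<open>B\<close> is zero and the next point of the same
  diagonal otherwise.\<close>

lemma pair_fst_snd_Succ:
  assumes "tyw w A = Some N" "tyw w B = Some N"
  shows "pr w (ft w (sc w (pr w A B))) (sd w (sc w (pr w A B))) = sc w (pr w A B)"
  using cls_induct1[where \<rho>=N and \<tau>s="[]"
      and s="pair_tm \<cdot> (fst_tm \<cdot> (Succ \<cdot> (pair_tm \<cdot> Var 0 \<cdot> Var 1))) \<cdot> (snd_tm \<cdot> (Succ \<cdot> (pair_tm \<cdot> Var 0 \<cdot> Var 1)))"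
      and t="Succ \<cdot> (pair_tm \<cdot> Var 0 \<cdot> Var 1)" and \<sigma>=N and w=w and as="[]" and X=B and Y=A] assms
  by (simp add: pair_Zero_Succ[symmetric] pair_Succ[symmetric])

lemma pair_fst_snd:
  assumes "tyw w A = Some N"
  shows "pr w (ft w A) (sd w A) = A"
proof -
  let ?s = "pair_tm \<cdot> (fst_tm \<cdot> Var 0) \<cdot> (snd_tm \<cdot> Var 0)" and ?t = "Var 0"
  have "den_eq w (A # map (val w) []) ?s ?t"
  proof (rule cls_induct0[where \<tau>s="[]"])
    show "den_eq w' (zr w' # map (val w') []) ?s ?t" for w'
      using fst_pair[of w' "zr w'" "zr w'"] snd_pair[of w' "zr w'" "zr w'"]
      by (simp add: pair_Zero_Zero)
    show "den_eq w' (sc w' X # map (val w') []) ?s ?t"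
      if "tyw w' X = Some N" "den_eq w' (X # map (val w') []) ?s ?t" for w' X
      using that pair_fst_snd_Succ[of w' "ft w' X" "sd w' X"] by simp
  qed (use assms in simp_all)
  then show ?thesis using assms by simp
qed

section \<open>Induction and recursion along the coding of sequences\<close>

lemma val_cases:
  assumes "typed w n N" "typed w s \<rho>" "typed w t \<rho>"
    and "\<And>w'. w \<le> w' \<Longrightarrow> val w' n = zr w' \<Longrightarrow> val w' s = val w' t"
    and "\<And>w' m. w \<le> w' \<Longrightarrow> typed w' m N \<Longrightarrow> val w' n = sc w' (val w' m) \<Longrightarrow> val w' s = val w' t"
  shows "val w s = val w t"
proof -
  have eq: "prv w' (Eq \<rho> s t) \<longleftrightarrow> val w' s = val w' t" if "w \<le> w'" for w'
    using val_eq_iff[OF typeof_mono[OF assms(2) that]] by simp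
  have "prv w (Eq \<rho> s t)"
    by (rule prv_cases[OF assms(1)]) (use assms eq in \<open>simp_all add: has_type_iff\<close>)
  then show ?thesis using eq by simp
qed

text \<open>
  The auxiliary induction on \<open>k\<close> establishes the claim for all codes
  below \<open>k\<close>, which are presented as \<open>k - j\<close> to keep the induction formula an equation.
\<close>

lemma code_induct1:
  assumes ty: "typeof (\<rho> # N # \<tau>s) s = Some \<sigma>" "typeof (\<rho> # N # \<tau>s) t = Some \<sigma>" "tyl w as \<tau>s"
    and base: "\<And>w' Y. w \<le> w' \<Longrightarrow> tyw w' Y = Some \<rho> \<Longrightarrow>
      den_eq w' (Y # zr w' # map (val w') as) s t"
    and step: "\<And>w' A X Y. w \<le> w' \<Longrightarrow> tyw w' A = Some N \<Longrightarrow> tyw w' X = Some N \<Longrightarrow>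
      (\<And>Y. tyw w' Y = Some \<rho> \<Longrightarrow>
        den_eq w' (Y # A # map (val w') as) s t) \<Longrightarrow>
      tyw w' Y = Some \<rho> \<Longrightarrow>
      den_eq w' (Y # snoc w' A X # map (val w') as) s t"
    and B: "tyw w B = Some N" "tyw w Y = Some \<rho>"
  shows "den_eq w (Y # B # map (val w) as) s t"
proof -
  let ?F = "N \<leadsto> \<rho> \<leadsto> \<sigma>"
  \<comment> \<open>With \<open>s\<close> and \<open>t\<close> abstracted, another code can be
    supplied by application instead of substitution.\<close>
  define f g where "f = sub ((!) as) (Lam N (Lam \<rho> s))" and "g = sub ((!) as) (Lam N (Lam \<rho> t))"
  have fg: "typed w f ?F" "typed w g ?F"
    unfolding f_def g_def by (rule typeof_sub[OF _ tyl_tysub[OF ty(3)]]; simp add: ty)+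
  have ev: "ap2 w' (val w' f) B Y = den w' (Y # B # map (val w') as) s"
    "ap2 w' (val w' g) B Y = den w' (Y # B # map (val w') as) t"
    if "w \<le> w'" "tyw w' B = Some N" "tyw w' Y = Some \<rho>" for w' B Y
  proof -
    have l: "tyl w' as \<tau>s" using tyl_mono[OF ty(3) that(1)] .
    have "val w' f = den w' (map (val w') as) (Lam N (Lam \<rho> s))"
      "val w' g = den w' (map (val w') as) (Lam N (Lam \<rho> t))"
      unfolding f_def g_def by (rule val_sub[OF l]; simp add: ty)+
    then show "ap2 w' (val w' f) B Y = den w' (Y # B # map (val w') as) s"
      "ap2 w' (val w' g) B Y = den w' (Y # B # map (val w') as) t"
      using that ty tyl_tys[OF l] tyl_tyE[OF l] by simp_all
  qed
  \<comment> \<open>Variable 2 is the bound \<open>k\<close> on which the induction runs, variable 1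
    the offset \<open>j\<close> and variable 0 the generalised parameter. The offset 0 returns the
    claim for \<open>k\<close> itself.\<close>
  let ?s = "Var 3 \<cdot> (monus_tm \<cdot> Var 2 \<cdot> Var 1) \<cdot> Var 0" and ?t = "Var 4 \<cdot> (monus_tm \<cdot> Var 2 \<cdot> Var 1) \<cdot> Var 0"
  have "den_eq w (Y # zr w # B # map (val w) [f, g]) ?s ?t"
  proof (rule cls_induct2[where \<rho>=\<rho> and \<rho>'=N and \<tau>s="[?F, ?F]" and \<sigma>=\<sigma>])
    show "tyl w [f, g] [?F, ?F]" using fg by simp
    fix w' Y Y' assume w': "w \<le> w'" "tyw w' Y = Some \<rho>" "tyw w' Y' = Some N"
    note fg' = fg[THEN typeof_mono, OF w'(1)]
    show "den_eq w' (Y # Y' # zr w' # map (val w') [f, g]) ?s ?t"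
      using fg' w' base[OF w'(1,2)] by (simp add: ev)
  next
    fix w' X Y Y' assume w': "w \<le> w'" and X: "tyw w' X = Some N" and Y: "tyw w' Y = Some \<rho>" "tyw w' Y' = Some N"
      and IH: "\<And>Y Y'. tyw w' Y = Some \<rho> \<Longrightarrow> tyw w' Y' = Some N \<Longrightarrow>
        den_eq w' (Y # Y' # X # map (val w') [f, g]) ?s ?t"
    note fg' = fg[THEN typeof_mono, OF w']
    have IH': "ap2 w' (val w' f) (mn w' X J) Z = ap2 w' (val w' g) (mn w' X J) Z"
      if "tyw w' Z = Some \<rho>" "tyw w' J = Some N" for Z J
      using IH[OF that] that X fg' by simp
    let ?A = "ft w' X" and ?B = "sd w' X"
    \<comment> \<open>By the Cantor formula \<open>X = A + T\<close> with a triangular number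
      \<open>T\<close>, so the code \<open>A\<close> of the shorter sequence is
      \<open>X - T\<close>, the form covered by the induction hypothesis.\<close>
    let ?T = "tri w' (pl w' ?A ?B)"
    have XAB: "X = pr w' ?A ?B" using X by (simp add: pair_fst_snd)
    then have "X = pl w' ?A ?T" using X pair_eq[of w' ?A ?B] plus_comm[of w' ?A ?T] by simp
    then have A: "mn w' X ?T = ?A" using X plus_monus[of w' ?A ?T] by simp
    have eqS: "ap2 w' (val w' f) (sc w' X) Y = ap2 w' (val w' g) (sc w' X) Y"
    proof -
      have "den_eq w' (Z # ?A # map (val w') as) s t"
        if "tyw w' Z = Some \<rho>" for Z
        using IH'[OF that, of ?T] X that by (simp add: A ev[OF w'])
      from step[OF w' _ _ this Y(1), of ?B] X XAB Y show ?thesis by (simp add: ev[OF w'])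
    qed
    obtain x where x: "X = val w' x" "typed w' x N" using cls_cases[OF X] .
    obtain y where y: "Y = val w' y" "typed w' y \<rho>" using cls_cases[OF Y(1)] .
    obtain j where j: "Y' = val w' j" "typed w' j N" using cls_cases[OF Y(2)] .
    \<comment> \<open>\<open>S\<close> serves the offset 0 and \<open>P\<close> a positive offset,
      where \<open>Succ x - j = x - pred j\<close>. Both are stated with terms to reach the later
      worlds of the case distinction; \<open>pred_tm \<cdot> j\<close> can be named already
      here.\<close>
    have S: "val w' (f \<cdot> (Succ \<cdot> x) \<cdot> y) = val w' (g \<cdot> (Succ \<cdot> x) \<cdot> y)"
      using eqS x y by simp
    have P: "val w' (f \<cdot> (monus_tm \<cdot> x \<cdot> (pred_tm \<cdot> j)) \<cdot> y) = val w' (g \<cdot> (monus_tm \<cdot> x \<cdot> (pred_tm \<cdot> j)) \<cdot> y)"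
      using IH'[of Y "pd w' Y'"] x y j by simp
    have "val w' (f \<cdot> (monus_tm \<cdot> (Succ \<cdot> x) \<cdot> j) \<cdot> y) = val w' (g \<cdot> (monus_tm \<cdot> (Succ \<cdot> x) \<cdot> j) \<cdot> y)"
    proof (rule val_cases[OF j(2), of _ \<sigma>])
      fix w'' assume w'': "w' \<le> w''" and j0: "val w'' j = zr w''"
      have "val w'' (f \<cdot> (Succ \<cdot> x) \<cdot> y) = val w'' (g \<cdot> (Succ \<cdot> x) \<cdot> y)"
        by (rule val_mono[OF S _ w'', of \<sigma>]) (use fg' x y in simp)
      then show "val w'' (f \<cdot> (monus_tm \<cdot> (Succ \<cdot> x) \<cdot> j) \<cdot> y) = val w'' (g \<cdot> (monus_tm \<cdot> (Succ \<cdot> x) \<cdot> j) \<cdot> y)"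
        using j0 typeof_mono[OF x(2) w''] by simp
    next
      fix w'' m assume w'': "w' \<le> w''" and m: "typed w'' m N" "val w'' j = sc w'' (val w'' m)"
      have "val w'' (f \<cdot> (monus_tm \<cdot> x \<cdot> (pred_tm \<cdot> j)) \<cdot> y) = val w'' (g \<cdot> (monus_tm \<cdot> x \<cdot> (pred_tm \<cdot> j)) \<cdot> y)"
        by (rule val_mono[OF P _ w'', of \<sigma>]) (use fg' x y j in simp)
      then show "val w'' (f \<cdot> (monus_tm \<cdot> (Succ \<cdot> x) \<cdot> j) \<cdot> y) = val w'' (g \<cdot> (monus_tm \<cdot> (Succ \<cdot> x) \<cdot> j) \<cdot> y)"
        using m typeof_mono[OF x(2) w''] by simp
    qed (use fg' x y j in simp_all)
    then show "den_eq w' (Y # Y' # sc w' X # map (val w') [f, g]) ?s ?t"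
      using fg' x y j by simp
  qed (use fg B in simp_all)
  then show ?thesis using B fg by (simp add: ev)
qed

lemma code_induct0:
  assumes ty: "typeof (N # \<tau>s) s = Some \<sigma>" "typeof (N # \<tau>s) t = Some \<sigma>" "tyl w as \<tau>s"
    and base: "\<And>w'. w \<le> w' \<Longrightarrow>
      den_eq w' (zr w' # map (val w') as) s t"
    and step: "\<And>w' A X. w \<le> w' \<Longrightarrow> tyw w' A = Some N \<Longrightarrow> tyw w' X = Some N \<Longrightarrow>
      den_eq w' (A # map (val w') as) s t \<Longrightarrow>
      den_eq w' (snoc w' A X # map (val w') as) s t"
    and B: "tyw w B = Some N"
  shows "den_eq w (B # map (val w) as) s t"
proof -
  have l: "length as = length \<tau>s" using map_eq_imp_length_eq[OF ty(3)] .
  have lift: "den w' (Y # A # map (val w') as) (lift u) = den w' (A # map (val w') as) u"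
    if "typeof (N # \<tau>s) u = Some \<sigma>" for w' Y A u
    unfolding den_def sub_ren
    by (rule arg_cong[where f="val w'"], rule sub_cong_typed[OF that]) (simp add: l)
  \<comment> \<open>A dummy variable with value zero takes the place of the generalised
    parameter.\<close>
  have "den w (zr w # B # map (val w) as) (lift s) = den w (zr w # B # map (val w) as) (lift t)"
    by (rule code_induct1[where \<rho>=N, OF typeof_lift[OF ty(1)] typeof_lift[OF ty(2)] ty(3)])
      (use ty B base step in \<open>simp_all add: lift\<close>)
  then show ?thesis by (simp add: lift ty)
qed

text \<open>
  Both \<^const>\<open>append_tm\<close> and the partial lookup function below are computed by iterating \<open>B\<close> many
  times on \<open>B\<close>. The result does not depend on the number of iterations as long as it is at least
  \<open>B\<close>, which yields recursion along snoc.
\<close>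

lemma iteration_stable:
  assumes i: "typed w i (N \<leadsto> N \<leadsto> \<tau>)" and z: "typed w z \<tau>"
    and i0: "\<And>w' B. w \<le> w' \<Longrightarrow> tyw w' B = Some N \<Longrightarrow> ap2 w' (val w' i) (zr w') B = val w' z"
    and iZ: "\<And>w' K. w \<le> w' \<Longrightarrow> tyw w' K = Some N \<Longrightarrow> ap2 w' (val w' i) (sc w' K) (zr w') = val w' z"
    and iS: "\<And>w' K C. w \<le> w' \<Longrightarrow> tyw w' K = Some N \<Longrightarrow> tyw w' C = Some N \<Longrightarrow>
      ap2 w' (val w' i) (sc w' K) (sc w' C) = G w' (sd w' C) (ap2 w' (val w' i) K (ft w' C))"
    and A: "tyw w A = Some N" and X: "tyw w X = Some N"
  shows "ap2 w (val w i) (snoc w A X) (snoc w A X) = G w X (ap2 w (val w i) A A)"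
proof -
  have Z: "ap2 w' (val w' i) J (zr w') = val w' z" if "w \<le> w'" "tyw w' J = Some N" for w' J
  proof -
    note i' = typeof_mono[OF i that(1)] and z' = typeof_mono[OF z that(1)]
    have "den w' (J # map (val w') [i, z]) (Var 1 \<cdot> Var 0 \<cdot> Zero) = den w' (J # map (val w') [i, z]) (Var 2)"
    proof (rule cls_induct0[where \<tau>s="[N \<leadsto> N \<leadsto> \<tau>, \<tau>]" and \<sigma>=\<tau>])
      fix w'' assume w'': "w' \<le> w''"
      show "den w'' (zr w'' # map (val w'') [i, z]) (Var 1 \<cdot> Var 0 \<cdot> Zero) =
        den w'' (zr w'' # map (val w'') [i, z]) (Var 2)"
        using typeof_mono[OF i' w''] typeof_mono[OF z' w''] i0[OF order_trans[OF that(1) w'']] by simp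
      fix X assume "tyw w'' X = Some N"
      then show "den w'' (sc w'' X # map (val w'') [i, z]) (Var 1 \<cdot> Var 0 \<cdot> Zero) =
        den w'' (sc w'' X # map (val w'') [i, z]) (Var 2)"
        using typeof_mono[OF i' w''] typeof_mono[OF z' w''] iZ[OF order_trans[OF that(1) w'']] by simp
    qed (use i' z' that in simp_all)
    then show ?thesis using i' z' that by simp
  qed
  let ?s = "Var 2 \<cdot> (plus_tm \<cdot> Var 1 \<cdot> Var 0) \<cdot> Var 1" and ?t = "Var 2 \<cdot> Var 1 \<cdot> Var 1"
  \<comment> \<open>\<open>pair A X\<close> is \<open>A\<close> plus a triangular number, which
    shows without an order relation that it is large enough for \<open>A\<close>.\<close>
  let ?T = "\<lambda>w A X. tri w (pl w A X)"
  have p0: "pr w' A X = pl w' A (?T w' A X)" if "tyw w' A = Some N" "tyw w' X = Some N" for w' A X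
    using that pair_eq[of w' A X] plus_comm[of w' A "?T w' A X"] by simp
  have pJ: "pl w' (pr w' A X) J = pl w' A (pl w' (?T w' A X) J)"
    if "tyw w' A = Some N" "tyw w' X = Some N" "tyw w' J = Some N" for w' A X J
    using that plus_assoc[of w' A "?T w' A X" J] p0[of w' A X] by simp
  \<comment> \<open>Having at least \<open>A\<close> iterations is written as \<open>A + J\<close>.
    The quantity \<open>J\<close> is generalised because the shorter code inherits the surplus
    \<open>T + J\<close> from the longer one.\<close>
  have stable: "ap2 w (val w i) (pl w A J) A = ap2 w (val w i) A A" if "tyw w J = Some N" for J
  proof -
    have "den_eq w (J # A # map (val w) [i]) ?s ?t"
    proof (rule code_induct1[where \<rho>=N and \<tau>s="[N \<leadsto> N \<leadsto> \<tau>]" and \<sigma>=\<tau>])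
      fix w' Y assume w': "w \<le> w'" and Y: "tyw w' Y = Some N"
      show "den_eq w' (Y # zr w' # map (val w') [i]) ?s ?t"
        using w' Y typeof_mono[OF i w'] Z[OF w'] by simp
      fix A X assume A: "tyw w' A = Some N" "tyw w' X = Some N"
        and IH: "\<And>Y. tyw w' Y = Some N \<Longrightarrow>
          den_eq w' (Y # A # map (val w') [i]) ?s ?t"
      have IH': "ap2 w' (val w' i) (pl w' A Y) A = ap2 w' (val w' i) A A" if "tyw w' Y = Some N" for Y
        using IH[OF that] that A typeof_mono[OF i w'] by simp
      have "ap2 w' (val w' i) (pl w' (pr w' A X) Y) A = ap2 w' (val w' i) A A"
        using IH' A Y by (simp add: pJ)
      moreover have "ap2 w' (val w' i) (pr w' A X) A = ap2 w' (val w' i) A A"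
        using IH' A by (simp add: p0)
      ultimately show "den_eq w' (Y # snoc w' A X # map (val w') [i]) ?s ?t"
        using w' Y A typeof_mono[OF i w'] by (simp add: iS)
    qed (use i A that in simp_all)
    then show ?thesis using i A that by simp
  qed
  have "ap2 w (val w i) (pr w A X) A = ap2 w (val w i) A A"
    using stable A X by (simp add: p0)
  then show ?thesis using A X by (simp add: iS)
qed

section \<open>Concatenation and initial segments\<close>

definition append_iter_tm :: tm where
  "append_iter_tm = Lam N (Rec (N \<leadsto> N) \<cdot> Lam N (Var 1)
    \<cdot> Lam N (Lam (N \<leadsto> N) (Lam N
       (Rec N \<cdot> Var 3 \<cdot> Lam N (Lam N (Succ \<cdot> (pair_tm \<cdot> (Var 3 \<cdot> (fst_tm \<cdot> Var 1)) \<cdot> (snd_tm \<cdot> Var 1)))) \<cdot> Var 0))))"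

lemma append_iter_type: "typeof [] append_iter_tm = Some (N \<leadsto> N \<leadsto> N \<leadsto> N)"
  by (simp add: append_iter_tm_def)

lemmas append_iter_type' [simp] = append_iter_type[THEN typeof_closed]
lemmas append_iter_den [simp] = append_iter_type[THEN den_closed]

text \<open>\<open>append_iter_tm\<close> separates the number of iterations from the code, as
  \<open>iteration_stable\<close> requires. Inside \<open>append_tm\<close> the recursor sees one
  more variable, the second sequence, but its arguments have the same values with and without
  it.\<close>

lemma append_unfold:
  assumes "tyw w A = Some N" "tyw w B = Some N"
  shows "cat w A B = ap2 w (app w (val w append_iter_tm) A) B B"
proof -
  have 1: "den w [B, A] (Lam N (Var 2)) = den w [A] (Lam N (Var 1))"
    by (simp add: den_def up_def numeral_eq_Suc)
  have sub_const: "sub f pair_tm = pair_tm" "sub f fst_tm = fst_tm" "sub f snd_tm = snd_tm" for f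
    using sub_cong_typed[of "[]" _ _ f Var] const_types by (simp_all add: sub_Var)
  have 2: "den w [B, A] (Lam N (Lam (N \<leadsto> N) (Lam N
       (Rec N \<cdot> Var 4 \<cdot> Lam N (Lam N (Succ \<cdot> (pair_tm \<cdot> (Var 3 \<cdot> (fst_tm \<cdot> Var 1)) \<cdot> (snd_tm \<cdot> Var 1)))) \<cdot> Var 0))))
    = den w [A] (Lam N (Lam (N \<leadsto> N) (Lam N
       (Rec N \<cdot> Var 3 \<cdot> Lam N (Lam N (Succ \<cdot> (pair_tm \<cdot> (Var 3 \<cdot> (fst_tm \<cdot> Var 1)) \<cdot> (snd_tm \<cdot> Var 1)))) \<cdot> Var 0))))"
    by (simp add: den_def up_def numeral_eq_Suc sub_const del: val_app val_Lam_closed)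
  show ?thesis using assms by (simp add: append_tm_def append_iter_tm_def 1 2 del: One_nat_def)
qed

lemma append_iter_simps:
  assumes "tyw w A = Some N" "tyw w K = Some N" "tyw w B = Some N"
  shows "ap2 w (app w (val w append_iter_tm) A) (zr w) B = A"
    "ap2 w (app w (val w append_iter_tm) A) (sc w K) (zr w) = A"
    "ap2 w (app w (val w append_iter_tm) A) (sc w K) (sc w B) =
      sc w (pr w (ap2 w (app w (val w append_iter_tm) A) K (ft w B)) (sd w B))"
  using assms by (simp_all add: append_iter_tm_def)

lemma append_nil [simp]: "tyw w A = Some N \<Longrightarrow> cat w A (zr w) = A"
  by (simp add: append_unfold append_iter_simps)

lemma append_snoc [simp]:
  assumes "tyw w A = Some N" "tyw w B = Some N" "tyw w X = Some N"
  shows "cat w A (snoc w B X) = snoc w (cat w A B) X"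
proof -
  obtain a where a: "A = val w a" "typed w a N" using cls_cases[OF assms(1)] .
  have "ap2 w (val w (append_iter_tm \<cdot> a)) (snoc w B X) (snoc w B X) =
    snoc w (ap2 w (val w (append_iter_tm \<cdot> a)) B B) X"
    by (rule iteration_stable[where G="\<lambda>w X R. snoc w R X" and z=a and \<tau>=N])
      (use a(2) assms typeof_mono[OF a(2)] in \<open>simp_all add: append_iter_simps\<close>)
  then show ?thesis using a assms by (simp add: append_unfold)
qed

lemma append_assoc:
  assumes "tyw w A = Some N" "tyw w B = Some N" "tyw w C = Some N"
  shows "cat w (cat w A B) C = cat w A (cat w B C)"
proof -
  obtain a where a: "A = val w a" "typed w a N" using cls_cases[OF assms(1)] .
  let ?s = "append_tm \<cdot> (append_tm \<cdot> Var 2 \<cdot> Var 0) \<cdot> Var 1" and ?t = "append_tm \<cdot> Var 2 \<cdot> (append_tm \<cdot> Var 0 \<cdot> Var 1)"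
  have "den_eq w (B # C # map (val w) [a]) ?s ?t"
    by (rule code_induct1[where \<rho>=N and \<tau>s="[N]" and \<sigma>=N])
      (use assms a(2) typeof_mono[OF a(2)] in simp_all)
  then show ?thesis using a assms by simp
qed

lemma single_eq: "tyw w X = Some N \<Longrightarrow> app w (val w single_tm) X = snoc w (zr w) X"
  by (simp add: single_tm_def nil_tm_def)

lemma append_single [simp]:
  "tyw w A = Some N \<Longrightarrow> tyw w X = Some N \<Longrightarrow> cat w A (app w (val w single_tm) X) = snoc w A X"
  by (simp add: single_eq)

abbreviation sg :: "world \<Rightarrow> cls \<Rightarrow> cls \<Rightarrow> cls" where "sg w \<equiv> ap2 w (val w seg_tm)"

lemma seg_simps [simp]:
  "tyw w F = Some (N \<leadsto> N) \<Longrightarrow> sg w F (zr w) = zr w"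
  "tyw w F = Some (N \<leadsto> N) \<Longrightarrow> tyw w A = Some N \<Longrightarrow> sg w F (sc w A) = snoc w (sg w F A) (app w F A)"
  by (simp_all add: seg_tm_def nil_tm_def)

section \<open>The translation and its logical relation\<close>

fun bty :: "ty \<Rightarrow> ty" where
  "bty N = (N \<leadsto> N)"
| "bty (\<rho> \<leadsto> \<sigma>) = (bty \<rho> \<leadsto> bty \<sigma>)"

definition eta_tm :: tm where
  "eta_tm = Lam N (Lam N (Succ \<cdot> Var 1))"

definition flip_tm :: "ty \<Rightarrow> ty \<Rightarrow> tm" where
  "flip_tm \<rho> \<sigma> = Lam (N \<leadsto> \<rho> \<leadsto> \<sigma>) (Lam \<rho> (Lam N (Var 2 \<cdot> Var 0 \<cdot> Var 1)))"

text \<open>The Kleisli extension \<open>bind h g\<close>: if \<open>g\<close> wants more input at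
  \<open>a\<close>, so does the result; if \<open>g\<close> returns \<open>n\<close> there, then
  \<open>h n\<close> is run on the same segment \<open>a\<close>.\<close>

definition bind_tm :: tm where
  "bind_tm = Lam (N \<leadsto> N \<leadsto> N) (Lam (N \<leadsto> N) (Lam N
     (Rec N \<cdot> Zero \<cdot> Lam N (Lam N (Var 4 \<cdot> Var 1 \<cdot> Var 2)) \<cdot> (Var 1 \<cdot> Var 0))))"

text \<open>Lifts \<open>bind_tm\<close> pointwise to function types. A recursor may have any result
  type, so its computed index has to be bound at every type.\<close>

fun ke :: "ty \<Rightarrow> tm" where
  "ke N = bind_tm"
| "ke (\<rho> \<leadsto> \<sigma>) = Lam (N \<leadsto> bty \<rho> \<leadsto> bty \<sigma>) (Lam (N \<leadsto> N) (Lam (bty \<rho>)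
     (ke \<sigma> \<cdot> (flip_tm (bty \<rho>) (bty \<sigma>) \<cdot> Var 2 \<cdot> Var 0) \<cdot> Var 1)))"

text \<open>The translated step function of a recursion expects a computation as index, whereas the
  recursor supplies a number; the unit mediates.\<close>

definition pre_tm :: "ty \<Rightarrow> tm" where
  "pre_tm \<sigma> = Lam ((N \<leadsto> N) \<leadsto> \<sigma>) (Lam N (Var 1 \<cdot> (eta_tm \<cdot> Var 0)))"

text \<open>A call-by-name translation: variables, applications and abstractions are kept, and the
  monad shows only at the constants. Recursion still runs on a plain number, and \<open>ke\<close>
  extends it to a computed one.\<close>

fun tr :: "tm \<Rightarrow> tm" where
  "tr (Var i) = Var i"
| "tr Zero = eta_tm \<cdot> Zero"
| "tr Succ = bind_tm \<cdot> Lam N (eta_tm \<cdot> (Succ \<cdot> Var 0))"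
| "tr (Rec \<rho>) = Lam (bty \<rho>) (Lam ((N \<leadsto> N) \<leadsto> bty \<rho> \<leadsto> bty \<rho>)
     (ke \<rho> \<cdot> (Rec (bty \<rho>) \<cdot> Var 1 \<cdot> (pre_tm (bty \<rho> \<leadsto> bty \<rho>) \<cdot> Var 0))))"
| "tr (s \<cdot> t) = tr s \<cdot> tr t"
| "tr (Lam \<rho> t) = Lam (bty \<rho>) (tr t)"

lemma eta_type: "typeof [] eta_tm = Some (N \<leadsto> N \<leadsto> N)"
  by (simp add: eta_tm_def)

lemma flip_type: "typeof [] (flip_tm \<rho> \<sigma>) = Some ((N \<leadsto> \<rho> \<leadsto> \<sigma>) \<leadsto> \<rho> \<leadsto> N \<leadsto> \<sigma>)"
  by (simp add: flip_tm_def)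

lemma bind_type: "typeof [] bind_tm = Some ((N \<leadsto> N \<leadsto> N) \<leadsto> (N \<leadsto> N) \<leadsto> N \<leadsto> N)"
  by (simp add: bind_tm_def)

lemmas tr_types1 [simp] = eta_type[THEN typeof_closed] flip_type[THEN typeof_closed] bind_type[THEN typeof_closed]

lemma ke_type: "typeof [] (ke \<rho>) = Some ((N \<leadsto> bty \<rho>) \<leadsto> (N \<leadsto> N) \<leadsto> bty \<rho>)"
proof (induction \<rho>)
  case (Fn \<rho> \<sigma>)
  then show ?case using typeof_closed[OF Fn.IH(2)] by simp
qed simp

lemma pre_type: "typeof [] (pre_tm \<sigma>) = Some (((N \<leadsto> N) \<leadsto> \<sigma>) \<leadsto> N \<leadsto> \<sigma>)"
  by (simp add: pre_tm_def)

lemmas tr_types2 [simp] = ke_type[THEN typeof_closed] pre_type[THEN typeof_closed]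
lemmas tr_dens [simp] = eta_type[THEN den_closed] flip_type[THEN den_closed] bind_type[THEN den_closed]
  ke_type[THEN den_closed] pre_type[THEN den_closed]

lemma sub_closed: "typeof [] t = Some \<rho> \<Longrightarrow> sub f t = t"
  using sub_cong_typed[of "[]" t \<rho> f Var] by (simp add: sub_Var)

lemmas tr_subs [simp] = eta_type[THEN sub_closed] flip_type[THEN sub_closed] bind_type[THEN sub_closed]
  ke_type[THEN sub_closed] pre_type[THEN sub_closed]

lemma tr_type: "typeof \<Gamma> t = Some \<tau> \<Longrightarrow> typeof (map bty \<Gamma>) (tr t) = Some (bty \<tau>)"
proof (induction t arbitrary: \<Gamma> \<tau>)
  case (App s t)
  then show ?case by (fastforce simp: apty_eq_Some)
next
  case (Lam \<rho> t)
  then obtain \<sigma> where "typeof (\<rho> # \<Gamma>) t = Some \<sigma>" "\<tau> = \<rho> \<leadsto> \<sigma>" by auto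
  with Lam.IH[OF this(1)] show ?case by simp
qed (auto split: if_splits)

lemma eta_eval: "tyw w X = Some N \<Longrightarrow> tyw w A = Some N \<Longrightarrow> ap2 w (val w eta_tm) X A = sc w X"
  by (simp add: eta_tm_def)

lemma flip_eval:
  "tyw w H = Some (N \<leadsto> \<rho> \<leadsto> \<sigma>) \<Longrightarrow> tyw w Y = Some \<rho> \<Longrightarrow> tyw w M = Some N \<Longrightarrow>
    app w (ap2 w (val w (flip_tm \<rho> \<sigma>)) H Y) M = ap2 w H M Y"
  by (simp add: flip_tm_def)

lemma pre_eval:
  "tyw w F = Some ((N \<leadsto> N) \<leadsto> \<sigma>) \<Longrightarrow> tyw w M = Some N \<Longrightarrow>
    ap2 w (val w (pre_tm \<sigma>)) F M = app w F (app w (val w eta_tm) M)"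
  by (simp add: pre_tm_def)

lemma ke_Fn_eval:
  "tyw w H = Some (N \<leadsto> bty \<rho> \<leadsto> bty \<sigma>) \<Longrightarrow> tyw w G = Some (N \<leadsto> N) \<Longrightarrow> tyw w Y = Some (bty \<rho>) \<Longrightarrow>
    app w (ap2 w (val w (ke (\<rho> \<leadsto> \<sigma>))) H G) Y =
    ap2 w (val w (ke \<sigma>)) (ap2 w (val w (flip_tm (bty \<rho>) (bty \<sigma>))) H Y) G"
  by simp

lemma bind_eval:
  assumes "tyw w H = Some (N \<leadsto> N \<leadsto> N)" "tyw w G = Some (N \<leadsto> N)" "tyw w A = Some N"
  shows "app w G A = zr w \<Longrightarrow> app w (ap2 w (val w bind_tm) H G) A = zr w"
    and "app w G A = sc w M \<Longrightarrow> tyw w M = Some N \<Longrightarrow>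
      app w (ap2 w (val w bind_tm) H G) A = ap2 w H M A"
  using assms by (simp_all add: bind_tm_def)

section \<open>The logical relation as a formula\<close>

lemma satl_rule:
  assumes "tyl w ts \<Gamma>" "wff (\<rho>s @ \<Gamma>) A" "wff (\<rho>s @ \<Gamma>) B"
  shows "satl w ts (foralls \<rho>s (A \<^bold>\<longrightarrow> B)) \<longleftrightarrow>
    (\<forall>w' \<ge> w. \<forall>us. tyl w' us \<rho>s \<longrightarrow> satl w' (us @ ts) A \<longrightarrow> satl w' (us @ ts) B)"
proof -
  have "satl w' (us @ ts) (A \<^bold>\<longrightarrow> B) \<longleftrightarrow> (\<forall>w'' \<ge> w'. satl w'' (us @ ts) A \<longrightarrow> satl w'' (us @ ts) B)"
    if "w \<le> w'" "tyl w' us \<rho>s" for w' us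
    by (rule satl_Imp[OF _ assms(2)]) (use that tyl_mono[OF assms(1)] in simp)
  moreover have "satl w ts (foralls \<rho>s (A \<^bold>\<longrightarrow> B)) \<longleftrightarrow>
      (\<forall>w' \<ge> w. \<forall>us. tyl w' us \<rho>s \<longrightarrow> satl w' (us @ ts) (A \<^bold>\<longrightarrow> B))"
    by (rule satl_foralls[OF assms(1)]) (simp add: assms)
  ultimately show ?thesis by (meson order_refl order_trans tyl_mono)
qed

lemma satl_subst1:
  assumes "tyl w ts \<Gamma>" "wff (\<sigma> # \<rho> # \<Gamma>) A" "typed w r \<sigma>" "typed w s \<rho>"
    "val w s = val w t" "satl w (r # s # ts) A"
  shows "satl w (r # t # ts) A"
proof -
  \<comment> \<open>Exchanges variables 0 and 1 to bring the replaced term to the front.\<close>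
  let ?f = "\<lambda>i. case i of 0 \<Rightarrow> Var 1 | Suc j \<Rightarrow> (case j of 0 \<Rightarrow> Var 0 | Suc k \<Rightarrow> Var (Suc (Suc k)))"
  have f: "satl w (u # r # ts) (fsub ?f A) \<longleftrightarrow> satl w (r # u # ts) A" for u
    by (rule satl_fsub[OF assms(2)]) (simp add: nth_Cons split: nat.split)
  have "tysub (\<rho> # \<sigma> # \<Gamma>) ?f (\<sigma> # \<rho> # \<Gamma>)"
    by (auto simp: tysub_def nth_Cons split: nat.split)
  from wff_fsub[OF assms(2) this] show ?thesis
    using satl_subst[of w "r # ts" "\<sigma> # \<Gamma>" \<rho> "fsub ?f A" s t] assms f by simp
qed

text \<open>
  \<open>Rf P \<rho>\<close> relates variable \<open>0\<close> of type \<open>\<rho>\<close> to variable \<open>1\<close> of type \<open>bty \<rho>\<close>. The remaining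
  variables are the parameters of \<open>P\<close>.
\<close>

primrec Rf :: "fm \<Rightarrow> ty \<Rightarrow> fm" where
  "Rf P N = P"
| "Rf P (\<rho> \<leadsto> \<sigma>) = foralls [bty \<rho>, \<rho>]
     (fsub (case_nat (Var 1) (case_nat (Var 0) (\<lambda>i. Var (i + 4)))) (Rf P \<rho>) \<^bold>\<longrightarrow>
      fsub (case_nat (Var 2 \<cdot> Var 1) (case_nat (Var 3 \<cdot> Var 0) (\<lambda>i. Var (i + 4)))) (Rf P \<sigma>))"

text \<open>The fundamental lemma needs no more of the base relation \<open>P\<close> than closure
  under unit and bind. The parameters \<open>\<theta>\<close> of \<open>P\<close> make sense from
  the world \<open>w0\<close> on, hence the restriction to worlds above it.\<close>

locale logical_relation =
  fixes w0 :: world and P :: fm and \<theta> :: "tm list" and \<Theta> :: "ty list"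
  assumes \<theta>: "tyl w0 \<theta> \<Theta>" and P: "wff (N # (N \<leadsto> N) # \<Theta>) P"
    and eta: "\<And>w m. w0 \<le> w \<Longrightarrow> typed w m N \<Longrightarrow> satl w (m # eta_tm \<cdot> m # \<theta>) P"
    and bind: "\<And>w k h n g. w0 \<le> w \<Longrightarrow> typed w k (N \<leadsto> N) \<Longrightarrow>
      typed w h (N \<leadsto> N \<leadsto> N) \<Longrightarrow> typed w n N \<Longrightarrow>
      typed w g (N \<leadsto> N) \<Longrightarrow>
      (\<And>w' m. w \<le> w' \<Longrightarrow> typed w' m N \<Longrightarrow> satl w' (k \<cdot> m # h \<cdot> m # \<theta>) P) \<Longrightarrow>
      satl w (n # g # \<theta>) P \<Longrightarrow> satl w (k \<cdot> n # bind_tm \<cdot> h \<cdot> g # \<theta>) P"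
begin

definition rel :: "world \<Rightarrow> ty \<Rightarrow> tm \<Rightarrow> tm \<Rightarrow> bool" where
  "rel w \<rho> s t \<longleftrightarrow> satl w (s # t # \<theta>) (Rf P \<rho>)"

lemma wff_Rf: "wff (\<rho> # bty \<rho> # \<Theta>) (Rf P \<rho>)"
proof (induction \<rho>)
  case (Fn \<rho> \<sigma>)
  let ?\<Gamma> = "bty \<rho> # \<rho> # (\<rho> \<leadsto> \<sigma>) # (bty \<rho> \<leadsto> bty \<sigma>) # \<Theta>"
  have "tysub ?\<Gamma> (case_nat (Var 1) (case_nat (Var 0) (\<lambda>i. Var (i + 4)))) (\<rho> # bty \<rho> # \<Theta>)"
    "tysub ?\<Gamma> (case_nat (Var 2 \<cdot> Var 1) (case_nat (Var 3 \<cdot> Var 0) (\<lambda>i. Var (i + 4)))) (\<sigma> # bty \<sigma> # \<Theta>)"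
    by (auto simp: tysub_def nth_Cons numeral_eq_Suc split: nat.split)
  with Fn show ?case by (simp add: wff_fsub)
qed (simp add: P)

lemma rel_mono: "rel w \<rho> s t \<Longrightarrow> w \<le> w' \<Longrightarrow> rel w' \<rho> s t"
  unfolding rel_def by (rule satl_mono)

lemma rel_cong:
  assumes w: "w0 \<le> w" and "rel w \<rho> s t" "val w s = val w s'" "val w t = val w t'"
    and ty: "typed w s \<rho>" "typed w t (bty \<rho>)"
  shows "rel w \<rho> s' t'"
proof -
  have ty': "typed w s' \<rho>" "typed w t' (bty \<rho>)"
    using ty assms(3,4) by (metis tyw_val)+
  have "satl w (s # t' # \<theta>) (Rf P \<rho>)"
    using satl_subst1[OF tyl_mono[OF \<theta> w] wff_Rf ty assms(4)] assms(2) by (simp add: rel_def)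
  then show ?thesis
    using satl_subst[of w "t' # \<theta>" "bty \<rho> # \<Theta>" \<rho> "Rf P \<rho>" s s'] tyl_mono[OF \<theta> w] wff_Rf ty ty' assms(3)
    by (simp add: rel_def)
qed

text \<open>Recovers the usual clause of a Kripke logical relation from the formula
  \<open>Rf\<close>, sparing later arguments at function types the de Bruijn indices.\<close>

lemma rel_Fn:
  assumes w: "w0 \<le> w" and ty: "typed w f (\<rho> \<leadsto> \<sigma>)" "typed w g (bty \<rho> \<leadsto> bty \<sigma>)"
  shows "rel w (\<rho> \<leadsto> \<sigma>) f g \<longleftrightarrow>
    (\<forall>w' \<ge> w. \<forall>x y. typed w' x \<rho> \<longrightarrow> typed w' y (bty \<rho>) \<longrightarrow>
      rel w' \<rho> x y \<longrightarrow> rel w' \<sigma> (f \<cdot> x) (g \<cdot> y))"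
proof -
  let ?a = "case_nat (Var 1) (case_nat (Var 0) (\<lambda>i. Var (i + 4)))"
  let ?b = "case_nat (Var 2 \<cdot> Var 1) (case_nat (Var 3 \<cdot> Var 0) (\<lambda>i. Var (i + 4)))"
  let ?\<Gamma> = "bty \<rho> # \<rho> # (\<rho> \<leadsto> \<sigma>) # (bty \<rho> \<leadsto> bty \<sigma>) # \<Theta>"
  have wf: "wff ?\<Gamma> (fsub ?a (Rf P \<rho>))" "wff ?\<Gamma> (fsub ?b (Rf P \<sigma>))"
    by (rule wff_fsub[OF wff_Rf]; auto simp: tysub_def nth_Cons numeral_eq_Suc split: nat.split)+
  have a: "satl w' (y # x # f # g # \<theta>) (fsub ?a (Rf P \<rho>)) \<longleftrightarrow> rel w' \<rho> x y" for w' x y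
    unfolding rel_def by (rule satl_fsub[OF wff_Rf]) (simp add: nth_Cons numeral_eq_Suc split: nat.split)
  have b: "satl w' (y # x # f # g # \<theta>) (fsub ?b (Rf P \<sigma>)) \<longleftrightarrow> rel w' \<sigma> (f \<cdot> x) (g \<cdot> y)" for w' x y
    unfolding rel_def by (rule satl_fsub[OF wff_Rf]) (simp add: nth_Cons numeral_eq_Suc split: nat.split)
  have l: "tyl w (f # g # \<theta>) ((\<rho> \<leadsto> \<sigma>) # (bty \<rho> \<leadsto> bty \<sigma>) # \<Theta>)"
    using ty tyl_mono[OF \<theta> w] by simp
  have "rel w (\<rho> \<leadsto> \<sigma>) f g \<longleftrightarrow> (\<forall>w' \<ge> w. \<forall>us. tyl w' us [bty \<rho>, \<rho>] \<longrightarrow>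
    satl w' (us @ f # g # \<theta>) (fsub ?a (Rf P \<rho>)) \<longrightarrow> satl w' (us @ f # g # \<theta>) (fsub ?b (Rf P \<sigma>)))"
    unfolding rel_def Rf.simps by (rule satl_rule[OF l]) (use wf in simp_all)
  also have "\<dots> \<longleftrightarrow> (\<forall>w' \<ge> w. \<forall>x y. typed w' x \<rho> \<longrightarrow> typed w' y (bty \<rho>) \<longrightarrow>
    rel w' \<rho> x y \<longrightarrow> rel w' \<sigma> (f \<cdot> x) (g \<cdot> y))"
  proof (intro iffI allI impI)
    fix w' x y
    assume "\<forall>w' \<ge> w. \<forall>us. tyl w' us [bty \<rho>, \<rho>] \<longrightarrow>
      satl w' (us @ f # g # \<theta>) (fsub ?a (Rf P \<rho>)) \<longrightarrow> satl w' (us @ f # g # \<theta>) (fsub ?b (Rf P \<sigma>))"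
      and "w \<le> w'" "typed w' x \<rho>" "typed w' y (bty \<rho>)" "rel w' \<rho> x y"
    from this(1)[rule_format, of w' "[y, x]"] this(2-) show "rel w' \<sigma> (f \<cdot> x) (g \<cdot> y)"
      by (simp add: a b del: One_nat_def)
  next
    fix w' us
    assume *: "\<forall>w' \<ge> w. \<forall>x y. typed w' x \<rho> \<longrightarrow> typed w' y (bty \<rho>) \<longrightarrow>
      rel w' \<rho> x y \<longrightarrow> rel w' \<sigma> (f \<cdot> x) (g \<cdot> y)"
      and "w \<le> w'" and us: "tyl w' us [bty \<rho>, \<rho>]" and "satl w' (us @ f # g # \<theta>) (fsub ?a (Rf P \<rho>))"
    moreover from us obtain y x where "us = [y, x]" "typed w' x \<rho>" "typed w' y (bty \<rho>)"
      by (auto simp: map_eq_Cons_conv)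
    ultimately show "satl w' (us @ f # g # \<theta>) (fsub ?b (Rf P \<sigma>))"
      by (simp add: a b del: One_nat_def)
  qed
  finally show ?thesis .
qed

text \<open>Closure under bind spreads from the base type by induction on the type. At a function
  type a related argument is fixed and moved into the continuation, which lowers the type.\<close>

lemma rel_ke:
  assumes "w0 \<le> w" "typed w k (N \<leadsto> \<rho>)" "typed w h (N \<leadsto> bty \<rho>)"
    "typed w n N" "typed w g (N \<leadsto> N)"
    and "\<And>w' m. w \<le> w' \<Longrightarrow> typed w' m N \<Longrightarrow> rel w' \<rho> (k \<cdot> m) (h \<cdot> m)"
    and "rel w N n g"
  shows "rel w \<rho> (k \<cdot> n) (ke \<rho> \<cdot> h \<cdot> g)"
  using assms
proof (induction \<rho> arbitrary: w k h n g)
  case N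
  then show ?case using bind[of w k h n g] by (simp add: rel_def)
next
  case (Fn \<rho> \<sigma>)
  have "rel w' \<sigma> (k \<cdot> n \<cdot> x) (ke (\<rho> \<leadsto> \<sigma>) \<cdot> h \<cdot> g \<cdot> y)"
    if w': "w \<le> w'" and x: "typed w' x \<rho>" and y: "typed w' y (bty \<rho>)"
      and xy: "rel w' \<rho> x y" for w' x y
  proof -
    let ?k = "flip_tm \<rho> \<sigma> \<cdot> k \<cdot> x" and ?h = "flip_tm (bty \<rho>) (bty \<sigma>) \<cdot> h \<cdot> y"
    have w0: "w0 \<le> w'" using Fn.prems(1) w' by (rule order_trans)
    note ty = Fn.prems(2-5)[THEN typeof_mono, OF w']
    have "rel w' \<sigma> (?k \<cdot> n) (ke \<sigma> \<cdot> ?h \<cdot> g)"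
    proof (rule Fn.IH(2)[OF w0])
      fix w'' m assume w'': "w' \<le> w''" and m: "typed w'' m N"
      note ty' = ty[THEN typeof_mono, OF w''] typeof_mono[OF x w''] typeof_mono[OF y w'']
      have "rel w'' (\<rho> \<leadsto> \<sigma>) (k \<cdot> m) (h \<cdot> m)"
        using Fn.prems(6)[OF order_trans[OF w' w''] m] .
      then have "rel w'' \<sigma> (k \<cdot> m \<cdot> x) (h \<cdot> m \<cdot> y)"
        using rel_Fn[of w'' "k \<cdot> m" \<rho> \<sigma> "h \<cdot> m"] ty' m order_trans[OF w0 w''] rel_mono[OF xy w''] by simp
      then show "rel w'' \<sigma> (?k \<cdot> m) (?h \<cdot> m)"
        using rel_cong[of w'' \<sigma> "k \<cdot> m \<cdot> x" "h \<cdot> m \<cdot> y" "?k \<cdot> m" "?h \<cdot> m"] ty' m order_trans[OF w0 w'']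
        by (simp add: flip_eval)
    qed (use ty x y rel_mono[OF Fn.prems(7) w'] in simp_all)
    then show ?thesis
      using rel_cong[OF w0, of \<sigma> "?k \<cdot> n" "ke \<sigma> \<cdot> ?h \<cdot> g" "k \<cdot> n \<cdot> x" "ke (\<rho> \<leadsto> \<sigma>) \<cdot> h \<cdot> g \<cdot> y"] ty x y
      by (simp add: flip_eval ke_Fn_eval del: ke.simps)
  qed
  then show ?case
    using rel_Fn[OF Fn.prems(1), of "k \<cdot> n" \<rho> \<sigma> "ke (\<rho> \<leadsto> \<sigma>) \<cdot> h \<cdot> g"] Fn.prems
    by (simp del: ke.simps)
qed

lemma rel_eta: "w0 \<le> w \<Longrightarrow> typed w m N \<Longrightarrow> rel w N m (eta_tm \<cdot> m)"
  using eta by (simp add: rel_def)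

lemma rel_Succ:
  assumes w: "w0 \<le> w"
  shows "rel w (N \<leadsto> N) Succ (tr Succ)"
proof -
  let ?h = "Lam N (eta_tm \<cdot> (Succ \<cdot> Var 0))"
  have "rel w' N (Succ \<cdot> x) (tr Succ \<cdot> y)"
    if w': "w \<le> w'" and x: "typed w' x N" and y: "typed w' y (N \<leadsto> N)"
      and xy: "rel w' N x y" for w' x y
  proof -
    have w0: "w0 \<le> w'" using w w' by (rule order_trans)
    have "rel w'' N (Succ \<cdot> m) (?h \<cdot> m)" if w'': "w' \<le> w''" and m: "typed w'' m N" for w'' m
      using rel_cong[OF order_trans[OF w0 w''] rel_eta[OF order_trans[OF w0 w'']], of "Succ \<cdot> m" "Succ \<cdot> m" "?h \<cdot> m"] m
      by simp
    then show ?thesis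
      using rel_ke[OF w0, of Succ N ?h x y] x y xy by simp
  qed
  then show ?thesis using rel_Fn[OF w, of Succ N N "tr Succ"] by simp
qed

text \<open>Both recursors run on the same number \<open>m\<close>, so an induction in HA on
  \<open>m\<close> suffices. In the step, \<open>n\<close> is related to
  \<open>eta_tm \<cdot> n\<close>, the index that \<open>pre_tm\<close> passes on. Computed indices
  are left to \<open>rel_ke\<close>.\<close>

lemma rel_Rec:
  assumes w: "w0 \<le> w"
    and a: "typed w a \<rho>" "typed w a' (bty \<rho>)" "rel w \<rho> a a'"
    and f: "typed w f (N \<leadsto> \<rho> \<leadsto> \<rho>)"
      "typed w f' ((N \<leadsto> N) \<leadsto> bty \<rho> \<leadsto> bty \<rho>)" "rel w (N \<leadsto> \<rho> \<leadsto> \<rho>) f f'"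
    and m: "typed w m N"
  shows "rel w \<rho> (Rec \<rho> \<cdot> a \<cdot> f \<cdot> m) (Rec (bty \<rho>) \<cdot> a' \<cdot> (pre_tm (bty \<rho> \<leadsto> bty \<rho>) \<cdot> f') \<cdot> m)"
proof -
  define k h where "k = Rec \<rho> \<cdot> a \<cdot> f" and "h = Rec (bty \<rho>) \<cdot> a' \<cdot> (pre_tm (bty \<rho> \<leadsto> bty \<rho>) \<cdot> f')"
  have kh: "typed w k (N \<leadsto> \<rho>)" "typed w h (N \<leadsto> bty \<rho>)"
    using a f by (simp_all add: k_def h_def)
  let ?\<tau> = "case_nat (Var 1 \<cdot> Var 0) (case_nat (Var 2 \<cdot> Var 0) (\<lambda>i. Var (i + 3)))"
  let ?A = "fsub ?\<tau> (Rf P \<rho>)"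
  have A: "satl w' (m # k # h # \<theta>) ?A \<longleftrightarrow> rel w' \<rho> (k \<cdot> m) (h \<cdot> m)" for w' m
    unfolding rel_def by (rule satl_fsub[OF wff_Rf]) (simp add: nth_Cons numeral_eq_Suc split: nat.split)
  have "satl w (m # k # h # \<theta>) ?A"
  proof (rule satl_induct[of _ _ "(N \<leadsto> \<rho>) # (N \<leadsto> bty \<rho>) # \<Theta>"])
    show "tyl w (k # h # \<theta>) ((N \<leadsto> \<rho>) # (N \<leadsto> bty \<rho>) # \<Theta>)"
      using kh tyl_mono[OF \<theta> w] by simp
    show "wff (N # (N \<leadsto> \<rho>) # (N \<leadsto> bty \<rho>) # \<Theta>) ?A"
      by (rule wff_fsub[OF wff_Rf]) (auto simp: tysub_def nth_Cons numeral_eq_Suc split: nat.split)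
    show "satl w (Zero # k # h # \<theta>) ?A"
      unfolding A
      by (rule rel_cong[OF w a(3) _ _ a(1,2)]) (use a f in \<open>simp_all add: k_def h_def\<close>)
    fix w' n assume w': "w \<le> w'" and n: "typed w' n N" and "satl w' (n # k # h # \<theta>) ?A"
    then have IH: "rel w' \<rho> (k \<cdot> n) (h \<cdot> n)" by (simp only: A)
    have w0: "w0 \<le> w'" using w w' by (rule order_trans)
    note ty = a(1,2)[THEN typeof_mono, OF w'] f(1,2)[THEN typeof_mono, OF w'] kh[THEN typeof_mono, OF w']
    have "rel w' (\<rho> \<leadsto> \<rho>) (f \<cdot> n) (f' \<cdot> (eta_tm \<cdot> n))"
      using rel_mono[OF f(3) w'] rel_Fn[OF w0, of f N "\<rho> \<leadsto> \<rho>" f'] rel_eta[OF w0 n] ty n by simp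
    then have "rel w' \<rho> (f \<cdot> n \<cdot> (k \<cdot> n)) (f' \<cdot> (eta_tm \<cdot> n) \<cdot> (h \<cdot> n))"
      using rel_Fn[OF w0, of "f \<cdot> n" \<rho> \<rho> "f' \<cdot> (eta_tm \<cdot> n)"] IH ty n by simp
    then show "satl w' (Succ \<cdot> n # k # h # \<theta>) ?A"
      unfolding A
      using rel_cong[OF w0, of \<rho> "f \<cdot> n \<cdot> (k \<cdot> n)" "f' \<cdot> (eta_tm \<cdot> n) \<cdot> (h \<cdot> n)" "k \<cdot> (Succ \<cdot> n)" "h \<cdot> (Succ \<cdot> n)"]
        ty n by (simp add: k_def h_def pre_eval)
  qed (rule m)
  then show ?thesis by (simp only: A) (simp only: k_def h_def)
qed

text \<open>Induction on the term outside HA. The recursor combines \<open>rel_Rec\<close> for plain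
  indices with \<open>rel_ke\<close>, and an abstraction is handled by invariance of the relation
  under beta conversion.\<close>

lemma fundamental:
  assumes "typeof \<Gamma> t = Some \<tau>" "w0 \<le> w" "tyl w ss \<Gamma>" "tyl w us (map bty \<Gamma>)"
    "\<And>i. i < length \<Gamma> \<Longrightarrow> rel w (\<Gamma> ! i) (ss ! i) (us ! i)"
  shows "rel w \<tau> (sub ((!) ss) t) (sub ((!) us) (tr t))"
  using assms
proof (induction t arbitrary: \<Gamma> \<tau> w ss us)
  case (Var i)
  then show ?case by (auto split: if_splits)
next
  case Zero
  then show ?case using rel_eta[of w Zero] by simp
next
  case Succ
  moreover have "sub ((!) us) (tr Succ) = tr Succ" by (rule sub_closed) simp
  ultimately show ?case using rel_Succ by (simp del: tr.simps)
next
  case (Rec \<rho>)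
  let ?r = "tr (Rec \<rho>)"
  have ty: "typed w' ?r (bty \<rho> \<leadsto> ((N \<leadsto> N) \<leadsto> bty \<rho> \<leadsto> bty \<rho>) \<leadsto> (N \<leadsto> N) \<leadsto> bty \<rho>)" for w'
    by simp
  have ev: "app w' (ap2 w' (val w' ?r) A F) G =
    ap2 w' (val w' (ke \<rho>)) (ap2 w' (val w' (Rec (bty \<rho>))) A (app w' (val w' (pre_tm (bty \<rho> \<leadsto> bty \<rho>))) F)) G"
    if "tyw w' A = Some (bty \<rho>)" "tyw w' F = Some ((N \<leadsto> N) \<leadsto> bty \<rho> \<leadsto> bty \<rho>)" "tyw w' G = Some (N \<leadsto> N)" for w' A F G
    using that by simp
  \<comment> \<open>The three arguments of the curried recursor arrive one at a time, each in a
    later world than the previous one.\<close>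
  have main: "rel w3 \<rho> (Rec \<rho> \<cdot> a \<cdot> f \<cdot> n) (?r \<cdot> a' \<cdot> f' \<cdot> g)"
    if w1: "w0 \<le> w1" and a: "typed w1 a \<rho>" "typed w1 a' (bty \<rho>)" "rel w1 \<rho> a a'"
      and w2: "w1 \<le> w2" and f: "typed w2 f (N \<leadsto> \<rho> \<leadsto> \<rho>)"
        "typed w2 f' ((N \<leadsto> N) \<leadsto> bty \<rho> \<leadsto> bty \<rho>)" "rel w2 (N \<leadsto> \<rho> \<leadsto> \<rho>) f f'"
      and w3: "w2 \<le> w3" and n: "typed w3 n N" "typed w3 g (N \<leadsto> N)" "rel w3 N n g"
    for w1 w2 w3 a a' f f' n g
  proof -
    note w13 = order_trans[OF w2 w3]
    note w03 = order_trans[OF w1 w13]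
    note ty = a(1,2)[THEN typeof_mono, OF w13] f(1,2)[THEN typeof_mono, OF w3]
    let ?k = "Rec \<rho> \<cdot> a \<cdot> f" and ?h = "Rec (bty \<rho>) \<cdot> a' \<cdot> (pre_tm (bty \<rho> \<leadsto> bty \<rho>) \<cdot> f')"
    have "rel w3 \<rho> (?k \<cdot> n) (ke \<rho> \<cdot> ?h \<cdot> g)"
    proof (rule rel_ke[OF w03])
      fix w' m assume w': "w3 \<le> w'" and m: "typed w' m N"
      show "rel w' \<rho> (?k \<cdot> m) (?h \<cdot> m)"
        by (rule rel_Rec[OF order_trans[OF w03 w'] _ _ rel_mono[OF a(3) order_trans[OF w13 w']] _ _
              rel_mono[OF f(3) order_trans[OF w3 w']] m])
          (use ty[THEN typeof_mono, OF w'] in simp_all)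
    qed (use ty n in simp_all)
    then show ?thesis
      using rel_cong[OF w03, of \<rho> "?k \<cdot> n" "ke \<rho> \<cdot> ?h \<cdot> g" "Rec \<rho> \<cdot> a \<cdot> f \<cdot> n" "?r \<cdot> a' \<cdot> f' \<cdot> g"] ty n
      by (simp add: ev del: tr.simps)
  qed
  have "rel w (\<rho> \<leadsto> (N \<leadsto> \<rho> \<leadsto> \<rho>) \<leadsto> N \<leadsto> \<rho>) (Rec \<rho>) ?r"
  proof (subst rel_Fn[OF Rec.prems(2)], simp, simp, intro allI impI)
    fix w1 a a'
    assume w1: "w \<le> w1" and a: "typed w1 a \<rho>" "typed w1 a' (bty \<rho>)" "rel w1 \<rho> a a'"
    note w01 = order_trans[OF Rec.prems(2) w1]
    show "rel w1 ((N \<leadsto> \<rho> \<leadsto> \<rho>) \<leadsto> N \<leadsto> \<rho>) (Rec \<rho> \<cdot> a) (?r \<cdot> a')"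
    proof (subst rel_Fn[OF w01], simp add: a, simp add: a, intro allI impI)
      fix w2 f f'
      assume w2: "w1 \<le> w2" and f: "typed w2 f (N \<leadsto> \<rho> \<leadsto> \<rho>)"
        "typed w2 f' (bty (N \<leadsto> \<rho> \<leadsto> \<rho>))" "rel w2 (N \<leadsto> \<rho> \<leadsto> \<rho>) f f'"
      note ty = a(1,2)[THEN typeof_mono, OF w2]
      show "rel w2 (N \<leadsto> \<rho>) (Rec \<rho> \<cdot> a \<cdot> f) (?r \<cdot> a' \<cdot> f')"
      proof (subst rel_Fn[OF order_trans[OF w01 w2]], use ty f in simp, use ty f in simp, intro allI impI)
        fix w3 n g
        assume "w2 \<le> w3" "typed w3 n N" "typed w3 g (bty N)" "rel w3 N n g"
        then show "rel w3 \<rho> (Rec \<rho> \<cdot> a \<cdot> f \<cdot> n) (?r \<cdot> a' \<cdot> f' \<cdot> g)"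
          using main[OF w01 a w2 f(1) _ f(3)] f(2) by simp
      qed
    qed
  qed
  moreover have "sub ((!) us) ?r = ?r"
    by (rule sub_closed) simp
  ultimately show ?case using Rec.prems(1) by (simp del: tr.simps)
next
  case (App s t)
  then obtain \<rho> where ty: "typeof \<Gamma> s = Some (\<rho> \<leadsto> \<tau>)" "typeof \<Gamma> t = Some \<rho>"
    by (auto simp: apty_eq_Some)
  have "rel w (\<rho> \<leadsto> \<tau>) (sub ((!) ss) s) (sub ((!) us) (tr s))" "rel w \<rho> (sub ((!) ss) t) (sub ((!) us) (tr t))"
    using App.IH(1)[OF ty(1) App.prems(2-)] App.IH(2)[OF ty(2) App.prems(2-)] by blast+
  moreover note sub_ty = ty[THEN typeof_sub, OF tyl_tysub[OF App.prems(3)]]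
    ty[THEN tr_type, THEN typeof_sub, OF tyl_tysub[OF App.prems(4)]]
  ultimately show ?case
    using rel_Fn[OF App.prems(2), of "sub ((!) ss) s" \<rho> \<tau> "sub ((!) us) (tr s)"] by simp
next
  case (Lam \<rho> t)
  then obtain \<sigma> where \<sigma>: "typeof (\<rho> # \<Gamma>) t = Some \<sigma>" "\<tau> = \<rho> \<leadsto> \<sigma>" by auto
  have t: "typeof \<Gamma> (Lam \<rho> t) = Some (\<rho> \<leadsto> \<sigma>)" using \<sigma> by simp
  note sub_ty = typeof_sub[OF t tyl_tysub[OF Lam.prems(3)]]
    typeof_sub[OF tr_type[OF t] tyl_tysub[OF Lam.prems(4)]]
  have beta: "val w' (sub ((!) ts) (Lam \<rho> u) \<cdot> x) = val w' (sub ((!) (x # ts)) u)"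
    if "tyl w' ts \<Delta>" "typeof (\<rho> # \<Delta>) u = Some \<sigma>" "typed w' x \<rho>" for w' ts \<Delta> u x \<rho> \<sigma>
  proof -
    have "val w' (sub ((!) ts) (Lam \<rho> u)) = den w' (map (val w') ts) (Lam \<rho> u)"
      by (rule val_sub[OF that(1)]) (simp add: that)
    moreover have "val w' (sub ((!) (x # ts)) u) = den w' (val w' x # map (val w') ts) u"
      using val_sub[of w' "x # ts" "\<rho> # \<Delta>" u \<sigma>] that by simp
    ultimately show ?thesis
      using that tyl_tys[OF that(1)] tyl_tyE[OF that(1)] by (simp del: sub.simps(3))
  qed
  have "rel w' \<sigma> (sub ((!) ss) (Lam \<rho> t) \<cdot> x) (sub ((!) us) (tr (Lam \<rho> t)) \<cdot> y)"
    if w': "w \<le> w'" and x: "typed w' x \<rho>" and y: "typed w' y (bty \<rho>)"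
      and xy: "rel w' \<rho> x y" for w' x y
  proof -
    have w0: "w0 \<le> w'" using Lam.prems(2) w' by (rule order_trans)
    note l = Lam.prems(3,4)[THEN tyl_mono, OF w']
    have IH: "rel w' \<sigma> (sub ((!) (x # ss)) t) (sub ((!) (y # us)) (tr t))"
      by (rule Lam.IH[OF \<sigma>(1) w0])
        (use x y xy l rel_mono[OF Lam.prems(5) w'] in \<open>auto simp: nth_Cons split: nat.split\<close>)
    show ?thesis
    proof (rule rel_cong[OF w0 IH])
      show "typed w' (sub ((!) (x # ss)) t) \<sigma>"
        by (rule typeof_sub[OF \<sigma>(1) tyl_tysub]) (use x l in simp)
      show "typed w' (sub ((!) (y # us)) (tr t)) (bty \<sigma>)"
        by (rule typeof_sub[OF tr_type[OF \<sigma>(1)] tyl_tysub]) (use y l in simp)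
      show "val w' (sub ((!) (x # ss)) t) = val w' (sub ((!) ss) (Lam \<rho> t) \<cdot> x)"
        by (rule beta[OF l(1) \<sigma>(1) x, symmetric])
      show "val w' (sub ((!) (y # us)) (tr t)) = val w' (sub ((!) us) (tr (Lam \<rho> t)) \<cdot> y)"
        unfolding tr.simps
        by (rule beta[OF l(2) _ y, symmetric]) (use tr_type[OF \<sigma>(1)] in simp)
    qed
  qed
  then show ?case
    using rel_Fn[OF Lam.prems(2) sub_ty(1)] sub_ty(2) \<sigma>(2) by simp
qed

end

section \<open>The generic sequence\<close>

text \<open>
  \<open>lookup a m\<close> is \<open>Succ v\<close> if the sequence coded by \<open>a\<close> has \<open>m\<close>-th entry \<open>v\<close>, and \<open>0\<close> if
  it is too short. The recursion along snoc computes the whole function \<open>lookup a\<close>: the new entry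
  of \<open>a * \<langle>n\<rangle>\<close> sits at the first \<open>m\<close> where \<open>lookup a\<close> is \<open>0\<close>.
\<close>

definition lookup_step_tm :: tm where
  "lookup_step_tm = Lam N (Lam (N \<leadsto> N) (Lam N (Rec N
     \<cdot> (Rec N \<cdot> (Succ \<cdot> Var 2)
          \<cdot> Lam N (Lam N (Rec N \<cdot> Zero \<cdot> Lam N (Lam N (Succ \<cdot> Var 6)) \<cdot> (Var 3 \<cdot> Var 1)))
          \<cdot> Var 0)
     \<cdot> Lam N (Lam N (Succ \<cdot> Var 1))
     \<cdot> (Var 1 \<cdot> Var 0))))"

definition lookup_iter_tm :: tm where
  "lookup_iter_tm = Rec (N \<leadsto> N \<leadsto> N) \<cdot> Lam N (Lam N Zero)
     \<cdot> Lam N (Lam (N \<leadsto> N \<leadsto> N) (Lam N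
        (Rec (N \<leadsto> N) \<cdot> Lam N Zero
           \<cdot> Lam N (Lam (N \<leadsto> N) (lookup_step_tm \<cdot> (snd_tm \<cdot> Var 1) \<cdot> (Var 3 \<cdot> (fst_tm \<cdot> Var 1))))
           \<cdot> Var 0)))"

definition lookup_tm :: tm where
  "lookup_tm = Lam N (lookup_iter_tm \<cdot> Var 0 \<cdot> Var 0)"

lemma lookup_step_type: "typeof [] lookup_step_tm = Some (N \<leadsto> (N \<leadsto> N) \<leadsto> N \<leadsto> N)"
  by (simp add: lookup_step_tm_def)

lemmas lookup_step_ty [simp] = lookup_step_type[THEN typeof_closed] lookup_step_type[THEN den_closed]

lemma lookup_iter_type: "typeof [] lookup_iter_tm = Some (N \<leadsto> N \<leadsto> N \<leadsto> N)"
  by (simp add: lookup_iter_tm_def)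

lemmas lookup_iter_ty [simp] = lookup_iter_type[THEN typeof_closed] lookup_iter_type[THEN den_closed]

lemma lookup_type: "typeof [] lookup_tm = Some (N \<leadsto> N \<leadsto> N)"
  by (simp add: lookup_tm_def)

lemmas lookup_ty [simp] = lookup_type[THEN typeof_closed] lookup_type[THEN den_closed]

abbreviation lk :: "world \<Rightarrow> cls \<Rightarrow> cls \<Rightarrow> cls" where "lk w \<equiv> ap2 w (val w lookup_tm)"

text \<open>Since the defined positions form an initial segment, an undefined \<open>M\<close> is
  the first such position just if it is zero or its predecessor is defined. Hence the recursor on
  \<open>M\<close> only inspects the predecessor.\<close>

lemma lookup_step_simps:
  assumes "tyw w X = Some N" "tyw w R = Some (N \<leadsto> N)" "tyw w M = Some N" "tyw w V = Some N"
  shows "app w R M = sc w V \<Longrightarrow> app w (ap2 w (val w lookup_step_tm) X R) M = sc w V"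
    and "app w R (zr w) = zr w \<Longrightarrow> app w (ap2 w (val w lookup_step_tm) X R) (zr w) = sc w X"
    and "app w R (sc w M) = zr w \<Longrightarrow> app w R M = zr w \<Longrightarrow>
      app w (ap2 w (val w lookup_step_tm) X R) (sc w M) = zr w"
    and "app w R (sc w M) = zr w \<Longrightarrow> app w R M = sc w V \<Longrightarrow>
      app w (ap2 w (val w lookup_step_tm) X R) (sc w M) = sc w X"
  using assms by (simp_all add: lookup_step_tm_def)

lemma lookup_nil: "tyw w M = Some N \<Longrightarrow> lk w (zr w) M = zr w"
  by (simp add: lookup_tm_def lookup_iter_tm_def)

lemma lookup_snoc:
  assumes "tyw w A = Some N" "tyw w X = Some N"
  shows "app w (val w lookup_tm) (snoc w A X) =
    ap2 w (val w lookup_step_tm) X (app w (val w lookup_tm) A)"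
proof -
  have z: "den w (Y # E) (Lam N Zero) = den w [] (Lam N Zero)" for w Y E
    by (simp only: den_def sub.simps)
  have "ap2 w (val w lookup_iter_tm) (snoc w A X) (snoc w A X) =
    ap2 w (val w lookup_step_tm) X (ap2 w (val w lookup_iter_tm) A A)"
    by (rule iteration_stable[where z="Lam N Zero" and \<tau>="N \<leadsto> N"
          and G="\<lambda>w. ap2 w (val w lookup_step_tm)"])
      (use assms in \<open>simp_all add: lookup_iter_tm_def z\<close>)
  then show ?thesis using assms by (simp add: lookup_tm_def)
qed

text \<open>Entries already present are never overwritten, by induction on the code of the appended
  sequence.\<close>

lemma lookup_append:
  assumes "tyw w A = Some N" "tyw w M = Some N" "tyw w V = Some N" "tyw w B = Some N"
    and "lk w A M = sc w V"
  shows "lk w (cat w A B) M = sc w V"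
proof -
  obtain a where a: "A = val w a" "typed w a N" using cls_cases[OF assms(1)] .
  obtain m where m: "M = val w m" "typed w m N" using cls_cases[OF assms(2)] .
  obtain v where v: "V = val w v" "typed w v N" using cls_cases[OF assms(3)] .
  \<comment> \<open>The hypothesis is turned into an equation between terms so that it persists in
    the worlds of the induction.\<close>
  have "val w (lookup_tm \<cdot> a \<cdot> m) = val w (Succ \<cdot> v)" using assms(5) a m v by simp
  from val_mono[OF this, of N] have h: "lk w' (val w' a) (val w' m) = sc w' (val w' v)" if "w \<le> w'" for w'
    using that a(2) m(2) by simp
  let ?s = "lookup_tm \<cdot> (append_tm \<cdot> Var 1 \<cdot> Var 0) \<cdot> Var 2" and ?t = "Succ \<cdot> Var 3"
  have "den_eq w (B # map (val w) [a, m, v]) ?s ?t"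
  proof (rule code_induct0[where \<tau>s="[N, N, N]" and \<sigma>=N])
    fix w' assume w': "w \<le> w'"
    note ty = typeof_mono[OF a(2) w'] typeof_mono[OF m(2) w'] typeof_mono[OF v(2) w']
    show "den_eq w' (zr w' # map (val w') [a, m, v]) ?s ?t"
      using ty h[OF w'] by simp
    fix C X assume "tyw w' C = Some N" "tyw w' X = Some N"
      "den_eq w' (C # map (val w') [a, m, v]) ?s ?t"
    then show "den_eq w' (snoc w' C X # map (val w') [a, m, v]) ?s ?t"
      using ty by (simp add: lookup_snoc lookup_step_simps(1))
  qed (use a(2) m(2) v(2) assms in simp_all)
  then show ?thesis using a m v assms by simp
qed

text \<open>Writing the position as length plus \<open>J\<close> avoids an inequality. To exclude a
  new entry there, the step needs both the position and its predecessor to be undefined before, that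
  is, the hypothesis at \<open>Succ J\<close> and at \<open>J\<close>.\<close>

lemma lookup_seg_undef:
  assumes "tyw w F = Some (N \<leadsto> N)" "tyw w M = Some N" "tyw w J = Some N"
  shows "lk w (sg w F M) (pl w M J) = zr w"
proof -
  obtain f where f: "F = val w f" "typed w f (N \<leadsto> N)" using cls_cases[OF assms(1)] .
  let ?s = "lookup_tm \<cdot> (seg_tm \<cdot> Var 2 \<cdot> Var 1) \<cdot> (plus_tm \<cdot> Var 1 \<cdot> Var 0)" and ?t = Zero
  have "den_eq w (J # M # map (val w) [f]) ?s ?t"
  proof (rule cls_induct1[where \<rho>=N and \<tau>s="[N \<leadsto> N]" and \<sigma>=N])
    fix w' Y assume w': "w \<le> w'" "tyw w' Y = Some N"
    note ty = typeof_mono[OF f(2) w'(1)]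
    show "den_eq w' (Y # zr w' # map (val w') [f]) ?s ?t"
      using ty w' by (simp add: lookup_nil)
    fix X assume X: "tyw w' X = Some N"
      and IH: "\<And>Y. tyw w' Y = Some N \<Longrightarrow>
        den_eq w' (Y # X # map (val w') [f]) ?s ?t"
    have "lk w' (sg w' (val w' f) X) (sc w' (pl w' X Y)) = zr w'" "lk w' (sg w' (val w' f) X) (pl w' X Y) = zr w'"
      using IH[of "sc w' Y"] IH[of Y] X w' ty by simp_all
    then show "den_eq w' (Y # sc w' X # map (val w') [f]) ?s ?t"
      using X w' ty by (simp add: lookup_snoc lookup_step_simps(3))
  qed (use assms f(2) in simp_all)
  then show ?thesis using f assms by simp
qed

text \<open>In the step, the segment of length \<open>Succ X\<close> has entry \<open>X\<close> by
  induction and none at \<open>Succ X\<close> by \<open>lookup_seg_undef\<close>, so the next value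
  is stored exactly at \<open>Succ X\<close>.\<close>

lemma lookup_seg_Succ:
  assumes "tyw w F = Some (N \<leadsto> N)" "tyw w M = Some N"
  shows "lk w (sg w F (sc w M)) M = sc w (app w F M)"
proof -
  obtain f where f: "F = val w f" "typed w f (N \<leadsto> N)" using cls_cases[OF assms(1)] .
  let ?s = "lookup_tm \<cdot> (seg_tm \<cdot> Var 1 \<cdot> (Succ \<cdot> Var 0)) \<cdot> Var 0" and ?t = "Succ \<cdot> (Var 1 \<cdot> Var 0)"
  have "den_eq w (M # map (val w) [f]) ?s ?t"
  proof (rule cls_induct0[where \<tau>s="[N \<leadsto> N]" and \<sigma>=N])
    fix w' assume w': "w \<le> w'"
    note ty = typeof_mono[OF f(2) w']
    show "den_eq w' (zr w' # map (val w') [f]) ?s ?t"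
      using ty w' by (simp add: lookup_snoc lookup_nil lookup_step_simps(2)[where V="zr w'" and M="zr w'"])
    fix X assume X: "tyw w' X = Some N"
      and IH: "den_eq w' (X # map (val w') [f]) ?s ?t"
    have "lk w' (sg w' (val w' f) (sc w' X)) (sc w' X) = zr w'"
      using lookup_seg_undef[of w' "val w' f" "sc w' X" "zr w'"] X ty by (simp del: seg_simps)
    moreover have "lk w' (sg w' (val w' f) (sc w' X)) X = sc w' (app w' (val w' f) X)"
      using IH X ty by (simp del: seg_simps)
    ultimately have "lk w' (sg w' (val w' f) (sc w' (sc w' X))) (sc w' X) = sc w' (app w' (val w' f) (sc w' X))"
      using X ty seg_simps(2)[of w' "val w' f" "sc w' X"]
        lookup_step_simps(4)[of w' "app w' (val w' f) (sc w' X)" "app w' (val w' lookup_tm) (sg w' (val w' f) (sc w' X))" X "app w' (val w' f) X"]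
      by (simp add: lookup_snoc del: seg_simps)
    then show "den_eq w' (sc w' X # map (val w') [f]) ?s ?t"
      using X ty by (simp del: seg_simps)
  qed (use assms f(2) in simp_all)
  then show ?thesis using f assms by simp
qed

text \<open>Two initial segments extend to a common one, so that no comparison of lengths is needed.\<close>

lemma lookup_seg_sound:
  assumes "tyw w F = Some (N \<leadsto> N)" "tyw w K = Some N" "tyw w M = Some N" "tyw w V = Some N"
    and "lk w (sg w F K) M = sc w V"
  shows "app w F M = V"
proof -
  have mono: "lk w (sg w F (pl w K J)) M = sc w V"
    if K: "tyw w K = Some N" and V: "tyw w V = Some N" and "lk w (sg w F K) M = sc w V" and "tyw w J = Some N" for K V J
  proof -
    obtain f where f: "F = val w f" "typed w f (N \<leadsto> N)" using cls_cases[OF assms(1)] .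
    obtain k where k: "K = val w k" "typed w k N" using cls_cases[OF K] .
    obtain m where m: "M = val w m" "typed w m N" using cls_cases[OF assms(3)] .
    obtain v where v: "V = val w v" "typed w v N" using cls_cases[OF V] .
    have "val w (lookup_tm \<cdot> (seg_tm \<cdot> f \<cdot> k) \<cdot> m) = val w (Succ \<cdot> v)" using that f k m v by simp
    from val_mono[OF this, of N]
    have h: "lk w' (sg w' (val w' f) (val w' k)) (val w' m) = sc w' (val w' v)" if "w \<le> w'" for w'
      using that f(2) k(2) m(2) by simp
    let ?as = "[f, k, m, v]"
    let ?s = "lookup_tm \<cdot> (seg_tm \<cdot> Var 1 \<cdot> (plus_tm \<cdot> Var 2 \<cdot> Var 0)) \<cdot> Var 3" and ?t = "Succ \<cdot> Var 4"
    have "den_eq w (J # map (val w) ?as) ?s ?t"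
    proof (rule cls_induct0[where \<tau>s="[N \<leadsto> N, N, N, N]" and \<sigma>=N])
      fix w' assume w': "w \<le> w'"
      note ty = f(2)[THEN typeof_mono, OF w'] k(2)[THEN typeof_mono, OF w']
        m(2)[THEN typeof_mono, OF w'] v(2)[THEN typeof_mono, OF w']
      show "den_eq w' (zr w' # map (val w') ?as) ?s ?t"
        using ty h[OF w'] by simp
      fix X assume "tyw w' X = Some N" "den_eq w' (X # map (val w') ?as) ?s ?t"
      then show "den_eq w' (sc w' X # map (val w') ?as) ?s ?t"
        using ty by (simp add: lookup_snoc lookup_step_simps(1))
    qed (use that f(2) k(2) m(2) v(2) in simp_all)
    then show ?thesis using that f k m v by simp
  qed
  have "lk w (sg w F (pl w K (sc w M))) M = sc w V"
    using assms by (intro mono) simp_all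
  moreover have "lk w (sg w F (pl w (sc w M) K)) M = sc w (app w F M)"
    using assms by (intro mono) (simp_all add: lookup_seg_Succ del: seg_simps)
  ultimately have "sc w (app w F M) = sc w V"
    using assms plus_comm[of w K M] by simp
  then show ?thesis by (rule val_Succ_inj) (use assms in simp_all)
qed

section \<open>Neighbourhood functions\<close>

lemmas const_subs [simp] = const_types[THEN sub_closed] lookup_type[THEN sub_closed]

text \<open>The position comes before the segment, so that \<open>generic_tm \<cdot> m\<close> is
  the computation that asks for entry \<open>m\<close>.\<close>

definition generic_tm :: tm where
  "generic_tm = Lam N (Lam N (lookup_tm \<cdot> Var 0 \<cdot> Var 1))"

lemma generic_type: "typeof [] generic_tm = Some (N \<leadsto> N \<leadsto> N)"
  by (simp add: generic_tm_def)

lemmas generic_simps [simp] =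
  generic_type[THEN typeof_closed] generic_type[THEN den_closed] generic_type[THEN sub_closed]

lemma generic_eval: "tyw w M = Some N \<Longrightarrow> tyw w A = Some N \<Longrightarrow> ap2 w (val w generic_tm) M A = lk w A M"
  by (simp add: generic_tm_def)

text \<open>
  The variables are \<open>0\<close> for a number \<open>x\<close>, \<open>1\<close> for a function \<open>g\<close> on codes, \<open>2\<close> for the sequence
  \<open>\<alpha>\<close>, followed by the parameters of \<open>Q\<close>. The last conjunct is bar induction for \<open>Q\<close> above an
  arbitrary node; this relativisation is what makes it stable under \<^const>\<open>bind_tm\<close>.
\<close>

definition base_fm :: "fm \<Rightarrow> fm" where
  "base_fm Q =
    (foralls [N, N, N] (Eq N (Var 4 \<cdot> Var 2) (Succ \<cdot> Var 1) \<^bold>\<longrightarrow>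
       Eq N (Var 4 \<cdot> (append_tm \<cdot> Var 2 \<cdot> Var 0)) (Succ \<cdot> Var 1)) \<^bold>\<and>
     foralls [N, N] (Eq N (Var 3 \<cdot> (seg_tm \<cdot> Var 4 \<cdot> Var 1)) (Succ \<cdot> Var 0) \<^bold>\<longrightarrow> Eq N (Var 2) (Var 0)) \<^bold>\<and>
     foralls [N]
       (foralls [N, N] (Eq N (Var 4 \<cdot> (append_tm \<cdot> Var 2 \<cdot> Var 1)) (Succ \<cdot> Var 0) \<^bold>\<longrightarrow>
          fsub (case_nat (append_tm \<cdot> Var 2 \<cdot> Var 1) (\<lambda>i. Var (i + 6))) Q) \<^bold>\<longrightarrow>
        fsub (case_nat (Var 0) (\<lambda>i. Var (i + 4))) Q))"

lemma all_tyl: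
  "(\<forall>us. tyl w us [\<rho>] \<longrightarrow> R us) \<longleftrightarrow> (\<forall>a. tyl w [a] [\<rho>] \<longrightarrow> R [a])"
  "(\<forall>us. tyl w us [\<rho>, \<rho>'] \<longrightarrow> R us) \<longleftrightarrow> (\<forall>a b. tyl w [a, b] [\<rho>, \<rho>'] \<longrightarrow> R [a, b])"
  "(\<forall>us. tyl w us [\<rho>, \<rho>', \<rho>''] \<longrightarrow> R us) \<longleftrightarrow> (\<forall>a b c. tyl w [a, b, c] [\<rho>, \<rho>', \<rho>''] \<longrightarrow> R [a, b, c])"
  by (auto simp: map_eq_Cons_conv)

definition mono_at :: "world \<Rightarrow> tm \<Rightarrow> bool" where
  "mono_at w g \<longleftrightarrow> (\<forall>w' \<ge> w. \<forall>a m b. typed w' a N \<longrightarrow> typed w' m N \<longrightarrow>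
     typed w' b N \<longrightarrow> app w' (val w' g) (val w' a) = sc w' (val w' m) \<longrightarrow>
     app w' (val w' g) (cat w' (val w' a) (val w' b)) = sc w' (val w' m))"

text \<open>Partial correctness only: it is left open whether \<open>g\<close> is positive anywhere
  along \<open>\<alpha>\<close>.\<close>

definition sound_at :: "world \<Rightarrow> tm \<Rightarrow> tm \<Rightarrow> tm \<Rightarrow> bool" where
  "sound_at w x g \<alpha> \<longleftrightarrow> (\<forall>w' \<ge> w. \<forall>n m. typed w' n N \<longrightarrow> typed w' m N \<longrightarrow>
     app w' (val w' g) (sg w' (val w' \<alpha>) (val w' n)) = sc w' (val w' m) \<longrightarrow> val w' x = val w' m)"

definition bar_at :: "fm \<Rightarrow> world \<Rightarrow> tm \<Rightarrow> tm list \<Rightarrow> tm \<Rightarrow> bool" where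
  "bar_at Q w g ps a \<longleftrightarrow> (\<forall>w' \<ge> w. \<forall>b m. typed w' b N \<longrightarrow> typed w' m N \<longrightarrow>
     app w' (val w' g) (cat w' (val w' a) (val w' b)) = sc w' (val w' m) \<longrightarrow>
     satl w' (append_tm \<cdot> a \<cdot> b # ps) Q)"

text \<open>Being progressive is not a premise here but an assumption on the ambient world. The base
  relation can therefore be shown closed under unit and bind without referring to it.\<close>

definition ind_at :: "fm \<Rightarrow> world \<Rightarrow> tm \<Rightarrow> tm list \<Rightarrow> bool" where
  "ind_at Q w g ps \<longleftrightarrow> (\<forall>w' \<ge> w. \<forall>a. typed w' a N \<longrightarrow> bar_at Q w' g ps a \<longrightarrow> satl w' (a # ps) Q)"

definition progressive :: "fm \<Rightarrow> world \<Rightarrow> tm list \<Rightarrow> bool" where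
  "progressive Q w ps \<longleftrightarrow> (\<forall>w' \<ge> w. \<forall>a. typed w' a N \<longrightarrow>
     (\<forall>w'' \<ge> w'. \<forall>n. typed w'' n N \<longrightarrow> satl w'' (append_tm \<cdot> a \<cdot> (single_tm \<cdot> n) # ps) Q) \<longrightarrow>
     satl w' (a # ps) Q)"

text \<open>\<open>bind_tm \<cdot> generic_tm\<close> is the generic sequence as an element of the
  translated type: it also accepts positions that are themselves computed from the input.\<close>

definition gam :: "tm \<Rightarrow> tm" where
  "gam Y = tr Y \<cdot> (bind_tm \<cdot> generic_tm)"

context
  fixes Q :: fm and \<Gamma> :: "ty list"
  assumes Q: "wff (N # \<Gamma>) Q"
begin

lemma wff_base_fm: "wff (N # (N \<leadsto> N) # (N \<leadsto> N) # \<Gamma>) (base_fm Q)"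
proof -
  let ?\<Delta> = "N # (N \<leadsto> N) # (N \<leadsto> N) # \<Gamma>"
  have "wff (N # N # N # ?\<Delta>) (fsub (case_nat (append_tm \<cdot> Var 2 \<cdot> Var 1) (\<lambda>i. Var (i + 6))) Q)"
    "wff (N # ?\<Delta>) (fsub (case_nat (Var 0) (\<lambda>i. Var (i + 4))) Q)"
    by (rule wff_fsub[OF Q]; auto simp: tysub_def nth_Cons numeral_eq_Suc split: nat.split)+
  then show ?thesis
    by (simp add: base_fm_def has_type_iff)
qed

lemma satl_base_fm:
  assumes "typed w x N" "typed w g (N \<leadsto> N)"
    "typed w \<alpha> (N \<leadsto> N)" "tyl w ps \<Gamma>"
  shows "satl w (x # g # \<alpha> # ps) (base_fm Q) \<longleftrightarrow> mono_at w g \<and> sound_at w x g \<alpha> \<and> ind_at Q w g ps"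
proof -
  let ?\<theta> = "x # g # \<alpha> # ps" and ?\<Delta> = "N # (N \<leadsto> N) # (N \<leadsto> N) # \<Gamma>"
  have l: "tyl w' ?\<theta> ?\<Delta>" if "w \<le> w'" for w'
    using assms tyl_mono[OF _ that, of ?\<theta> ?\<Delta>] by simp
  have Eq: "satl w' (us @ ?\<theta>) (Eq N s t) \<longleftrightarrow>
      den_eq w' (map (val w') (us @ ?\<theta>)) s t"
    if "w \<le> w'" "tyl w' us \<rho>s" "typeof (\<rho>s @ ?\<Delta>) s = Some N" "typeof (\<rho>s @ ?\<Delta>) t = Some N" for w' us \<rho>s s t
    by (rule satl_Eq[of _ _ "\<rho>s @ ?\<Delta>"]) (use that l in simp_all)
  have tyE: "tyE w' (map (val w') ps)" if "w \<le> w'" for w'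
    by (rule tyl_tyE[OF tyl_mono[OF assms(4) that]])
  let ?A = "Eq N (Var 4 \<cdot> Var 2) (Succ \<cdot> Var 1)"
  let ?B = "Eq N (Var 4 \<cdot> (append_tm \<cdot> Var 2 \<cdot> Var 0)) (Succ \<cdot> Var 1)"
  have 1: "satl w ?\<theta> (foralls [N, N, N] (?A \<^bold>\<longrightarrow> ?B)) \<longleftrightarrow> mono_at w g"
  proof -
    have "satl w ?\<theta> (foralls [N, N, N] (?A \<^bold>\<longrightarrow> ?B)) \<longleftrightarrow>
      (\<forall>w' \<ge> w. \<forall>us. tyl w' us [N, N, N] \<longrightarrow> satl w' (us @ ?\<theta>) ?A \<longrightarrow> satl w' (us @ ?\<theta>) ?B)"
      by (rule satl_rule[OF l]) (simp_all add: has_type_iff)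
    also have "\<dots> \<longleftrightarrow> (\<forall>w' \<ge> w. \<forall>b m a. tyl w' [b, m, a] [N, N, N] \<longrightarrow>
      satl w' ([b, m, a] @ ?\<theta>) ?A \<longrightarrow> satl w' ([b, m, a] @ ?\<theta>) ?B)"
      by (simp only: all_tyl(3))
    also have "\<dots> \<longleftrightarrow> mono_at w g"
    proof -
      have "satl w' ([b, m, a] @ ?\<theta>) ?A \<longleftrightarrow> app w' (val w' g) (val w' a) = sc w' (val w' m)"
        "satl w' ([b, m, a] @ ?\<theta>) ?B \<longleftrightarrow>
          app w' (val w' g) (cat w' (val w' a) (val w' b)) = sc w' (val w' m)"
        if "w \<le> w'" "tyl w' [b, m, a] [N, N, N]" for w' b m a
        by (subst Eq[OF that]; use that l[OF that(1)] tyE[OF that(1)] in simp)+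
      then show ?thesis unfolding mono_at_def by (auto 0 3)
    qed
    finally show ?thesis .
  qed
  let ?C = "Eq N (Var 3 \<cdot> (seg_tm \<cdot> Var 4 \<cdot> Var 1)) (Succ \<cdot> Var 0)" and ?D = "Eq N (Var 2) (Var 0)"
  have 2: "satl w ?\<theta> (foralls [N, N] (?C \<^bold>\<longrightarrow> ?D)) \<longleftrightarrow> sound_at w x g \<alpha>"
  proof -
    have "satl w ?\<theta> (foralls [N, N] (?C \<^bold>\<longrightarrow> ?D)) \<longleftrightarrow>
      (\<forall>w' \<ge> w. \<forall>us. tyl w' us [N, N] \<longrightarrow> satl w' (us @ ?\<theta>) ?C \<longrightarrow> satl w' (us @ ?\<theta>) ?D)"
      by (rule satl_rule[OF l]) (simp_all add: has_type_iff)
    also have "\<dots> \<longleftrightarrow> (\<forall>w' \<ge> w. \<forall>m n. tyl w' [m, n] [N, N] \<longrightarrow>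
      satl w' ([m, n] @ ?\<theta>) ?C \<longrightarrow> satl w' ([m, n] @ ?\<theta>) ?D)"
      by (simp only: all_tyl(2))
    also have "\<dots> \<longleftrightarrow> sound_at w x g \<alpha>"
    proof -
      have "satl w' ([m, n] @ ?\<theta>) ?C \<longleftrightarrow>
          app w' (val w' g) (sg w' (val w' \<alpha>) (val w' n)) = sc w' (val w' m)"
        "satl w' ([m, n] @ ?\<theta>) ?D \<longleftrightarrow> val w' x = val w' m"
        if "w \<le> w'" "tyl w' [m, n] [N, N]" for w' m n
        by (subst Eq[OF that]; use that l[OF that(1)] tyE[OF that(1)] in simp)+
      then show ?thesis unfolding sound_at_def by (auto 0 3)
    qed
    finally show ?thesis .
  qed
  let ?E = "Eq N (Var 4 \<cdot> (append_tm \<cdot> Var 2 \<cdot> Var 1)) (Succ \<cdot> Var 0)"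
  let ?F = "fsub (case_nat (append_tm \<cdot> Var 2 \<cdot> Var 1) (\<lambda>i. Var (i + 6))) Q"
  let ?H = "fsub (case_nat (Var 0) (\<lambda>i. Var (i + 4))) Q"
  have wf: "wff (N # N # N # ?\<Delta>) ?F" "wff (N # ?\<Delta>) ?H"
    by (rule wff_fsub[OF Q]; auto simp: tysub_def nth_Cons numeral_eq_Suc split: nat.split)+
  have 3: "satl w ?\<theta> (foralls [N] (foralls [N, N] (?E \<^bold>\<longrightarrow> ?F) \<^bold>\<longrightarrow> ?H)) \<longleftrightarrow> ind_at Q w g ps"
  proof -
    have inner: "satl w' (a # ?\<theta>) (foralls [N, N] (?E \<^bold>\<longrightarrow> ?F)) \<longleftrightarrow> bar_at Q w' g ps a"
      if w': "w \<le> w'" and a: "typed w' a N" for w' a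
    proof -
      have "satl w' (a # ?\<theta>) (foralls [N, N] (?E \<^bold>\<longrightarrow> ?F)) \<longleftrightarrow>
        (\<forall>w'' \<ge> w'. \<forall>us. tyl w'' us [N, N] \<longrightarrow> satl w'' (us @ a # ?\<theta>) ?E \<longrightarrow> satl w'' (us @ a # ?\<theta>) ?F)"
        by (rule satl_rule[of _ _ "N # ?\<Delta>"]) (use a l[OF w'] wf in \<open>simp_all add: has_type_iff\<close>)
      also have "\<dots> \<longleftrightarrow> (\<forall>w'' \<ge> w'. \<forall>m b. tyl w'' [m, b] [N, N] \<longrightarrow>
        satl w'' ([m, b] @ a # ?\<theta>) ?E \<longrightarrow> satl w'' ([m, b] @ a # ?\<theta>) ?F)"
        by (simp only: all_tyl(2))
      also have "\<dots> \<longleftrightarrow> bar_at Q w' g ps a"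
      proof -
        have "satl w'' ([m, b] @ a # ?\<theta>) ?E \<longleftrightarrow>
            app w'' (val w'' g) (cat w'' (val w'' a) (val w'' b)) = sc w'' (val w'' m)"
          if w'': "w' \<le> w''" "tyl w'' [m, b] [N, N]" for w'' m b
        proof -
          have "tyl w'' [m, b, a] [N, N, N]" using w'' typeof_mono[OF a w''(1)] by simp
          from Eq[OF order_trans[OF w' w''(1)] this, of "Var 4 \<cdot> (append_tm \<cdot> Var 2 \<cdot> Var 1)" "Succ \<cdot> Var 0"]
          show ?thesis
            using w'' typeof_mono[OF a w''(1)] l[OF order_trans[OF w' w''(1)]] tyE[OF order_trans[OF w' w''(1)]]
            by simp
        qed
        moreover have "satl w'' ([m, b] @ a # ?\<theta>) ?F \<longleftrightarrow> satl w'' (append_tm \<cdot> a \<cdot> b # ps) Q" for w'' m b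
          by (rule satl_fsub[OF Q]) (simp add: nth_Cons numeral_eq_Suc split: nat.split)
        ultimately show ?thesis unfolding bar_at_def by (auto 0 3)
      qed
      finally show ?thesis .
    qed
    have "satl w ?\<theta> (foralls [N] (foralls [N, N] (?E \<^bold>\<longrightarrow> ?F) \<^bold>\<longrightarrow> ?H)) \<longleftrightarrow>
      (\<forall>w' \<ge> w. \<forall>us. tyl w' us [N] \<longrightarrow> satl w' (us @ ?\<theta>) (foralls [N, N] (?E \<^bold>\<longrightarrow> ?F)) \<longrightarrow> satl w' (us @ ?\<theta>) ?H)"
      by (rule satl_rule[OF l]) (use wf in \<open>simp_all add: has_type_iff\<close>)
    also have "\<dots> \<longleftrightarrow> (\<forall>w' \<ge> w. \<forall>a. tyl w' [a] [N] \<longrightarrow>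
      satl w' ([a] @ ?\<theta>) (foralls [N, N] (?E \<^bold>\<longrightarrow> ?F)) \<longrightarrow> satl w' ([a] @ ?\<theta>) ?H)"
      by (simp only: all_tyl(1))
    also have "\<dots> \<longleftrightarrow> ind_at Q w g ps"
    proof -
      have "satl w' ([a] @ ?\<theta>) ?H \<longleftrightarrow> satl w' (a # ps) Q" for w' a
        by (rule satl_fsub[OF Q]) (simp add: nth_Cons numeral_eq_Suc split: nat.split)
      then show ?thesis unfolding ind_at_def using inner by (auto 0 3 simp del: foralls.simps)
    qed
    finally show ?thesis .
  qed
  show ?thesis
    unfolding base_fm_def satl_Conj 1 2 3 ..
qed

section \<open>Closure of the base relation under unit, bind and the generic sequence\<close>

lemma Q_cong:
  assumes "tyl w ps \<Gamma>" "typed w s N" "val w s = val w t" "satl w (s # ps) Q"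
  shows "satl w (t # ps) Q"
  by (rule satl_subst[OF assms(1) Q assms(2,3,4)])

lemma satl_cases:
  assumes "typed w t N" "tyl w ts \<Delta>" "wff \<Delta> A"
    and "\<And>w'. w \<le> w' \<Longrightarrow> val w' t = zr w' \<Longrightarrow> satl w' ts A"
    and "\<And>w' n. w \<le> w' \<Longrightarrow> typed w' n N \<Longrightarrow> val w' t = sc w' (val w' n) \<Longrightarrow> satl w' ts A"
  shows "satl w ts A"
  using prv_cases[OF assms(1) wff_fsub[OF assms(3) tyl_tysub[OF assms(2)]]] assms(4,5)
  by (simp add: satl_def sat_def)

text \<open>A unit is positive at every node, so the bar above \<open>a\<close> contains
  \<open>a\<close> itself; soundness is injectivity of the successor.\<close>

lemma base_eta:
  assumes m: "typed w m N" and "typed w \<alpha> (N \<leadsto> N)" and ps: "tyl w ps \<Gamma>"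
  shows "satl w (m # eta_tm \<cdot> m # \<alpha> # ps) (base_fm Q)"
proof -
  have "mono_at w (eta_tm \<cdot> m)"
    unfolding mono_at_def using typeof_mono[OF m] by (simp add: eta_eval)
  moreover have "sound_at w m (eta_tm \<cdot> m) \<alpha>"
    unfolding sound_at_def
  proof (intro allI impI)
    fix w' n v assume w': "w \<le> w'" and "typed w' n N" "typed w' v N"
      "app w' (val w' (eta_tm \<cdot> m)) (sg w' (val w' \<alpha>) (val w' n)) = sc w' (val w' v)"
    then show "val w' m = val w' v"
      using val_Succ_inj[of w' "val w' m" "val w' v"] typeof_mono[OF m w'] typeof_mono[OF assms(2) w']
      by (simp add: eta_eval)
  qed
  moreover have "ind_at Q w (eta_tm \<cdot> m) ps"
    unfolding ind_at_def bar_at_def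
  proof (intro allI impI)
    fix w' a assume w': "w \<le> w'" and a: "typed w' a N"
      and H: "\<forall>w'' \<ge> w'. \<forall>b v. typed w'' b N \<longrightarrow> typed w'' v N \<longrightarrow>
        app w'' (val w'' (eta_tm \<cdot> m)) (cat w'' (val w'' a) (val w'' b)) = sc w'' (val w'' v) \<longrightarrow>
        satl w'' (append_tm \<cdot> a \<cdot> b # ps) Q"
    have "satl w' (append_tm \<cdot> a \<cdot> Zero # ps) Q"
      using H[rule_format, of w' Zero m] a typeof_mono[OF m w'] by (simp add: eta_eval)
    then show "satl w' (a # ps) Q"
      by (rule Q_cong[OF tyl_mono[OF ps w'], rotated 2]) (use a in simp_all)
  qed
  ultimately show ?thesis
    using assms by (subst satl_base_fm) simp_all
qed

text \<open>Where \<open>g\<close> returns \<open>m\<close>, it keeps doing so above by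
  monotonicity, and there the bind agrees with \<open>h \<cdot> m\<close>. Above such a node the bar
  of the bind is thus the bar of \<open>h \<cdot> m\<close>, whose induction gives \<open>Q\<close>
  at the node. So \<open>Q\<close> holds on the bar of \<open>g\<close>, and the induction for
  \<open>g\<close> brings it down to \<open>a\<close>.\<close>

lemma base_bind:
  assumes k: "typed w k (N \<leadsto> N)" and h: "typed w h (N \<leadsto> N \<leadsto> N)"
    and n: "typed w n N" and g: "typed w g (N \<leadsto> N)"
    and \<alpha>: "typed w \<alpha> (N \<leadsto> N)" and ps: "tyl w ps \<Gamma>"
    and kh: "\<And>w' m. w \<le> w' \<Longrightarrow> typed w' m N \<Longrightarrow> satl w' (k \<cdot> m # h \<cdot> m # \<alpha> # ps) (base_fm Q)"
    and ng: "satl w (n # g # \<alpha> # ps) (base_fm Q)"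
  shows "satl w (k \<cdot> n # bind_tm \<cdot> h \<cdot> g # \<alpha> # ps) (base_fm Q)"
proof -
  note ty = k[THEN typeof_mono] h[THEN typeof_mono] n[THEN typeof_mono] g[THEN typeof_mono]
    \<alpha>[THEN typeof_mono] tyl_mono[OF ps]
  have G: "mono_at w g" "sound_at w n g \<alpha>" "ind_at Q w g ps"
    using ng satl_base_fm[OF n g \<alpha> ps] by simp_all
  have H: "mono_at w' (h \<cdot> m)" "sound_at w' (k \<cdot> m) (h \<cdot> m) \<alpha>" "ind_at Q w' (h \<cdot> m) ps"
    if w': "w \<le> w'" and m: "typed w' m N" for w' m
    using kh[OF that] satl_base_fm[of w' "k \<cdot> m" "h \<cdot> m" \<alpha> ps] ty[OF w'] m by simp_all
  have ev0: "app w' (val w' (bind_tm \<cdot> h \<cdot> g)) A = zr w'"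
    if "w \<le> w'" "tyw w' A = Some N" "app w' (val w' g) A = zr w'" for w' A
    using that ty[OF that(1)] by (simp add: bind_eval)
  have evS: "app w' (val w' (bind_tm \<cdot> h \<cdot> g)) A = app w' (val w' (h \<cdot> m)) A"
    if "w \<le> w'" "tyw w' A = Some N" "typed w' m N" "app w' (val w' g) A = sc w' (val w' m)" for w' A m
    using that ty[OF that(1)] by (simp add: bind_eval(2)[where M="val w' m"])
  have "mono_at w (bind_tm \<cdot> h \<cdot> g)"
    unfolding mono_at_def
  proof (intro allI impI)
    fix w' a v b
    assume w': "w \<le> w'" and a: "typed w' a N" and v: "typed w' v N"
      and b: "typed w' b N"
      and eq: "app w' (val w' (bind_tm \<cdot> h \<cdot> g)) (val w' a) = sc w' (val w' v)"
    \<comment> \<open>Whether \<open>g\<close> is positive at \<open>a\<close> has to be decided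
      inside HA. If it is zero, the bind would be zero too, against \<open>eq\<close>, and the world
      is inconsistent.\<close>
    have "val w' (bind_tm \<cdot> h \<cdot> g \<cdot> (append_tm \<cdot> a \<cdot> b)) = val w' (Succ \<cdot> v)"
    proof (rule val_cases[of w' "g \<cdot> a" _ N])
      fix w'' assume w'': "w' \<le> w''"
      note w02 = order_trans[OF w' w'']
      note ty' = a[THEN typeof_mono, OF w''] v[THEN typeof_mono, OF w''] b[THEN typeof_mono, OF w''] ty[OF w02]
      have "val w' (bind_tm \<cdot> h \<cdot> g \<cdot> a) = val w' (Succ \<cdot> v)" using eq by simp
      from val_mono[OF this _ w'', of N] have eq': "app w'' (val w'' (bind_tm \<cdot> h \<cdot> g)) (val w'' a) = sc w'' (val w'' v)"
        using ty[OF w'] a by simp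
      {
        assume "val w'' (g \<cdot> a) = zr w''"
        then have "sc w'' (val w'' v) = zr w''" using eq' ev0[OF w02, of "val w'' a"] ty' by simp
        then show "val w'' (bind_tm \<cdot> h \<cdot> g \<cdot> (append_tm \<cdot> a \<cdot> b)) = val w'' (Succ \<cdot> v)"
          by (rule val_Succ_not_Zero_eq[where \<rho>=N]) (use ty' in simp_all)
      next
        fix m assume m: "typed w'' m N" and "val w'' (g \<cdot> a) = sc w'' (val w'' m)"
        then have ga: "app w'' (val w'' g) (val w'' a) = sc w'' (val w'' m)" by simp
        have "app w'' (val w'' (h \<cdot> m)) (val w'' a) = sc w'' (val w'' v)"
          using eq' evS[OF w02 _ m ga] ty' by simp
        then have "app w'' (val w'' (h \<cdot> m)) (cat w'' (val w'' a) (val w'' b)) = sc w'' (val w'' v)"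
          using H(1)[OF w02 m] ty' unfolding mono_at_def by blast
        moreover have "app w'' (val w'' g) (cat w'' (val w'' a) (val w'' b)) = sc w'' (val w'' m)"
          using G(1) ga ty' m w02 unfolding mono_at_def by blast
        ultimately show "val w'' (bind_tm \<cdot> h \<cdot> g \<cdot> (append_tm \<cdot> a \<cdot> b)) = val w'' (Succ \<cdot> v)"
          using evS[OF w02 _ m, of "cat w'' (val w'' a) (val w'' b)"] ty' by simp
      }
    qed (use ty[OF w'] a b v in simp_all)
    then show "app w' (val w' (bind_tm \<cdot> h \<cdot> g)) (cat w' (val w' a) (val w' b)) = sc w' (val w' v)" by simp
  qed
  moreover have "sound_at w (k \<cdot> n) (bind_tm \<cdot> h \<cdot> g) \<alpha>"
    unfolding sound_at_def
  proof (intro allI impI)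
    fix w' j v
    assume w': "w \<le> w'" and j: "typed w' j N" and v: "typed w' v N"
      and eq: "app w' (val w' (bind_tm \<cdot> h \<cdot> g)) (sg w' (val w' \<alpha>) (val w' j)) = sc w' (val w' v)"
    show "val w' (k \<cdot> n) = val w' v"
    proof (rule val_cases[of w' "g \<cdot> (seg_tm \<cdot> \<alpha> \<cdot> j)" _ N])
      fix w'' assume w'': "w' \<le> w''"
      note w02 = order_trans[OF w' w'']
      note ty' = j[THEN typeof_mono, OF w''] v[THEN typeof_mono, OF w''] ty[OF w02]
      have "val w' (bind_tm \<cdot> h \<cdot> g \<cdot> (seg_tm \<cdot> \<alpha> \<cdot> j)) = val w' (Succ \<cdot> v)" using eq by simp
      from val_mono[OF this _ w'', of N]
      have eq': "app w'' (val w'' (bind_tm \<cdot> h \<cdot> g)) (sg w'' (val w'' \<alpha>) (val w'' j)) = sc w'' (val w'' v)"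
        using ty[OF w'] j by simp
      {
        assume "val w'' (g \<cdot> (seg_tm \<cdot> \<alpha> \<cdot> j)) = zr w''"
        then have "sc w'' (val w'' v) = zr w''"
          using eq' ev0[OF w02, of "sg w'' (val w'' \<alpha>) (val w'' j)"] ty' by simp
        then show "val w'' (k \<cdot> n) = val w'' v"
          by (rule val_Succ_not_Zero_eq[where \<rho>=N]) (use ty' in simp_all)
      next
        fix m assume m: "typed w'' m N" and "val w'' (g \<cdot> (seg_tm \<cdot> \<alpha> \<cdot> j)) = sc w'' (val w'' m)"
        then have gm: "app w'' (val w'' g) (sg w'' (val w'' \<alpha>) (val w'' j)) = sc w'' (val w'' m)" by simp
        have "app w'' (val w'' (h \<cdot> m)) (sg w'' (val w'' \<alpha>) (val w'' j)) = sc w'' (val w'' v)"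
          using eq' evS[OF w02 _ m gm] ty' by simp
        then have "val w'' (k \<cdot> m) = val w'' v"
          using H(2)[OF w02 m] ty' unfolding sound_at_def by blast
        moreover have "val w'' n = val w'' m"
          using G(2) gm ty' m w02 unfolding sound_at_def by blast
        ultimately show "val w'' (k \<cdot> n) = val w'' v" by simp
      }
    qed (use ty[OF w'] j v in simp_all)
  qed
  moreover have "ind_at Q w (bind_tm \<cdot> h \<cdot> g) ps"
    unfolding ind_at_def
  proof (intro allI impI)
    fix w' a assume w': "w \<le> w'" and a: "typed w' a N" and bar: "bar_at Q w' (bind_tm \<cdot> h \<cdot> g) ps a"
    have "bar_at Q w' g ps a"
      unfolding bar_at_def
    proof (intro allI impI)
      fix w'' b m
      assume w'': "w' \<le> w''" and b: "typed w'' b N" and m: "typed w'' m N"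
        and gm: "app w'' (val w'' g) (cat w'' (val w'' a) (val w'' b)) = sc w'' (val w'' m)"
      note w02 = order_trans[OF w' w'']
      have "bar_at Q w'' (h \<cdot> m) ps (append_tm \<cdot> a \<cdot> b)"
        unfolding bar_at_def
      proof (intro allI impI)
        fix w3 c v
        assume w3: "w'' \<le> w3" and c: "typed w3 c N" and v: "typed w3 v N"
          and hv: "app w3 (val w3 (h \<cdot> m)) (cat w3 (val w3 (append_tm \<cdot> a \<cdot> b)) (val w3 c)) = sc w3 (val w3 v)"
        note w03 = order_trans[OF w02 w3]
        note ty' = typeof_mono[OF a order_trans[OF w'' w3]] b[THEN typeof_mono, OF w3] m[THEN typeof_mono, OF w3]
          c v ty[OF w03]
        have "val w'' (g \<cdot> (append_tm \<cdot> a \<cdot> b)) = val w'' (Succ \<cdot> m)" using gm by simp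
        from val_mono[OF this _ w3, of N]
        have "app w3 (val w3 g) (val w3 (append_tm \<cdot> a \<cdot> b)) = sc w3 (val w3 m)"
          using ty[OF w02] typeof_mono[OF a w''] b by simp
        moreover have "typed w3 (append_tm \<cdot> a \<cdot> b) N" using ty' by simp
        ultimately have "app w3 (val w3 g) (cat w3 (val w3 (append_tm \<cdot> a \<cdot> b)) (val w3 c)) = sc w3 (val w3 m)"
          using G(1) ty' w03 unfolding mono_at_def by blast
        then have "app w3 (val w3 (bind_tm \<cdot> h \<cdot> g)) (cat w3 (val w3 (append_tm \<cdot> a \<cdot> b)) (val w3 c)) = sc w3 (val w3 v)"
          using evS[OF w03 _ _, of "cat w3 (val w3 (append_tm \<cdot> a \<cdot> b)) (val w3 c)" m] hv ty' by simp
        then have "app w3 (val w3 (bind_tm \<cdot> h \<cdot> g)) (cat w3 (val w3 a) (val w3 (append_tm \<cdot> b \<cdot> c))) = sc w3 (val w3 v)"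
          using append_assoc[of w3 "val w3 a" "val w3 b" "val w3 c"] ty' by simp
        moreover have "typed w3 (append_tm \<cdot> b \<cdot> c) N" using ty' by simp
        ultimately have "satl w3 (append_tm \<cdot> a \<cdot> (append_tm \<cdot> b \<cdot> c) # ps) Q"
          using bar order_trans[OF w'' w3] v unfolding bar_at_def by blast
        then show "satl w3 (append_tm \<cdot> (append_tm \<cdot> a \<cdot> b) \<cdot> c # ps) Q"
          by (rule Q_cong[OF ty(6)[OF w03], rotated 2]) (use ty' in \<open>simp_all add: append_assoc\<close>)
      qed
      moreover have "typed w'' (append_tm \<cdot> a \<cdot> b) N" using typeof_mono[OF a w''] b by simp
      ultimately show "satl w'' (append_tm \<cdot> a \<cdot> b # ps) Q"
        using H(3)[OF w02 m] unfolding ind_at_def by blast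
    qed
    then show "satl w' (a # ps) Q"
      using G(3) w' a unfolding ind_at_def by blast
  qed
  ultimately show ?thesis
    using ty[OF order_refl] by (subst satl_base_fm) simp_all
qed

lemma progressive_mono: "progressive Q w ps \<Longrightarrow> w \<le> w' \<Longrightarrow> progressive Q w' ps"
  unfolding progressive_def using order_trans by blast

text \<open>Every node \<open>a * \<langle>n\<rangle>\<close> has a first entry, either one that
  \<open>a\<close> already had or \<open>n\<close>. It lies in the bar, so a single use of
  progressiveness gives \<open>Q\<close> at \<open>a\<close>.\<close>

lemma ind_at_generic_Zero:
  assumes prog: "progressive Q w ps" and ps: "tyl w ps \<Gamma>"
  shows "ind_at Q w (generic_tm \<cdot> Zero) ps"
  unfolding ind_at_def
proof (intro allI impI)
  fix w' a assume w': "w \<le> w'" and a: "typed w' a N" and bar: "bar_at Q w' (generic_tm \<cdot> Zero) ps a"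
  have "satl w'' (append_tm \<cdot> a \<cdot> (single_tm \<cdot> n) # ps) Q"
    if w'': "w' \<le> w''" and n: "typed w'' n N" for w'' n
  proof (rule satl_cases[of w'' "lookup_tm \<cdot> a \<cdot> Zero"])
    note a' = typeof_mono[OF a w'']
    show "typed w'' (lookup_tm \<cdot> a \<cdot> Zero) N" using a' by simp
    show "tyl w'' (append_tm \<cdot> a \<cdot> (single_tm \<cdot> n) # ps) (N # \<Gamma>)"
      using a' n tyl_mono[OF ps order_trans[OF w' w'']] by simp
    fix w3 assume w3: "w'' \<le> w3"
    note a'' = typeof_mono[OF a' w3] and n' = typeof_mono[OF n w3]
    have s: "satl w3 (append_tm \<cdot> a \<cdot> (single_tm \<cdot> n) # ps) Q"
      if "typed w3 v N" "lk w3 (snoc w3 (val w3 a) (val w3 n)) (zr w3) = sc w3 (val w3 v)" for v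
    proof -
      have "app w3 (val w3 (generic_tm \<cdot> Zero)) (cat w3 (val w3 a) (val w3 (single_tm \<cdot> n))) = sc w3 (val w3 v)"
        using that a'' n' by (simp add: generic_eval)
      moreover have "typed w3 (single_tm \<cdot> n) N" using n' by simp
      ultimately show ?thesis
        using bar order_trans[OF w'' w3] that(1) unfolding bar_at_def by blast
    qed
    {
      assume "val w3 (lookup_tm \<cdot> a \<cdot> Zero) = zr w3"
      then show "satl w3 (append_tm \<cdot> a \<cdot> (single_tm \<cdot> n) # ps) Q"
        using a'' n' by (intro s[of n])
          (simp_all add: lookup_snoc lookup_step_simps(2)[where M="zr w3" and V="zr w3"])
    next
      fix v assume "typed w3 v N" "val w3 (lookup_tm \<cdot> a \<cdot> Zero) = sc w3 (val w3 v)"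
      then show "satl w3 (append_tm \<cdot> a \<cdot> (single_tm \<cdot> n) # ps) Q"
        using a'' n' by (intro s[of v])
          (simp_all add: lookup_snoc lookup_step_simps(1)[where V="val w3 v"])
    }
  qed (rule Q)
  then show "satl w' (a # ps) Q"
    using prog w' a unfolding progressive_def by blast
qed

text \<open>A one-step extension of a node with entry \<open>m\<close> has entry
  \<open>Succ m\<close>. By progressiveness \<open>Q\<close> then holds at all nodes above
  \<open>a\<close> with entry \<open>m\<close>, which is the bar for which induction is already
  available.\<close>

lemma ind_at_generic_Succ:
  assumes prog: "progressive Q w ps" and ps: "tyl w ps \<Gamma>" and m: "typed w m N"
    and IH: "ind_at Q w (generic_tm \<cdot> m) ps"
  shows "ind_at Q w (generic_tm \<cdot> (Succ \<cdot> m)) ps"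
  unfolding ind_at_def
proof (intro allI impI)
  fix w' a assume w': "w \<le> w'" and a: "typed w' a N"
    and bar: "bar_at Q w' (generic_tm \<cdot> (Succ \<cdot> m)) ps a"
  have "bar_at Q w' (generic_tm \<cdot> m) ps a"
    unfolding bar_at_def
  proof (intro allI impI)
    fix w'' b v
    assume w'': "w' \<le> w''" and b: "typed w'' b N" and v: "typed w'' v N"
      and eq: "app w'' (val w'' (generic_tm \<cdot> m)) (cat w'' (val w'' a) (val w'' b)) = sc w'' (val w'' v)"
    note w02 = order_trans[OF w' w'']
    note ty2 = typeof_mono[OF m w02] typeof_mono[OF a w''] b v
    let ?ab = "append_tm \<cdot> a \<cdot> b"
    have ab: "typed w'' ?ab N" using ty2 by simp
    have "satl w3 (append_tm \<cdot> ?ab \<cdot> (single_tm \<cdot> n) # ps) Q"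
      if w3: "w'' \<le> w3" and n: "typed w3 n N" for w3 n
    proof (rule satl_cases[of w3 "lookup_tm \<cdot> ?ab \<cdot> (Succ \<cdot> m)"])
      note ty3 = ty2[THEN typeof_mono, OF w3]
      show "typed w3 (lookup_tm \<cdot> ?ab \<cdot> (Succ \<cdot> m)) N" using ty3 by simp
      show "tyl w3 (append_tm \<cdot> ?ab \<cdot> (single_tm \<cdot> n) # ps) (N # \<Gamma>)"
        using ty3 n tyl_mono[OF ps order_trans[OF w02 w3]] by simp
      fix w4 assume w4: "w3 \<le> w4"
      note w24 = order_trans[OF w3 w4]
      note ty4 = ty2[THEN typeof_mono, OF w24] typeof_mono[OF n w4]
      have "val w'' (generic_tm \<cdot> m \<cdot> ?ab) = val w'' (Succ \<cdot> v)" using eq by simp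
      from val_mono[OF this _ w24, of N]
      have lkm: "lk w4 (cat w4 (val w4 a) (val w4 b)) (val w4 m) = sc w4 (val w4 v)"
        using ty2 ty4 by (simp add: generic_eval)
      have s: "satl w4 (append_tm \<cdot> ?ab \<cdot> (single_tm \<cdot> n) # ps) Q"
        if u: "typed w4 u N"
          "lk w4 (snoc w4 (cat w4 (val w4 a) (val w4 b)) (val w4 n)) (sc w4 (val w4 m)) = sc w4 (val w4 u)" for u
      proof -
        let ?bn = "append_tm \<cdot> b \<cdot> (single_tm \<cdot> n)"
        have "app w4 (val w4 (generic_tm \<cdot> (Succ \<cdot> m))) (cat w4 (val w4 a) (val w4 ?bn)) = sc w4 (val w4 u)"
          using u ty4 by (simp add: generic_eval)
        moreover have "typed w4 ?bn N" using ty4 by simp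
        ultimately have "satl w4 (append_tm \<cdot> a \<cdot> ?bn # ps) Q"
          using bar order_trans[OF w'' w24] u(1) unfolding bar_at_def by blast
        then show ?thesis
          by (rule Q_cong[OF tyl_mono[OF ps order_trans[OF w02 w24]], rotated 2]) (use ty4 in simp_all)
      qed
      {
        assume "val w4 (lookup_tm \<cdot> ?ab \<cdot> (Succ \<cdot> m)) = zr w4"
        then show "satl w4 (append_tm \<cdot> ?ab \<cdot> (single_tm \<cdot> n) # ps) Q"
          using ty4 lkm by (intro s[of n])
            (simp_all add: lookup_snoc lookup_step_simps(4)[where V="val w4 v"])
      next
        fix u assume "typed w4 u N" "val w4 (lookup_tm \<cdot> ?ab \<cdot> (Succ \<cdot> m)) = sc w4 (val w4 u)"
        then show "satl w4 (append_tm \<cdot> ?ab \<cdot> (single_tm \<cdot> n) # ps) Q"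
          using ty4 by (intro s[of u])
            (simp_all add: lookup_snoc lookup_step_simps(1)[where V="val w4 u"])
      }
    qed (rule Q)
    then show "satl w'' (?ab # ps) Q"
      using prog w02 ab unfolding progressive_def by blast
  qed
  then show "satl w' (a # ps) Q"
    using IH w' a unfolding ind_at_def by blast
qed

lemma base_generic:
  assumes \<alpha>: "typed w \<alpha> (N \<leadsto> N)" and ps: "tyl w ps \<Gamma>" and prog: "progressive Q w ps"
    and m: "typed w m N"
  shows "satl w (\<alpha> \<cdot> m # generic_tm \<cdot> m # \<alpha> # ps) (base_fm Q)"
proof -
  let ?\<tau> = "case_nat (Var 1 \<cdot> Var 0) (case_nat (generic_tm \<cdot> Var 0) (\<lambda>i. Var (i + 1)))"
  have mono: "mono_at w' (generic_tm \<cdot> n)" if "typed w' n N" for w' n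
    unfolding mono_at_def using typeof_mono[OF that] by (auto simp: generic_eval lookup_append)
  have sound: "sound_at w' (\<alpha> \<cdot> n) (generic_tm \<cdot> n) \<alpha>" if w': "w \<le> w'" and n: "typed w' n N" for w' n
    unfolding sound_at_def
  proof (intro allI impI)
    fix w'' j v assume w'': "w' \<le> w''" and "typed w'' j N" "typed w'' v N"
      and "app w'' (val w'' (generic_tm \<cdot> n)) (sg w'' (val w'' \<alpha>) (val w'' j)) = sc w'' (val w'' v)"
    then show "val w'' (\<alpha> \<cdot> n) = val w'' v"
      using lookup_seg_sound[of w'' "val w'' \<alpha>" "val w'' j" "val w'' n" "val w'' v"]
        typeof_mono[OF \<alpha> order_trans[OF w' w'']] typeof_mono[OF n w'']
      by (simp add: generic_eval)
  qed
  \<comment> \<open>Monotonicity and soundness hold outright. The induction in HA, which requires a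
    formula, can thus be run on \<open>base_fm\<close> while only \<open>ind_at\<close> is at
    stake.\<close>
  have base: "satl w' (\<alpha> \<cdot> n # generic_tm \<cdot> n # \<alpha> # ps) (base_fm Q) \<longleftrightarrow> ind_at Q w' (generic_tm \<cdot> n) ps"
    if "w \<le> w'" "typed w' n N" for w' n
    using mono[OF that(2)] sound[OF that] typeof_mono[OF \<alpha> that(1)] tyl_mono[OF ps that(1)] that(2)
    by (subst satl_base_fm) simp_all
  have A: "satl w' (n # \<alpha> # ps) (fsub ?\<tau> (base_fm Q)) \<longleftrightarrow>
    satl w' (\<alpha> \<cdot> n # generic_tm \<cdot> n # \<alpha> # ps) (base_fm Q)" for w' n
    by (rule satl_fsub[OF wff_base_fm]) (simp add: nth_Cons split: nat.split)
  have "satl w (m # \<alpha> # ps) (fsub ?\<tau> (base_fm Q))"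
  proof (rule satl_induct[of _ _ "(N \<leadsto> N) # \<Gamma>"])
    show "tyl w (\<alpha> # ps) ((N \<leadsto> N) # \<Gamma>)" using \<alpha> ps by simp
    show "wff (N # (N \<leadsto> N) # \<Gamma>) (fsub ?\<tau> (base_fm Q))"
      by (rule wff_fsub[OF wff_base_fm]) (auto simp: tysub_def nth_Cons split: nat.split)
    show "satl w (Zero # \<alpha> # ps) (fsub ?\<tau> (base_fm Q))"
      unfolding A by (subst base) (use ind_at_generic_Zero[OF prog ps] in simp_all)
    fix w' n assume w': "w \<le> w'" and n: "typed w' n N"
      and "satl w' (n # \<alpha> # ps) (fsub ?\<tau> (base_fm Q))"
    then have "ind_at Q w' (generic_tm \<cdot> n) ps" unfolding A by (subst (asm) base) simp_all
    then have "ind_at Q w' (generic_tm \<cdot> (Succ \<cdot> n)) ps"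
      by (rule ind_at_generic_Succ[OF progressive_mono[OF prog w'] tyl_mono[OF ps w'] n])
    then show "satl w' (Succ \<cdot> n # \<alpha> # ps) (fsub ?\<tau> (base_fm Q))"
      unfolding A by (subst base) (use w' n in simp_all)
  qed (rule m)
  then show ?thesis by (simp only: A)
qed

text \<open>The sequence \<open>\<alpha>\<close> is related to the generic one: for plain positions
  by \<open>base_generic\<close>, for computed ones by \<open>rel_ke\<close>. The fundamental lemma
  for the closed term \<open>Y\<close> then applies.\<close>

lemma base_gam:
  assumes Y: "typeof [] Y = Some ((N \<leadsto> N) \<leadsto> N)"
    and \<alpha>: "typed w \<alpha> (N \<leadsto> N)" and ps: "tyl w ps \<Gamma>" and prog: "progressive Q w ps"
  shows "satl w (Y \<cdot> \<alpha> # gam Y # \<alpha> # ps) (base_fm Q)"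
proof -
  interpret logical_relation w "base_fm Q" "\<alpha> # ps" "(N \<leadsto> N) # \<Gamma>"
  proof
    show "tyl w (\<alpha> # ps) ((N \<leadsto> N) # \<Gamma>)" using \<alpha> ps by simp
    show "wff (N # (N \<leadsto> N) # (N \<leadsto> N) # \<Gamma>) (base_fm Q)" by (rule wff_base_fm)
    show "satl w' (m # eta_tm \<cdot> m # \<alpha> # ps) (base_fm Q)"
      if "w \<le> w'" "typed w' m N" for w' m
      by (rule base_eta[OF that(2) typeof_mono[OF \<alpha> that(1)] tyl_mono[OF ps that(1)]])
    show "satl w' (k \<cdot> n # bind_tm \<cdot> h \<cdot> g # \<alpha> # ps) (base_fm Q)"
      if "w \<le> w'" "typed w' k (N \<leadsto> N)" "typed w' h (N \<leadsto> N \<leadsto> N)"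
        "typed w' n N" "typed w' g (N \<leadsto> N)"
        "\<And>w'' m. w' \<le> w'' \<Longrightarrow> typed w'' m N \<Longrightarrow> satl w'' (k \<cdot> m # h \<cdot> m # \<alpha> # ps) (base_fm Q)"
        "satl w' (n # g # \<alpha> # ps) (base_fm Q)" for w' k h n g
      using base_bind[OF that(2-5) typeof_mono[OF \<alpha> that(1)] tyl_mono[OF ps that(1)] that(6,7)] .
  qed
  have "rel w ((N \<leadsto> N) \<leadsto> N) (sub ((!) []) Y) (sub ((!) []) (tr Y))"
    by (rule fundamental[OF Y]) simp_all
  moreover have trY: "typeof [] (tr Y) = Some (((N \<leadsto> N) \<leadsto> N \<leadsto> N) \<leadsto> N \<leadsto> N)"
    using tr_type[OF Y] by simp
  ultimately have relY: "rel w ((N \<leadsto> N) \<leadsto> N) Y (tr Y)"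
    by (simp add: sub_closed[OF Y] sub_closed)
  have relG: "rel w (N \<leadsto> N) \<alpha> (bind_tm \<cdot> generic_tm)"
  proof (subst rel_Fn[OF order_refl \<alpha>], simp, intro allI impI)
    fix w' x y assume w': "w \<le> w'" and "typed w' x N" "typed w' y (bty N)" "rel w' N x y"
    moreover have "rel w'' N (\<alpha> \<cdot> m) (generic_tm \<cdot> m)" if "w' \<le> w''" "typed w'' m N" for w'' m
    proof -
      note w02 = order_trans[OF w' that(1)]
      show ?thesis
        using base_generic[OF typeof_mono[OF \<alpha> w02] tyl_mono[OF ps w02] progressive_mono[OF prog w02] that(2)]
        by (simp add: rel_def)
    qed
    ultimately show "rel w' N (\<alpha> \<cdot> x) (bind_tm \<cdot> generic_tm \<cdot> y)"
      using rel_ke[OF w', of \<alpha> N generic_tm x y] typeof_mono[OF \<alpha> w'] by simp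
  qed
  have "rel w N (Y \<cdot> \<alpha>) (gam Y)"
    using relY relG \<alpha> typeof_closed[OF Y] typeof_closed[OF trY]
      rel_Fn[OF order_refl, of Y "N \<leadsto> N" N "tr Y"] unfolding gam_def by simp
  then show ?thesis by (simp add: rel_def)
qed

end

lemma gam_type: "typeof [] Y = Some ((N \<leadsto> N) \<leadsto> N) \<Longrightarrow> typeof [] (gam Y) = Some (N \<leadsto> N)"
  using tr_type[of "[]" Y "(N \<leadsto> N) \<leadsto> N"] by (simp add: gam_def)

section \<open>Bar induction\<close>

lemma satl_ExistsI:
  assumes "tyl w ts \<Gamma>" "wff (\<rho> # \<Gamma>) A" "typed w t \<rho>" "satl w (t # ts) A"
  shows "satl w ts (Exists \<rho> A)"
  using sat_ExistsI[OF tyl_tysub[OF assms(1)] assms(2,3)] assms(4) by (simp add: satl_def case_nat_nth)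

lemma satl_rule1:
  assumes "tyl w ts \<Gamma>" "wff (\<rho> # \<Gamma>) A" "wff (\<rho> # \<Gamma>) B"
  shows "satl w ts (Forall \<rho> (A \<^bold>\<longrightarrow> B)) \<longleftrightarrow>
    (\<forall>w' \<ge> w. \<forall>a. typed w' a \<rho> \<longrightarrow> satl w' (a # ts) A \<longrightarrow> satl w' (a # ts) B)"
  using satl_rule[OF assms(1), of "[\<rho>]" A B] assms(2,3) unfolding all_tyl by simp

lemma satl_rule2:
  assumes "tyl w ts \<Gamma>" "wff (\<rho> # \<sigma> # \<Gamma>) A" "wff (\<rho> # \<sigma> # \<Gamma>) B"
  shows "satl w ts (Forall \<sigma> (Forall \<rho> (A \<^bold>\<longrightarrow> B))) \<longleftrightarrow>
    (\<forall>w' \<ge> w. \<forall>a b. typed w' a \<rho> \<longrightarrow> typed w' b \<sigma> \<longrightarrow>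
      satl w' (a # b # ts) A \<longrightarrow> satl w' (a # b # ts) B)"
  using satl_rule[OF assms(1), of "[\<rho>, \<sigma>]" A B] assms(2,3) unfolding all_tyl by simp blast

lemma den_lift:
  assumes "typeof \<Gamma> t = Some \<rho>" "length E = length \<Gamma>"
  shows "den w (X # E) (lift t) = den w E t"
  unfolding den_def sub_ren
  by (rule arg_cong[where f="val w"], rule sub_cong_typed[OF assms(1)]) (simp add: assms(2))

lemma wff_less_Zero: "typeof \<Gamma> t = Some N \<Longrightarrow> wff \<Gamma> (less_fm Zero t)"
  by (simp add: less_fm_def has_type_iff typeof_lift)

text \<open>The predecessor of \<open>t\<close> is a definable witness of positivity, so the
  existential can be exchanged for an equation.\<close>

lemma satl_less_Zero:
  assumes l: "tyl w ts \<Gamma>" and t: "typeof \<Gamma> t = Some N"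
  shows "satl w ts (less_fm Zero t) \<longleftrightarrow>
    den w (map (val w) ts) t = sc w (pd w (den w (map (val w) ts) t))"
proof
  let ?B = "Eq N (plus_tm \<cdot> lift Zero \<cdot> (Succ \<cdot> Var 0)) (lift t)"
  have len: "length ts = length \<Gamma>" using map_eq_imp_length_eq[OF l] .
  have tyt: "tyw w' (den w' (map (val w') ts) t) = Some N" if "w \<le> w'" for w'
    using tyl_mono[OF l that] t by (simp add: tyw_den tyl_tyE tyl_tys)
  have B: "satl w' (u # ts) ?B \<longleftrightarrow> sc w' (val w' u) = den w' (map (val w') ts) t"
    if "w \<le> w'" "typed w' u N" for w' u
  proof -
    have l': "tyl w' (u # ts) (N # \<Gamma>)" using tyl_mono[OF l that(1)] that(2) by simp
    show ?thesis
      using that(2) tyl_tyE[OF l']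
      by (subst satl_Eq[OF l']) (simp_all add: t typeof_lift den_lift[OF t] len)
  qed
  {
    assume *: "satl w ts (less_fm Zero t)"
    have "satl w ts (Eq N t (Succ \<cdot> (pred_tm \<cdot> t)))"
      unfolding satl_def
    proof (rule sat_ExistsE)
      show "sat w ((!) ts) (Exists N ?B)" using * by (simp add: less_fm_def satl_def)
      show "wff (ctx w) (fsub ((!) ts) (Eq N t (Succ \<cdot> (pred_tm \<cdot> t))))"
        by (rule wff_fsub[OF _ tyl_tysub[OF l]]) (simp add: has_type_iff t)
      fix w' u assume w': "w \<le> w'" "typed w' u N" "sat w' (case_nat u ((!) ts)) ?B"
      then have "sc w' (val w' u) = den w' (map (val w') ts) t"
        using B[OF w'(1,2)] by (simp add: satl_def case_nat_nth)
      from this[symmetric] show "sat w' ((!) ts) (Eq N t (Succ \<cdot> (pred_tm \<cdot> t)))"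
        using w'(2) satl_Eq[OF tyl_mono[OF l w'(1)] t, of "Succ \<cdot> (pred_tm \<cdot> t)"] t by (simp add: satl_def)
    qed
    then show "den w (map (val w) ts) t = sc w (pd w (den w (map (val w) ts) t))"
      using satl_Eq[OF l t, of "Succ \<cdot> (pred_tm \<cdot> t)"] t by simp
  next
    assume *: "den w (map (val w) ts) t = sc w (pd w (den w (map (val w) ts) t))"
    let ?u = "sub ((!) ts) (pred_tm \<cdot> t)"
    have u: "typed w ?u N"
      by (rule typeof_sub[OF _ tyl_tysub[OF l]]) (simp add: t)
    have "val w ?u = den w (map (val w) ts) (pred_tm \<cdot> t)"
      by (rule val_sub[OF l]) (simp add: t)
    then have "satl w (?u # ts) ?B" using B[OF order_refl u] * by simp
    then show "satl w ts (less_fm Zero t)"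
      unfolding less_fm_def by (intro satl_ExistsI[OF l _ u]) (simp_all add: has_type_iff typeof_lift t)
  }
qed

lemma satl_at_snoc:
  assumes "wff (N # \<Gamma>) Q"
  shows "satl w (n # a # ps) (at_snoc Q) \<longleftrightarrow> satl w (append_tm \<cdot> a \<cdot> (single_tm \<cdot> n) # ps) Q"
  unfolding at_snoc_def by (rule satl_fsub[OF assms]) (simp add: nth_Cons split: nat.split)

lemma wff_at_snoc: "wff (N # \<Gamma>) Q \<Longrightarrow> wff (N # N # \<Gamma>) (at_snoc Q)"
  unfolding at_snoc_def
  by (rule wff_fsub) (auto simp: tysub_def nth_Cons split: nat.split)

text \<open>The way back from the model: under the identity assignment, satisfaction is
  derivability.\<close>

lemma satl_vars:
  assumes "wff (ctx w) A"
  shows "satl w (map Var [0..<length (ctx w)]) A \<longleftrightarrow> prv w A"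
proof -
  have "fsub ((!) (map Var [0..<length (ctx w)])) A = fsub Var A"
    by (rule fsub_cong_wff[OF assms]) simp
  then show ?thesis by (simp add: satl_def sat_def fsub_Var)
qed

lemma tyl_vars: "tyl w (map Var [0..<length (ctx w)]) (ctx w)"
  by (rule nth_equalityI) simp_all

section \<open>Bar induction and the neighbourhood property for \<open>gam Y\<close>\<close>

context
  fixes Y :: tm
  assumes Y: "typeof [] Y = Some ((N \<leadsto> N) \<leadsto> N)"
begin

lemmas gam_simps [simp] = gam_type[OF Y, THEN typeof_closed] gam_type[OF Y, THEN den_closed]
  gam_type[OF Y, THEN sub_closed]
lemmas Y_simps [simp] = Y[THEN typeof_closed] Y[THEN den_closed] Y[THEN sub_closed]

lemma gam_props:
  assumes Q: "wff (N # \<Gamma>) Q" and \<alpha>: "typed w \<alpha> (N \<leadsto> N)" and ps: "tyl w ps \<Gamma>"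
    and prog: "progressive Q w ps"
  shows "mono_at w (gam Y)" "sound_at w (Y \<cdot> \<alpha>) (gam Y) \<alpha>" "ind_at Q w (gam Y) ps"
  using base_gam[OF Q Y \<alpha> ps prog] satl_base_fm[OF Q, of w "Y \<cdot> \<alpha>" "gam Y" \<alpha> ps] \<alpha> ps by simp_all

lemma ind_gam:
  assumes Q: "wff (N # \<Gamma>) Q" and ps: "tyl w ps \<Gamma>" and prog: "progressive Q w ps"
    and bar: "\<And>w' a m. w \<le> w' \<Longrightarrow> typed w' a N \<Longrightarrow> typed w' m N \<Longrightarrow>
      app w' (val w' (gam Y)) (val w' a) = sc w' (val w' m) \<Longrightarrow> satl w' (a # ps) Q"
  shows "satl w (Zero # ps) Q"
proof -
  have "bar_at Q w (gam Y) ps Zero"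
    unfolding bar_at_def
  proof (intro allI impI)
    fix w' b m assume "w \<le> w'" "typed w' b N" "typed w' m N"
      "app w' (val w' (gam Y)) (cat w' (val w' Zero) (val w' b)) = sc w' (val w' m)"
    then show "satl w' (append_tm \<cdot> Zero \<cdot> b # ps) Q"
      by (intro bar[of w' _ m]) simp_all
  qed
  \<comment> \<open>The relation is indexed by a sequence, but \<open>ind_at\<close> does not
    mention it; the zero sequence will do.\<close>
  moreover have "typed w (Lam N Zero) (N \<leadsto> N)" by simp
  ultimately show ?thesis
    using gam_props(3)[OF Q _ ps prog] unfolding ind_at_def by (metis order_refl typeof.simps(2))
qed

lemma HA_bar_ind:
  assumes Q: "wff (N # \<Gamma>) Q"
  shows "HA \<Gamma> [] (bar_ind (gam Y) Q)"
proof -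
  obtain w where w: "ctx w = \<Gamma>" "hyp w = []" using ex_world[of "[]" \<Gamma>] by auto
  let ?ps = "map Var [0..<length \<Gamma>]"
  let ?L = "less_fm Zero (gam Y \<cdot> Var 0)"
  let ?A = "Forall N (?L \<^bold>\<longrightarrow> Q)" and ?B = "Forall N (Forall N (at_snoc Q) \<^bold>\<longrightarrow> Q)"
  have ps: "tyl w ?ps \<Gamma>" using tyl_vars[of w] w by simp
  have wf: "wff (N # \<Gamma>) ?L" by (rule wff_less_Zero) simp
  have wfC: "wff \<Gamma> (fsub (inst nil_tm) Q)" by (rule wff_fsub[OF Q tysub_inst]) simp
  have "satl w ?ps (?A \<^bold>\<and> ?B \<^bold>\<longrightarrow> fsub (inst nil_tm) Q)"
  proof (subst satl_Imp[OF ps], simp add: wf Q wff_at_snoc, intro allI impI)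
    fix w1 assume w1: "w \<le> w1" and "satl w1 ?ps (?A \<^bold>\<and> ?B)"
    then have AB: "satl w1 ?ps ?A" "satl w1 ?ps ?B" by (simp_all add: satl_Conj)
    note ps1 = tyl_mono[OF ps w1]
    have A: "satl w' (a # ?ps) ?L \<Longrightarrow> satl w' (a # ?ps) Q" if "w1 \<le> w'" "typed w' a N" for w' a
      using satl_rule1[OF ps1 wf Q] AB(1) that by blast
    have B: "satl w' (a # ?ps) (Forall N (at_snoc Q)) \<Longrightarrow> satl w' (a # ?ps) Q"
      if "w1 \<le> w'" "typed w' a N" for w' a
      using satl_rule1[OF ps1, of N "Forall N (at_snoc Q)" Q] AB(2) wff_at_snoc[OF Q] Q that
      by simp
    have "satl w1 (Zero # ?ps) Q"
    proof (rule ind_gam[OF Q ps1])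
      show "progressive Q w1 ?ps"
        unfolding progressive_def
      proof (intro allI impI)
        fix w' a
        assume w': "w1 \<le> w'" "typed w' a N"
          and *: "\<forall>w'' \<ge> w'. \<forall>n. typed w'' n N \<longrightarrow>
            satl w'' (append_tm \<cdot> a \<cdot> (single_tm \<cdot> n) # ?ps) Q"
        have "tyl w' (a # ?ps) (N # \<Gamma>)" using w' tyl_mono[OF ps1 w'(1)] by simp
        from satl_Forall[OF this wff_at_snoc[OF Q]] have "satl w' (a # ?ps) (Forall N (at_snoc Q))"
          using * by (simp add: satl_at_snoc[OF Q])
        then show "satl w' (a # ?ps) Q" by (rule B[OF w'])
      qed
      fix w' a m
      assume w': "w1 \<le> w'" and a: "typed w' a N" and m: "typed w' m N"
        and eq: "app w' (val w' (gam Y)) (val w' a) = sc w' (val w' m)"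
      have l: "tyl w' (a # ?ps) (N # \<Gamma>)" using a tyl_mono[OF ps1 w'] by simp
      have "satl w' (a # ?ps) ?L"
        using eq m tyl_tyE[OF l] by (subst satl_less_Zero[OF l]) simp_all
      then show "satl w' (a # ?ps) Q" by (rule A[OF w' a])
    qed
    moreover have "satl w1 ?ps (fsub (inst nil_tm) Q) \<longleftrightarrow> satl w1 (Zero # ?ps) Q"
      by (rule satl_fsub[OF Q]) (simp add: inst_def nth_Cons nil_tm_def split: nat.split)
    ultimately show "satl w1 ?ps (fsub (inst nil_tm) Q)" by simp
  qed
  then have "prv w (?A \<^bold>\<and> ?B \<^bold>\<longrightarrow> fsub (inst nil_tm) Q)"
    using satl_vars[of w] w wf Q wfC wff_at_snoc[OF Q] by simp
  then show ?thesis by (simp add: prv_def w bar_ind_def)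
qed

text \<open>The formula for the bar induction is
  \<open>\<forall>n. a = seg \<alpha> n \<longrightarrow> E\<close>, where \<open>E\<close> is the
  goal and does not depend on \<open>a\<close>. Where \<open>gam Y\<close> is positive at
  \<open>a\<close>, the length \<open>n\<close> is a witness for \<open>E\<close>.\<close>

lemma satl_gam_positive:
  assumes \<alpha>: "typed w \<alpha> (N \<leadsto> N)"
  shows "satl w [\<alpha>] (Exists N (less_fm Zero (gam Y \<cdot> (seg_tm \<cdot> Var 1 \<cdot> Var 0))))" (is "satl w _ ?E")
proof -
  let ?L = "less_fm Zero (gam Y \<cdot> (seg_tm \<cdot> Var 1 \<cdot> Var 0))"
  let ?A = "Eq N (Var 1) (seg_tm \<cdot> Var 2 \<cdot> Var 0)" and ?B = "fsub (\<lambda>i. Var (i + 2)) ?E"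
  let ?Q = "foralls [N] (?A \<^bold>\<longrightarrow> ?B)"
  have wL: "wff [N, N \<leadsto> N] ?L" by (rule wff_less_Zero) simp
  then have wE: "wff [N \<leadsto> N] ?E" by simp
  have wB: "wff [N, N, N \<leadsto> N] ?B"
    by (rule wff_fsub[OF wE]) (simp add: tysub_def)
  have B: "satl w' [n, a, \<alpha>] ?B \<longleftrightarrow> satl w' [\<alpha>] ?E" for w' n a
    by (rule satl_fsub[OF wE]) simp
  have Q: "wff [N, N \<leadsto> N] ?Q" using wB by (simp add: has_type_iff)
  have Qsem: "satl w' [a, \<alpha>] ?Q \<longleftrightarrow> (\<forall>w'' \<ge> w'. \<forall>n. typed w'' n N \<longrightarrow>
      val w'' a = sg w'' (val w'' \<alpha>) (val w'' n) \<longrightarrow> satl w'' [\<alpha>] ?E)"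
    if w': "w \<le> w'" and a: "typed w' a N" for w' a
  proof -
    have "satl w' [a, \<alpha>] ?Q \<longleftrightarrow> (\<forall>w'' \<ge> w'. \<forall>us. tyl w'' us [N] \<longrightarrow>
        satl w'' (us @ [a, \<alpha>]) ?A \<longrightarrow> satl w'' (us @ [a, \<alpha>]) ?B)"
      by (rule satl_rule[of _ _ "[N, N \<leadsto> N]"])
        (use a typeof_mono[OF \<alpha> w'] wB in \<open>simp_all add: has_type_iff\<close>)
    also have "\<dots> \<longleftrightarrow> (\<forall>w'' \<ge> w'. \<forall>n. tyl w'' [n] [N] \<longrightarrow>
        satl w'' ([n] @ [a, \<alpha>]) ?A \<longrightarrow> satl w'' ([n] @ [a, \<alpha>]) ?B)"
      by (simp only: all_tyl(1))
    also have "\<dots> \<longleftrightarrow> (\<forall>w'' \<ge> w'. \<forall>n. typed w'' n N \<longrightarrow>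
        val w'' a = sg w'' (val w'' \<alpha>) (val w'' n) \<longrightarrow> satl w'' [\<alpha>] ?E)"
    proof -
      have "satl w'' [n, a, \<alpha>] ?A \<longleftrightarrow> val w'' a = sg w'' (val w'' \<alpha>) (val w'' n)"
        if "w' \<le> w''" "typed w'' n N" for w'' n
        using that typeof_mono[OF a that(1)] typeof_mono[OF \<alpha> order_trans[OF w' that(1)]]
        by (subst satl_Eq[of _ _ "[N, N, N \<leadsto> N]"]) simp_all
      then show ?thesis using B by (auto 0 3)
    qed
    finally show ?thesis .
  qed
  have E: "satl w' [\<alpha>] ?E"
    if w': "w \<le> w'" and n: "typed w' n N" and m: "typed w' m N"
      and eq: "app w' (val w' (gam Y)) (sg w' (val w' \<alpha>) (val w' n)) = sc w' (val w' m)" for w' n m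
  proof (rule satl_ExistsI[OF _ wL n])
    show "tyl w' [\<alpha>] [N \<leadsto> N]" using typeof_mono[OF \<alpha> w'] by simp
    then show "satl w' [n, \<alpha>] ?L"
      using n m eq by (subst satl_less_Zero[of _ _ "[N, N \<leadsto> N]"]) simp_all
  qed
  have "satl w [Zero, \<alpha>] ?Q"
  proof (rule ind_gam[OF Q])
    show "tyl w [\<alpha>] [N \<leadsto> N]" using \<alpha> by simp
    show "progressive ?Q w [\<alpha>]"
      unfolding progressive_def
    proof (intro allI impI)
      fix w1 a
      assume w1: "w \<le> w1" and a: "typed w1 a N"
        and *: "\<forall>w2 \<ge> w1. \<forall>n. typed w2 n N \<longrightarrow> satl w2 [append_tm \<cdot> a \<cdot> (single_tm \<cdot> n), \<alpha>] ?Q"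
      show "satl w1 [a, \<alpha>] ?Q"
        unfolding Qsem[OF w1 a]
      proof (intro allI impI)
        fix w2 n
        assume w2: "w1 \<le> w2" and n: "typed w2 n N"
          and eq: "val w2 a = sg w2 (val w2 \<alpha>) (val w2 n)"
        note w02 = order_trans[OF w1 w2]
        note ty = typeof_mono[OF \<alpha> w02] typeof_mono[OF a w2] n
        \<comment> \<open>Among the one-step extensions of \<open>a\<close>, this is the one that
          stays on \<open>\<alpha>\<close>; it is the segment of length
          \<open>Succ n\<close>.\<close>
        let ?b = "append_tm \<cdot> a \<cdot> (single_tm \<cdot> (\<alpha> \<cdot> n))"
        have "satl w2 [?b, \<alpha>] ?Q" using *[rule_format, OF w2, of "\<alpha> \<cdot> n"] ty by simp
        moreover have b: "typed w2 ?b N" using ty by simp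
        moreover have "val w2 ?b = sg w2 (val w2 \<alpha>) (val w2 (Succ \<cdot> n))"
          using ty eq by simp
        ultimately show "satl w2 [\<alpha>] ?E"
          unfolding Qsem[OF w02 b] using n by (metis order_refl typeof.simps(3,5) apty.simps(1))
      qed
    qed
    fix w1 a m
    assume w1: "w \<le> w1" and a: "typed w1 a N" and m: "typed w1 m N"
      and eq: "app w1 (val w1 (gam Y)) (val w1 a) = sc w1 (val w1 m)"
    show "satl w1 [a, \<alpha>] ?Q"
      unfolding Qsem[OF w1 a]
    proof (intro allI impI)
      fix w2 n
      assume w2: "w1 \<le> w2" and n: "typed w2 n N"
        and seg: "val w2 a = sg w2 (val w2 \<alpha>) (val w2 n)"
      have "val w1 (gam Y \<cdot> a) = val w1 (Succ \<cdot> m)" using eq by simp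
      from val_mono[OF this _ w2, of N] have "app w2 (val w2 (gam Y)) (val w2 a) = sc w2 (val w2 m)"
        using a by simp
      then show "satl w2 [\<alpha>] ?E"
        using E[OF order_trans[OF w1 w2] n typeof_mono[OF m w2]] seg by simp
    qed
  qed
  \<comment> \<open>The empty sequence is the segment of length 0, which discharges the premise of
    the formula at the root.\<close>
  then have "\<forall>w' \<ge> w. \<forall>n. typed w' n N \<longrightarrow>
      val w' Zero = sg w' (val w' \<alpha>) (val w' n) \<longrightarrow> satl w' [\<alpha>] ?E"
    using Qsem[OF order_refl, of Zero] by simp
  from this[rule_format, of w Zero] show ?thesis using \<alpha> by simp
qed

lemma HA_nbhd_of: "HA [] [] (nbhd_of (gam Y) Y)"
proof -
  obtain w where w: "ctx w = []" "hyp w = []" using ex_world[of "[]" "[]"] by auto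
  \<comment> \<open>Monotonicity and soundness do not involve \<open>Q\<close>. A true equation is
    trivially progressive and gives access to \<open>gam_props\<close>.\<close>
  let ?Q = "Eq N Zero Zero"
  have Q: "wff [N] ?Q" by (simp add: has_type_iff)
  have prog: "progressive ?Q w' []" for w'
  proof -
    have "satl w' [a] ?Q" for w' a by (simp add: satl_def sat_def prv_def HA.EqRefl has_type_iff)
    then show ?thesis by (simp add: progressive_def)
  qed
  let ?P = "less_fm Zero (gam Y \<cdot> Var 0)"
  let ?S = "less_fm Zero (gam Y \<cdot> (seg_tm \<cdot> Var 1 \<cdot> Var 0))"
  have wf: "wff [N, N \<leadsto> N] ?S" "wff [N] ?P" by (rule wff_less_Zero; simp)+
  have 1: "satl w [] (Forall (N \<leadsto> N) (Exists N ?S))"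
    by (subst satl_Forall[of _ _ "[]"]) (use wf satl_gam_positive in simp_all)
  have 2: "satl w [] (Forall N (?P \<^bold>\<longrightarrow> Forall N (Eq N (gam Y \<cdot> Var 1) (gam Y \<cdot> (append_tm \<cdot> Var 1 \<cdot> Var 0)))))"
  proof -
    let ?M = "Eq N (gam Y \<cdot> Var 1) (gam Y \<cdot> (append_tm \<cdot> Var 1 \<cdot> Var 0))"
    have wM: "wff [N, N] ?M" by (simp add: has_type_iff)
    have "satl w' [a] (Forall N ?M)"
      if a: "typed w' a N" and P: "satl w' [a] ?P" for w' a
    proof -
      have l: "tyl w' [a] [N]" using a by simp
      have pos: "app w' (val w' (gam Y)) (val w' a) = sc w' (val w' (pred_tm \<cdot> (gam Y \<cdot> a)))"
        using satl_less_Zero[OF l, of "gam Y \<cdot> Var 0"] P a by simp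
      show ?thesis
      proof (subst satl_Forall[OF l wM], intro allI impI)
        fix w'' b assume w'': "w' \<le> w''" and b: "typed w'' b N"
        let ?m = "pred_tm \<cdot> (gam Y \<cdot> a)"
        note a' = typeof_mono[OF a w'']
        have "val w' (gam Y \<cdot> a) = val w' (Succ \<cdot> ?m)" using pos by simp
        from val_mono[OF this _ w'', of N]
        have pos': "app w'' (val w'' (gam Y)) (val w'' a) = sc w'' (val w'' ?m)" using a by simp
        have mono: "mono_at w'' (gam Y)"
          by (rule gam_props(1)[OF Q _ _ prog, of _ "Lam N Zero"]) simp_all
        have "typed w'' ?m N" using a' by simp
        then have "app w'' (val w'' (gam Y)) (cat w'' (val w'' a) (val w'' b)) = sc w'' (val w'' ?m)"
          using mono a' b pos' order_refl[of w''] unfolding mono_at_def by blast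
        then show "satl w'' [b, a] ?M"
          using pos' a' b by (subst satl_Eq[of _ _ "[N, N]"]) (simp_all del: val_app)
      qed
    qed
    then show ?thesis
      using satl_rule1[of w "[]" "[]" N ?P "Forall N ?M"] wf(2) wM by simp
  qed
  have 3: "satl w [] (Forall (N \<leadsto> N) (Forall N (?S \<^bold>\<longrightarrow>
    Eq N (Y \<cdot> Var 1) (monus_tm \<cdot> (gam Y \<cdot> (seg_tm \<cdot> Var 1 \<cdot> Var 0)) \<cdot> (Succ \<cdot> Zero)))))"
  proof -
    let ?E = "Eq N (Y \<cdot> Var 1) (monus_tm \<cdot> (gam Y \<cdot> (seg_tm \<cdot> Var 1 \<cdot> Var 0)) \<cdot> (Succ \<cdot> Zero))"
    have "satl w' [n, \<alpha>] ?E"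
      if n: "typed w' n N" and \<alpha>: "typed w' \<alpha> (N \<leadsto> N)" and S: "satl w' [n, \<alpha>] ?S"
      for w' n \<alpha>
    proof -
      have l: "tyl w' [n, \<alpha>] [N, N \<leadsto> N]" using n \<alpha> by simp
      let ?m = "pred_tm \<cdot> (gam Y \<cdot> (seg_tm \<cdot> \<alpha> \<cdot> n))"
      have pos: "app w' (val w' (gam Y)) (sg w' (val w' \<alpha>) (val w' n)) = sc w' (val w' ?m)"
        using satl_less_Zero[OF l, of "gam Y \<cdot> (seg_tm \<cdot> Var 1 \<cdot> Var 0)"] S n \<alpha> by simp
      have sound: "sound_at w' (Y \<cdot> \<alpha>) (gam Y) \<alpha>"
        by (rule gam_props(2)[OF Q \<alpha> _ prog]) simp
      have m: "typed w' ?m N" using n \<alpha> by simp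
      \<comment> \<open>Soundness yields the predecessor of the value of \<open>gam Y\<close>, which
        is the same as cut-off subtraction of 1 by \<open>monus_Succ\<close>.\<close>
      then have "val w' (Y \<cdot> \<alpha>) = val w' ?m"
        using sound n pos order_refl[of w'] unfolding sound_at_def by blast
      then show ?thesis
        using n \<alpha> by (subst satl_Eq[OF l]) (simp_all add: monus_Succ)
    qed
    then show ?thesis
      using satl_rule2[of w "[]" "[]" N "N \<leadsto> N" ?S ?E] wf(1) by (simp add: has_type_iff)
  qed
  have "satl w [] (nbhd_of (gam Y) Y)"
    unfolding nbhd_of_def nbhd_def satl_Conj using 1 2 3 by blast
  moreover have "wff [] (nbhd_of (gam Y) Y)"
    using wf by (simp add: nbhd_of_def nbhd_def has_type_iff)
  ultimately show ?thesis
    using satl_vars[of w "nbhd_of (gam Y) Y"] w by (simp add: prv_def)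
qed

end

theorem theorem3p4:
  fixes Y :: tm
  assumes "[] \<turnstile> Y \<Colon> (N \<leadsto> N) \<leadsto> N"
  shows "\<exists>\<gamma>. ([] \<turnstile> \<gamma> \<Colon> Seq \<leadsto> N) \<and>
             HA [] [] (nbhd_of \<gamma> Y) \<and>
             (\<forall>\<Gamma> Q. wff (Seq # \<Gamma>) Q \<longrightarrow> HA \<Gamma> [] (bar_ind \<gamma> Q))"
proof -
  have "typeof [] Y = Some ((N \<leadsto> N) \<leadsto> N)" using assms by (simp add: has_type_iff)
  from gam_type[OF this] HA_nbhd_of[OF this] HA_bar_ind[OF this] show ?thesis
    by (auto simp: has_type_iff)
qed

end
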